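(* Let $\mu$ be a gamma process with law $\mathcal G(d\mu|\theta H)$, $\theta>0$, and let $P(\cdot)=T^{-1}\mu(\cdot)$, where $T=\mu(\mathcal Y)$, so that $P$ is a Dirichlet process with shape $\theta H$. Suppose that $\mathbf Y=\{Y_1,\dots,Y_n\}$ ($n\ge1$) are, conditionally on $P$, i.i.d. with law $P$. Then the posterior distribution of $\mu$ given $\mathbf Y$ is $$\mathcal{BG}\Big(d\mu\Big|\theta H+\sum_{i=1}^n\delta_{Y_i},n\Big)=\frac{\Gamma(\theta+n)}{\Gamma(\theta)}T^{-n}\,\mathcal G\Big(d\mu\Big|\theta H+\sum_{i=1}^n\delta_{Y_i}\Big).$$ For every positive measurable function $g$ with $\int_{\mathcal Y}\log[1+g(y)]\theta H(dy)<\infty$, its Laplace functional (the integral of $e^{-\mu(g)}$ with respect to this law) is $$\int_0^\infty e^{-\int_{\mathcal Y}\log[1+\frac{1}{1+v}g(y)]\theta H(dy)}\prod_{j=1}^{n(\mathbf p)}\Big(1+\frac{1}{1+v}g(Y^*_j)\Big)^{-e_{j,n}}\gamma(dv|\theta+n,n),$$ and it can also be represented as $$\int_0^1 e^{-\int_{\mathcal Y}\log[1+ug(y)]\theta H(dy)}\prod_{j=1}^{n(\mathbf p)}\big(1+ug(Y^*_j)\big)^{-e_{j,n}}\mathcal B(du|\theta,n).$$ Consequently the posterior distribution of $\mu$ given $\mathbf Y$ is equal to the distribution of the random measure $U_nG^*_n$, where $U_n$ is a beta random variable with parameters $(\theta,n)$ and, independent of $U_n$, $G^*_n$ is a gamma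 process with shape $\theta H+\sum_{i=1}^n\delta_{Y_i}$. Moreover $U_n=1/(1+V_n)$, where $V_n$ is a gamma-gamma random variable with parameters $(\theta+n,n)$, i.e. with law $\gamma(dv|\theta+n,n)$.
   Context: $\mathcal Y$ is a Polish space, $\mathcal M$ is the space of boundedly finite measures on $\mathcal Y$, and $H$ is a fixed non-atomic probability measure on $\mathcal Y$. Write $\mu(g)=\int_{\mathcal Y}g(y)\mu(dy)$. For a finite measure $\nu$ on $\mathcal Y$, $\mathcal G(d\mu|\nu)$ is the law on $\mathcal M$ of the gamma process with shape $\nu$, i.e. the random measure $\mu$ with independent values on disjoint sets and $\mu(A)$ gamma distributed with shape $\nu(A)$ and scale $1$; its Laplace functional is $\exp\{-\int\log[1+g(y)]\nu(dy)\}$. The Dirichlet process with shape $\theta H$ is $\mu/\mu(\mathcal Y)$ for $\mu$ with law $\mathcal G(d\mu|\theta H)$. $Y^*_1,\dots,Y^*_{n(\mathbf p)}$ denote the distinct values among $Y_1,\dots,Y_n$; $\mathbf p=\{C_1,\dots,C_{n(\mathbf p)}\}$ is the induced partition of $\{1,\dots,n\}$ with $C_j=\{i:Y_i=Y^*_j\}$, and $e_{j,n}$ is the size of $C_j$. Beta law: $\mathcal B(du|a,b)=\frac{\Gamma(a+b)}{\Gamma(a)\Gamma(b)}u^{a-1}(1-u)^{b-1}du$, $0<u<1$. Gamma-gamma law with parameters $(\tau,q)$, $\tau>q>0$: $\gamma(dv|\tau,q)=\frac{\Gamma(\tau)}{\Gamma(q)\Gamma(\tau-q)}v^{q-1}(1+v)^{-\tau}dv$,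 $0<v<\infty$.
   Formalization: "Conditionally on P, i.i.d. with law P" is taken as: conditionally on μ (of which P = μ/T is a function), the Y_i are i.i.d. with law P. Conditioning on P alone would let Y depend on T, and the stated posterior of μ could then fail. *)

theory Defs
  imports "HOL-Probability.Probability"
begin

section \<open>Random measures\<close>

text \<open>The sigma-algebra is generated by the evaluations at Borel sets, in the style of
  \<^const>\<open>subprob_algebra\<close>. "Bounded" refers to the metric of the Polish space.\<close>

definition bf_measure_algebra :: "'a::metric_space measure measure" where
  "bf_measure_algebra =
     (SUP A \<in> sets borel. vimage_algebra
        {m. sets m = sets borel \<and> (\<forall>B\<in>sets borel. bounded B \<longrightarrow> emeasure m B < \<infinity>)}
        (\<lambda>m. emeasure m A) borel)"

definition non_atomic :: "'a measure \<Rightarrow> bool" where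
  "non_atomic M \<longleftrightarrow> (\<forall>A\<in>sets M. 0 < emeasure M A \<longrightarrow>
     (\<exists>B\<in>sets M. B \<subseteq> A \<and> 0 < emeasure M B \<and> emeasure M B < emeasure M A))"

text \<open>Equal to the zero measure if the total mass is 0 or infinite.\<close>

definition normalize_measure :: "'a measure \<Rightarrow> 'a measure" where
  "normalize_measure m = scale_measure (1 / emeasure m (space m)) m"

section \<open>Laws on the line\<close>

text \<open>Gamma law with scale 1; the law with shape 0 is the point mass at 0.\<close>

definition gamma_law :: "real \<Rightarrow> real measure" where
  "gamma_law a = (if a = 0 then return borel 0
     else density lborel (\<lambda>x. ennreal (indicator {0<..} x * (x powr (a - 1) * exp (- x) / Gamma a))))"

definition beta_law :: "real \<Rightarrow> real \<Rightarrow> real measure" where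
  "beta_law a b = density lborel (\<lambda>u. ennreal (indicator {0<..<1} u *
     (Gamma (a + b) / (Gamma a * Gamma b) * u powr (a - 1) * (1 - u) powr (b - 1))))"

definition gamma_gamma_law :: "real \<Rightarrow> real \<Rightarrow> real measure" where
  "gamma_gamma_law \<tau> q = density lborel (\<lambda>v. ennreal (indicator {0<..} v *
     (Gamma \<tau> / (Gamma q * Gamma (\<tau> - q)) * v powr (q - 1) * (1 + v) powr (- \<tau>))))"

section \<open>Gamma processes and beta-gamma processes\<close>

text \<open>The one-dimensional laws are compared on \<^typ>\<open>ennreal\<close>, so that \<open>X \<omega> A\<close> is almost surely
  finite instead of being truncated to 0 when infinite.\<close>

definition gamma_process :: "'w measure \<Rightarrow> 'a::metric_space measure \<Rightarrow> ('w \<Rightarrow> 'a measure) \<Rightarrow> bool" where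
  "gamma_process M \<nu> X \<longleftrightarrow> prob_space M \<and> X \<in> measurable M bf_measure_algebra \<and>
     (\<forall>F. F \<subseteq> sets borel \<longrightarrow> finite F \<longrightarrow> disjoint F \<longrightarrow>
        prob_space.indep_vars M (\<lambda>_. borel) (\<lambda>A \<omega>. emeasure (X \<omega>) A) F) \<and>
     (\<forall>A\<in>sets borel. distr M borel (\<lambda>\<omega>. emeasure (X \<omega>) A) =
        distr (gamma_law (measure \<nu> A)) borel ennreal)"

definition gamma_process_law :: "'a::metric_space measure \<Rightarrow> 'a measure measure" where
  "gamma_process_law \<nu> =
     (THE Q. sets Q = sets bf_measure_algebra \<and> gamma_process Q \<nu> (\<lambda>m. m))"

text \<open>The gamma process law with shape \<open>\<nu>\<close>, tilted by \<open>T\<^sup>-\<^sup>q\<close> where \<open>T\<close> is the total mass, which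
  is gamma distributed with shape \<open>\<nu>(UNIV)\<close>; the constant is \<open>1 / E[T\<^sup>-\<^sup>q]\<close>, for
  \<open>0 \<le> q < \<nu>(UNIV)\<close>.\<close>

definition beta_gamma_process_law :: "'a::metric_space measure \<Rightarrow> real \<Rightarrow> 'a measure measure" where
  "beta_gamma_process_law \<nu> q = density (gamma_process_law \<nu>)
     (\<lambda>m. ennreal (Gamma (measure \<nu> UNIV) / Gamma (measure \<nu> UNIV - q) * measure m UNIV powr (- q)))"

text \<open>\<open>\<theta> H + \<Sum>i=1..n. \<delta>(y i)\<close>\<close>

definition posterior_shape :: "real \<Rightarrow> 'a::topological_space measure \<Rightarrow> nat \<Rightarrow> (nat \<Rightarrow> 'a) \<Rightarrow> 'a measure" where
  "posterior_shape \<theta> H n y = measure_of UNIV (sets borel)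
     (\<lambda>A. ennreal \<theta> * emeasure H A + (\<Sum>i=1..n. emeasure (return borel (y i)) A))"

lemma sets_posterior_shape [simp]: "sets (posterior_shape \<theta> H n y) = sets borel"
proof -
  have "sigma_sets UNIV (sets (borel :: 'a measure)) = sets borel"
    using sets.sigma_sets_eq[of "borel :: 'a measure"] by simp
  then show ?thesis
    by (simp add: posterior_shape_def sets_measure_of_conv)
qed

lemma emeasure_posterior_shape:
  assumes "sets H = sets borel" "A \<in> sets borel"
  shows "emeasure (posterior_shape \<theta> H n y) A =
    ennreal \<theta> * emeasure H A + (\<Sum>i=1..n. indicator A (y i))"
proof -
  let ?f = "\<lambda>A. ennreal \<theta> * emeasure H A + (\<Sum>i=1..n. emeasure (return borel (y i)) A)"
  have "emeasure (posterior_shape \<theta> H n y) A = ?f A"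
  proof (rule emeasure_measure_of[OF posterior_shape_def])
    show "countably_additive (sets (posterior_shape \<theta> H n y)) ?f"
    proof (rule countably_additiveI)
      fix B :: "nat \<Rightarrow> 'a set"
      assume B: "range B \<subseteq> sets (posterior_shape \<theta> H n y)" "disjoint_family B"
      have "(\<Sum>k. ?f (B k)) = (\<Sum>k. ennreal \<theta> * emeasure H (B k))
          + (\<Sum>k. \<Sum>i=1..n. emeasure (return borel (y i)) (B k))"
        by (rule suminf_add[symmetric]) auto
      also have "\<dots> = ennreal \<theta> * (\<Sum>k. emeasure H (B k))
          + (\<Sum>i=1..n. \<Sum>k. emeasure (return borel (y i)) (B k))"
        by (subst suminf_sum) auto
      also have "\<dots> = ?f (\<Union>k. B k)"
      proof -
        have "(\<Sum>k. emeasure H (B k)) = emeasure H (\<Union>k. B k)"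
          using B assms(1) by (intro suminf_emeasure) auto
        moreover have "(\<Sum>k. emeasure (return borel (y i)) (B k))
            = emeasure (return borel (y i)) (\<Union>k. B k)" for i
          using B by (intro suminf_emeasure) auto
        ultimately show ?thesis by simp
      qed
      finally show "(\<Sum>k. ?f (B k)) = ?f (\<Union>k. B k)" .
    qed
  qed (use assms in \<open>auto simp: positive_def\<close>)
  then show ?thesis
    using assms by simp
qed

section \<open>Laplace functionals\<close>

text \<open>\<open>e\<^sup>-\<^sup>x\<close> on \<open>[0, \<infinity>]\<close>, with value 0 at infinity.\<close>

definition exp_neg :: "ennreal \<Rightarrow> real" where
  "exp_neg x = (if x = \<infinity> then 0 else exp (- enn2real x))"

definition laplace_functional :: "'a measure measure \<Rightarrow> ('a \<Rightarrow> real) \<Rightarrow> real" where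
  "laplace_functional Q g = (\<integral>m. exp_neg (\<integral>\<^sup>+y. ennreal (g y) \<partial>m) \<partial>Q)"

text \<open>The distinct values among \<open>y 1, \<dots>, y n\<close>, and the size of the block of indices at which a value
  is attained.\<close>

definition distinct_values :: "nat \<Rightarrow> (nat \<Rightarrow> 'a) \<Rightarrow> 'a set" where
  "distinct_values n y = y ` {1..n}"

definition block_size :: "nat \<Rightarrow> (nat \<Rightarrow> 'a) \<Rightarrow> 'a \<Rightarrow> nat" where
  "block_size n y z = card {i\<in>{1..n}. y i = z}"

section \<open>Conditional laws\<close>

text \<open>The sigma-algebra on \<open>space M\<close> generated by \<open>X\<close>.\<close>

abbreviation generated_algebra :: "'w measure \<Rightarrow> ('w \<Rightarrow> 'b) \<Rightarrow> 'b measure \<Rightarrow> 'w measure" where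
  "generated_algebra M X S \<equiv> vimage_algebra (space M) X S"

text \<open>Given the sigma-algebra \<open>F\<close>, the variables \<open>Y i\<close> are i.i.d. with (random) law \<open>P\<close>. For data sampled from
  the normalization \<open>P = \<mu> / T\<close> of a random measure \<open>\<mu>\<close>, take \<open>F = \<sigma>(\<mu>)\<close>: with \<open>F = \<sigma>(P)\<close> the
  joint law of \<open>\<mu>\<close> and \<open>Y\<close> is not determined, since \<open>Y\<close> could depend on \<open>T\<close>.\<close>

definition cond_iid ::
  "'w measure \<Rightarrow> 'w measure \<Rightarrow> 'i set \<Rightarrow> ('i \<Rightarrow> 'w \<Rightarrow> 'a::topological_space) \<Rightarrow> ('w \<Rightarrow> 'a measure) \<Rightarrow> bool" where
  "cond_iid M F I Y P \<longleftrightarrow> (\<forall>i\<in>I. Y i \<in> borel_measurable M) \<and>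
     (\<forall>A. (\<forall>i\<in>I. A i \<in> sets borel) \<longrightarrow>
       (AE \<omega> in M. real_cond_exp M F (indicator {\<omega>\<in>space M. \<forall>i\<in>I. Y i \<omega> \<in> A i}) \<omega>
          = (\<Prod>i\<in>I. measure (P \<omega>) (A i))))"

text \<open>\<open>K\<close> is a regular conditional distribution of \<open>X\<close> (values in \<open>S\<close>) given \<open>Y\<close> (values in \<open>T\<close>).\<close>

definition regular_cond_distr ::
  "'w measure \<Rightarrow> ('w \<Rightarrow> 'b) \<Rightarrow> 'b measure \<Rightarrow> ('w \<Rightarrow> 'c) \<Rightarrow> 'c measure \<Rightarrow> ('c \<Rightarrow> 'b measure) \<Rightarrow> bool" where
  "regular_cond_distr M X S Y T K \<longleftrightarrow>
     X \<in> measurable M S \<and> Y \<in> measurable M T \<and> K \<in> measurable T (prob_algebra S) \<and>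
     (\<forall>B\<in>sets S. AE \<omega> in M.
        real_cond_exp M (generated_algebra M Y T) (indicator (X -` B \<inter> space M)) \<omega>
          = measure (K (Y \<omega>)) B)"

text \<open>\<open>U\<close> is beta distributed with parameters \<open>(a, b)\<close>, \<open>G\<close> is a gamma process with shape \<open>\<nu>\<close>, and
  they are independent. (\<^const>\<open>prob_space.indep_var\<close> needs both variables to have the same type,
  so independence is stated for the generated sigma-algebras.)\<close>

definition indep_beta_gamma ::
  "'w measure \<Rightarrow> real \<Rightarrow> real \<Rightarrow> 'a::metric_space measure \<Rightarrow> ('w \<Rightarrow> real) \<Rightarrow> ('w \<Rightarrow> 'a measure) \<Rightarrow> bool" where
  "indep_beta_gamma N a b \<nu> U G \<longleftrightarrow> prob_space N \<and>
     U \<in> borel_measurable N \<and> distr N borel U = beta_law a b \<and>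
     gamma_process N \<nu> G \<and>
     prob_space.indep_set N (sets (generated_algebra N U borel))
       (sets (generated_algebra N G bf_measure_algebra))"

end

theory Submission
  imports Defs
begin

text \<open>The proof computes with the masses that a random measure gives to the cells of a finite Borel
partition. For a gamma process these masses are independent gamma variables, and a finite measure on
the space of boundedly finite measures is determined by the joint laws of such masses
(\<open>bf_measure_eqI\<close>). Every identity between laws of random measures therefore reduces to an identity
between products of gamma densities, and a gamma density \<open>x\<^bsup>a-1\<^esup> e\<^bsup>-x\<^esup> / \<Gamma>(a)\<close> reproduces itself under two
kinds of weights.

The weight \<open>e\<^bsup>-sx\<^esup>\<close> only rescales it. For the whole process, weighting \<open>\<G>(d\<mu>|\<nu>)\<close> by \<open>e\<^bsup>-sT\<^esup>\<close> gives
\<open>(1 + s)\<^bsup>-\<nu>(UNIV)\<^esup>\<close> times the law of \<open>\<mu> / (1 + s)\<close> (\<open>gamma_process_exp_tilt\<close>). Since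
\<open>T\<^bsup>-q\<^esup> = \<Gamma>(q)\<^bsup>-1\<^esup> \<integral> s\<^bsup>q-1\<^esup> e\<^bsup>-sT\<^esup> ds\<close>, the gamma process weighted by \<open>T\<^bsup>-q\<^esup>\<close> is a mixture over \<open>s\<close> of the laws of
\<open>\<mu> / (1 + s)\<close>; the mixing density \<open>s\<^bsup>q-1\<^esup> (1 + s)\<^bsup>-\<nu>(UNIV)\<^esup>\<close> is the gamma-gamma density up to a constant,
and \<open>u = 1 / (1 + s)\<close> is then beta distributed (\<open>beta_gamma_process_law_eq_distr\<close>). This is the
representation \<open>U\<^sub>n G\<^sub>n\<^sup>*\<close>; both formulas for the Laplace functional follow from it by mixing the Laplace functional of the gamma
process over \<open>u\<close>.

The weight \<open>x\<^sup>k\<close> moves the shape from \<open>a\<close> to \<open>a + k\<close>. This gives Bayes' formula. Given \<open>\<mu>\<close>, the event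
\<open>Y\<^sub>1 \<in> A\<^sub>1, \<dots>, Y\<^sub>n \<in> A\<^sub>n\<close> has probability \<open>T\<^bsup>-n\<^esup> \<Prod> \<mu>(A\<^sub>i)\<close>. If the \<open>A\<^sub>i\<close> are cells of a partition, the
factor \<open>\<Prod> \<mu>(A\<^sub>i)\<close> is a product of powers of cell masses, and for events that depend on the cell masses
alone it turns the shape \<open>\<theta> H\<close> into \<open>\<theta> H + \<Sum> \<delta>(y\<^sub>i)\<close>, whatever points \<open>y\<^sub>i \<in> A\<^sub>i\<close> are chosen
(\<open>gamma_process_power_tilt\<close>); the factor \<open>T\<^bsup>-n\<^esup>\<close> remains and makes the law beta-gamma
(\<open>bayes_on_cells\<close>). General events are reached by refining the partition and by two applications of
the \<open>\<pi>\<close>-\<open>\<lambda>\<close> theorem.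

A gamma process with the posterior shape exists because independent exponential masses can be added
at the points \<open>y\<^sub>i\<close> (\<open>gamma_process_add_atom\<close>).\<close>

section \<open>The exponential on the extended half-line\<close>

lemma exp_neg_ennreal: "x \<ge> 0 \<Longrightarrow> exp_neg (ennreal x) = exp (- x)"
  by (simp add: exp_neg_def)

lemma exp_neg_nonneg [simp]: "0 \<le> exp_neg x"
  by (simp add: exp_neg_def)

lemma exp_neg_le_1: "exp_neg x \<le> 1"
  by (simp add: exp_neg_def)

lemma borel_measurable_exp_neg [measurable]: "exp_neg \<in> borel_measurable borel"
  unfolding exp_neg_def[abs_def] by measurable

lemma exp_neg_0 [simp]: "exp_neg 0 = 1"
  by (simp add: exp_neg_def)

lemma exp_neg_add: "exp_neg (x + y) = exp_neg x * exp_neg y"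
  by (cases x; cases y) (auto simp: exp_neg_def enn2real_plus mult_exp_exp simp flip: ennreal_plus)

lemma exp_neg_sum: "exp_neg (sum f I) = (\<Prod>i\<in>I. exp_neg (f i))"
  by (induction I rule: infinite_finite_induct) (auto simp: exp_neg_add)

section \<open>Gamma laws on the line\<close>

text \<open>The masses of a random measure lie in \<open>[0, \<infinity>]\<close>; all computations with gamma laws use this copy of the
gamma law there.\<close>

definition gamma_mass_law :: "real \<Rightarrow> ennreal measure" where
  "gamma_mass_law a = distr (gamma_law a) borel ennreal"

lemma sets_gamma_law [simp, measurable_cong]: "sets (gamma_law a) = sets borel"
  by (simp add: gamma_law_def)

lemma sets_gamma_mass_law [simp, measurable_cong]: "sets (gamma_mass_law a) = sets borel"
  by (simp add: gamma_mass_law_def)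

lemma space_gamma_mass_law [simp]: "space (gamma_mass_law a) = UNIV"
  by (simp add: gamma_mass_law_def)

lemma nn_integral_gamma_mass_law_0:
  assumes [measurable]: "f \<in> borel_measurable borel"
  shows "(\<integral>\<^sup>+x. f x \<partial>gamma_mass_law 0) = f 0"
  by (simp add: gamma_mass_law_def gamma_law_def nn_integral_distr nn_integral_return)

lemma nn_integral_gamma_mass_law:
  assumes "a > 0" and [measurable]: "f \<in> borel_measurable borel"
  shows "(\<integral>\<^sup>+x. f x \<partial>gamma_mass_law a) =
    (\<integral>\<^sup>+x. ennreal (indicator {0<..} x * (x powr (a - 1) * exp (- x) / Gamma a)) * f (ennreal x) \<partial>lborel)"
  using assms(1) by (simp add: gamma_mass_law_def gamma_law_def nn_integral_distr nn_integral_density)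

text \<open>Euler's integral after the substitution \<open>s \<mapsto> t s\<close>. It expresses \<open>t\<^bsup>-q\<^esup>\<close> as a mixture of the
exponentials \<open>e\<^bsup>-st\<^esup>\<close>, for which the weighted gamma process is known.\<close>

lemma nn_integral_Gamma:
  assumes "q > 0" "t > 0"
  shows "(\<integral>\<^sup>+s. ennreal (indicator {0<..} s * (s powr (q - 1) * exp (- (s * t)))) \<partial>lborel)
    = ennreal (Gamma q * t powr (- q))"
proof -
  let ?f = "\<lambda>s. ennreal (indicator {0<..} s * (s powr (q - 1) * exp (- s)))"
  have "ennreal (Gamma q) = (\<integral>\<^sup>+s. ennreal (indicator {0..} s * s powr (q - 1) / exp s) \<partial>lborel)"
    by (rule Gamma_conv_nn_integral_real[OF assms(1)])
  also have "\<dots> = (\<integral>\<^sup>+s. ?f s \<partial>lborel)"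
    by (intro nn_integral_cong arg_cong[where f=ennreal]) (auto simp: indicator_def exp_minus field_simps)
  also have "\<dots> = ennreal t * (\<integral>\<^sup>+s. ?f (0 + t * s) \<partial>lborel)"
    using assms by (subst nn_integral_real_affine[where c=t and t=0]) auto
  also have "(\<integral>\<^sup>+s. ?f (0 + t * s) \<partial>lborel)
    = (\<integral>\<^sup>+s. ennreal (t powr (q - 1)) *
         ennreal (indicator {0<..} s * (s powr (q - 1) * exp (- (s * t)))) \<partial>lborel)"
    using assms by (intro nn_integral_cong)
      (auto simp: ennreal_mult[symmetric] indicator_def powr_mult zero_less_mult_iff mult.commute)
  also have "\<dots> = ennreal (t powr (q - 1)) *
      (\<integral>\<^sup>+s. ennreal (indicator {0<..} s * (s powr (q - 1) * exp (- (s * t)))) \<partial>lborel)" (is "_ = _ * ?I")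
    by (rule nn_integral_cmult) auto
  finally have *: "ennreal (Gamma q) = ennreal (t powr q) * ?I"
    using assms by (simp add: mult.assoc[symmetric] ennreal_mult[symmetric] powr_mult_base)
  have "ennreal (Gamma q * t powr (- q)) = ennreal (t powr (- q)) * ennreal (Gamma q)"
    using assms by (subst ennreal_mult[symmetric]) (auto simp: mult.commute)
  also have "\<dots> = ennreal (t powr (- q) * t powr q) * ?I"
    unfolding * by (simp add: mult.assoc ennreal_mult)
  also have "t powr (- q) * t powr q = 1"
    using assms by (simp add: powr_add[symmetric])
  finally show ?thesis by simp
qed

lemma prob_space_gamma_law: assumes "a \<ge> 0" shows "prob_space (gamma_law a)"
proof (cases "a = 0")
  case True
  then show ?thesis by (simp add: gamma_law_def prob_space_return)
next
  case False
  with assms have a: "a > 0" by simp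
  have "(\<integral>\<^sup>+x. ennreal (indicator {0<..} x * (x powr (a - 1) * exp (- x) / Gamma a)) \<partial>lborel)
    = (\<integral>\<^sup>+x. ennreal (inverse (Gamma a)) *
        ennreal (indicator {0<..} x * (x powr (a - 1) * exp (- (x * 1)))) \<partial>lborel)"
    using a by (intro nn_integral_cong) (auto simp: ennreal_mult[symmetric] field_simps)
  also have "\<dots> = ennreal (inverse (Gamma a)) * ennreal (Gamma a * 1 powr (- a))"
    using a by (subst nn_integral_cmult) (auto simp del: mult_1_right simp: nn_integral_Gamma)
  also have "\<dots> = 1"
    using less_imp_neq[OF Gamma_real_pos[OF a]] a by (simp add: ennreal_mult[symmetric])
  finally show ?thesis
    using a by (intro prob_spaceI) (simp add: gamma_law_def emeasure_density)
qed

lemma prob_space_gamma_mass_law: "a \<ge> 0 \<Longrightarrow> prob_space (gamma_mass_law a)"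
  unfolding gamma_mass_law_def
  by (intro prob_space.prob_space_distr prob_space_gamma_law) auto

text \<open>The product \<open>e\<^bsup>-sx\<^esup> x\<^bsup>a-1\<^esup> e\<^bsup>-x\<^esup>\<close> is a gamma density in the variable \<open>(1 + s) x\<close>. The test function \<open>f\<close>
turns the statement into one about measures.\<close>

lemma gamma_mass_law_exp_tilt:
  assumes a: "a \<ge> 0" and s: "s \<ge> 0" and [measurable]: "f \<in> borel_measurable borel"
  shows "(\<integral>\<^sup>+x. ennreal (exp_neg (ennreal s * x)) * f x \<partial>gamma_mass_law a)
    = ennreal ((1 + s) powr (- a)) * (\<integral>\<^sup>+x. f (ennreal (1 / (1 + s)) * x) \<partial>gamma_mass_law a)"
proof (cases "a = 0")
  case True
  with s show ?thesis by (simp add: nn_integral_gamma_mass_law_0)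
next
  case False
  with a have a: "a > 0" by simp
  let ?d = "\<lambda>x. indicator {0<..} x * (x powr (a - 1) * exp (- x) / Gamma a) :: real"
  let ?F = "\<lambda>x. ennreal (?d x) * f (ennreal (1 / (1 + s)) * ennreal x)"
  have "ennreal ((1 + s) powr (- a)) * (\<integral>\<^sup>+x. f (ennreal (1 / (1 + s)) * x) \<partial>gamma_mass_law a)
    = ennreal ((1 + s) powr (- a)) * (\<integral>\<^sup>+x. ?F x \<partial>lborel)"
    using a by (simp add: nn_integral_gamma_mass_law)
  also have "(\<integral>\<^sup>+x. ?F x \<partial>lborel) = ennreal (1 + s) * (\<integral>\<^sup>+x. ?F (0 + (1 + s) * x) \<partial>lborel)"
    using s by (subst nn_integral_real_affine[where c="1 + s" and t=0]) auto
  also have "ennreal ((1 + s) powr (- a)) * \<dots> =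
    (\<integral>\<^sup>+x. ennreal ((1 + s) powr (- a) * (1 + s)) * ?F ((1 + s) * x) \<partial>lborel)"
    using s by (subst nn_integral_cmult) (auto simp: ennreal_mult mult.assoc)
  also have "\<dots> = (\<integral>\<^sup>+x. ennreal (?d x) * (ennreal (exp_neg (ennreal s * ennreal x)) * f (ennreal x)) \<partial>lborel)"
  proof (intro nn_integral_cong)
    fix x :: real
    show "ennreal ((1 + s) powr (- a) * (1 + s)) * ?F ((1 + s) * x)
      = ennreal (?d x) * (ennreal (exp_neg (ennreal s * ennreal x)) * f (ennreal x))"
    proof (cases "x > 0")
      case True
      have "(1 + s) powr (- a) * (1 + s) * ?d ((1 + s) * x) = ?d x * exp (- (s * x))"
      proof -
        have "(1 + s) powr (- a) * (1 + s) * (1 + s) powr (a - 1) = 1"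
          using s by (simp add: powr_diff powr_minus divide_simps)
        moreover have "exp (- ((1 + s) * x)) = exp (- x) * exp (- (s * x))"
          by (simp add: exp_add[symmetric] algebra_simps)
        moreover have "?d ((1 + s) * x) = (1 + s) powr (a - 1) * x powr (a - 1) * exp (- ((1 + s) * x)) / Gamma a"
          using True s by (simp add: powr_mult)
        moreover have "?d x = x powr (a - 1) * exp (- x) / Gamma a" using True by simp
        moreover have "A * (B * X * (E1 * E2) / G) = X * E1 / G * E2" if "A * B = 1" for A B X E1 E2 G :: real
        proof -
          have "A * (B * X * (E1 * E2) / G) = (A * B) * (X * E1 / G * E2)" by simp
          then show ?thesis by (simp only: that mult_1)
        qed
        ultimately show ?thesis by (simp only:)
      qed
      moreover have "ennreal (1 / (1 + s)) * ennreal ((1 + s) * x) = ennreal x"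
        using s True by (simp add: ennreal_mult[symmetric])
      moreover have "exp_neg (ennreal s * ennreal x) = exp (- (s * x))"
        using s True by (simp add: ennreal_mult[symmetric] exp_neg_ennreal)
      moreover have "?d x \<ge> 0" "?d ((1 + s) * x) \<ge> 0" using a by auto
      ultimately show ?thesis
        using s by (simp only: mult.assoc[symmetric] ennreal_mult[symmetric] exp_ge_zero
            powr_ge_zero mult_nonneg_nonneg add_nonneg_nonneg zero_le_one)
    next
      case False
      with s have "(1 + s) * x \<le> 0" by (simp add: mult_nonneg_nonpos)
      with False show ?thesis by auto
    qed
  qed
  also have "\<dots> = (\<integral>\<^sup>+x. ennreal (exp_neg (ennreal s * x)) * f x \<partial>gamma_mass_law a)"
    using a by (simp add: nn_integral_gamma_mass_law)
  finally show ?thesis ..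
qed

text \<open>The product \<open>x\<^sup>k x\<^bsup>a-1\<^esup> e\<^bsup>-x\<^esup>\<close> is a gamma density of shape \<open>a + k\<close>, and the ratio of the normalizing
constants is the rising factorial. For \<open>a = 0\<close> and \<open>k > 0\<close> both sides vanish.\<close>

lemma gamma_mass_law_power_tilt:
  assumes a: "a \<ge> 0" and [measurable]: "f \<in> borel_measurable borel"
  shows "(\<integral>\<^sup>+x. x ^ k * f x \<partial>gamma_mass_law a)
    = ennreal (pochhammer a k) * (\<integral>\<^sup>+x. f x \<partial>gamma_mass_law (a + real k))"
proof (cases "a = 0")
  case True
  then show ?thesis
    by (cases "k = 0") (auto simp: nn_integral_gamma_mass_law_0 pochhammer_0_left)
next
  case False
  with a have a: "a > 0" by simp
  have G: "Gamma (a + real k) = pochhammer a k * Gamma a"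
    using a pochhammer_Gamma[of a k] Gamma_real_pos[OF a] nonpos_Ints_nonpos[of a]
    by (force simp: field_simps)
  have pos: "Gamma a > 0" "Gamma (a + real k) > 0" "pochhammer a k > 0"
    using a by (auto intro!: Gamma_real_pos pochhammer_pos)
  have "ennreal (pochhammer a k) * (\<integral>\<^sup>+x. f x \<partial>gamma_mass_law (a + real k)) =
     (\<integral>\<^sup>+x. ennreal (pochhammer a k) * (ennreal (indicator {0<..} x *
        (x powr (a + real k - 1) * exp (- x) / Gamma (a + real k))) * f (ennreal x)) \<partial>lborel)"
    using a by (subst nn_integral_cmult) (auto simp: nn_integral_gamma_mass_law)
  also have "\<dots> = (\<integral>\<^sup>+x. ennreal (indicator {0<..} x * (x powr (a - 1) * exp (- x) / Gamma a)) *
        (ennreal x ^ k * f (ennreal x)) \<partial>lborel)"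
  proof (intro nn_integral_cong)
    fix x :: real
    show "ennreal (pochhammer a k) * (ennreal (indicator {0<..} x *
        (x powr (a + real k - 1) * exp (- x) / Gamma (a + real k))) * f (ennreal x)) =
      ennreal (indicator {0<..} x * (x powr (a - 1) * exp (- x) / Gamma a)) *
        (ennreal x ^ k * f (ennreal x))"
    proof (cases "x > 0")
      case True
      have "x powr (a + real k - 1) = x powr (a - 1) * x ^ k"
        using True by (simp add: powr_diff powr_add powr_realpow field_simps)
      then have "pochhammer a k * (x powr (a + real k - 1) * exp (- x) / Gamma (a + real k))
        = (x powr (a - 1) * exp (- x) / Gamma a) * x ^ k"
        using pos unfolding G by simp
      moreover have "0 \<le> x powr (a - 1) * exp (- x) / Gamma a"
        "0 \<le> x powr (a + real k - 1) * exp (- x) / Gamma (a + real k)" "0 \<le> x ^ k" "0 \<le> pochhammer a k"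
        using pos True by (auto intro: less_imp_le)
      ultimately show ?thesis
        using True by (simp add: mult.assoc[symmetric] ennreal_mult[symmetric] ennreal_power)
    qed auto
  qed
  also have "\<dots> = (\<integral>\<^sup>+x. x ^ k * f x \<partial>gamma_mass_law a)"
    using a by (simp add: nn_integral_gamma_mass_law)
  finally show ?thesis ..
qed

lemma nn_integral_powr_Ioo:
  assumes "a > 0"
  shows "(\<integral>\<^sup>+x. ennreal (if 0 < x \<and> x < w then x powr (a - 1) else 0) \<partial>lborel)
    = ennreal (indicator {0<..} w * (w powr a / a))"
proof (cases "w > 0")
  case True
  have "((\<lambda>x. x powr (a - 1)) has_integral w powr (a - 1 + 1) / (a - 1 + 1)) {0..w}"
    using assms True by (intro has_integral_powr_from_0) auto
  then have "((\<lambda>x. x powr (a - 1)) has_integral w powr a / a) {0<..<w}"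
    by (simp add: has_integral_Icc_iff_Ioo)
  then have "(\<integral>\<^sup>+x. ennreal (indicator {0<..<w} x * x powr (a - 1)) \<partial>lborel) = ennreal (w powr a / a)"
    by (intro nn_integral_has_integral_lebesgue) auto
  also have "(\<lambda>x. indicator {0<..<w} x * x powr (a - 1)) = (\<lambda>x. if 0 < x \<and> x < w then x powr (a - 1) else 0)"
    by (auto simp: indicator_def fun_eq_iff)
  finally show ?thesis using True by simp
qed (auto intro!: nn_integral_0_iff_AE[THEN iffD2])

text \<open>Gamma laws of shapes \<open>a\<close> and \<open>1\<close> convolve to shape \<open>a + 1\<close>: with \<open>w = x + z\<close> the inner integral is
\<open>\<integral>\<^sub>0\<^sup>w x\<^bsup>a-1\<^esup> dx = w\<^sup>a / a\<close>.\<close>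

lemma gamma_mass_law_convolution_1:
  assumes a: "a \<ge> 0" and [measurable]: "f \<in> borel_measurable borel"
  shows "(\<integral>\<^sup>+x. \<integral>\<^sup>+z. f (x + z) \<partial>gamma_mass_law 1 \<partial>gamma_mass_law a)
    = (\<integral>\<^sup>+x. f x \<partial>gamma_mass_law (a + 1))"
proof (cases "a = 0")
  case True
  have [measurable]: "(\<lambda>x. \<integral>\<^sup>+z. f (x + z) \<partial>gamma_mass_law 1) \<in> borel_measurable borel"
    by (intro sigma_finite_measure.borel_measurable_nn_integral prob_space_imp_sigma_finite
        prob_space_gamma_mass_law) auto
  show ?thesis unfolding True by (subst nn_integral_gamma_mass_law_0) auto
next
  case False
  with a have a: "a > 0" by simp
  let ?i = "\<lambda>x w. ennreal (if 0 < x \<and> x < w then x powr (a - 1) else 0) * (ennreal (exp (- w) / Gamma a) * f (ennreal w))"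
  have [measurable]: "(\<lambda>x. \<integral>\<^sup>+z. f (x + z) \<partial>gamma_mass_law 1) \<in> borel_measurable borel"
    by (intro sigma_finite_measure.borel_measurable_nn_integral prob_space_imp_sigma_finite
        prob_space_gamma_mass_law) auto
  have G1: "Gamma (a + 1) = a * Gamma a"
    using a by (intro Gamma_plus1) (auto dest: nonpos_Ints_nonpos)
  have "(\<integral>\<^sup>+x. \<integral>\<^sup>+z. f (x + z) \<partial>gamma_mass_law 1 \<partial>gamma_mass_law a)
    = (\<integral>\<^sup>+x. ennreal (indicator {0<..} x * (x powr (a - 1) * exp (- x) / Gamma a)) *
        (\<integral>\<^sup>+z. ennreal (indicator {0<..} z * exp (- z)) * f (ennreal x + ennreal z) \<partial>lborel) \<partial>lborel)"
    using a by (simp add: nn_integral_gamma_mass_law powr_0 cong: if_cong)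
      (auto intro!: nn_integral_cong arg_cong2[where f="(*)"] simp: indicator_def)
  also have "\<dots> = (\<integral>\<^sup>+x. \<integral>\<^sup>+w. ?i x w \<partial>lborel \<partial>lborel)"
  proof (intro nn_integral_cong)
    fix x :: real
    have "(\<integral>\<^sup>+z. ennreal (indicator {0<..} z * exp (- z)) * f (ennreal x + ennreal z) \<partial>lborel)
      = (\<integral>\<^sup>+w. ennreal (indicator {0<..} (- x + 1 * w) * exp (- (- x + 1 * w))) * f (ennreal x + ennreal (- x + 1 * w)) \<partial>lborel)"
      by (subst nn_integral_real_affine[where c=1 and t="- x"]) auto
    then show "ennreal (indicator {0<..} x * (x powr (a - 1) * exp (- x) / Gamma a)) *
        (\<integral>\<^sup>+z. ennreal (indicator {0<..} z * exp (- z)) * f (ennreal x + ennreal z) \<partial>lborel)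
      = (\<integral>\<^sup>+w. ?i x w \<partial>lborel)"
    proof (simp only:, subst nn_integral_cmult[symmetric], goal_cases)
      case 2
      show ?case
      proof (intro nn_integral_cong)
        fix w :: real
        show "ennreal (indicator {0<..} x * (x powr (a - 1) * exp (- x) / Gamma a)) *
          (ennreal (indicator {0<..} (- x + 1 * w) * exp (- (- x + 1 * w))) * f (ennreal x + ennreal (- x + 1 * w))) = ?i x w"
        proof (cases "0 < x \<and> x < w")
          case True
          then have "ennreal x + ennreal (- x + 1 * w) = ennreal w"
            by (simp add: ennreal_plus[symmetric] del: ennreal_plus)
          moreover have "exp (- x) * exp (- (- x + 1 * w)) = exp (- w)"
            by (simp add: exp_add[symmetric])
          then have "(x powr (a - 1) * exp (- x) / Gamma a) * exp (- (- x + 1 * w)) = x powr (a - 1) * (exp (- w) / Gamma a)"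
            by (simp only: times_divide_eq_left times_divide_eq_right mult.assoc)
          then have "ennreal (x powr (a - 1) * exp (- x) / Gamma a) * ennreal (exp (- (- x + 1 * w)))
              = ennreal (x powr (a - 1)) * ennreal (exp (- w) / Gamma a)"
            using a by (simp only: ennreal_mult[symmetric] powr_ge_zero exp_ge_zero Gamma_real_nonneg
                divide_nonneg_nonneg mult_nonneg_nonneg less_imp_le)
          ultimately show ?thesis
            using True by (simp add: mult.assoc[symmetric])
        next
          case False
          then have "indicator {0<..} x = (0::real) \<or> indicator {0<..} (- x + 1 * w) = (0::real)"
            by (auto simp: indicator_def)
          with False show ?thesis by (elim disjE) (simp_all add: if_not_P[OF False] del: mult_1)
        qed
      qed
    qed auto
  qed
  also have "\<dots> = (\<integral>\<^sup>+w. \<integral>\<^sup>+x. ?i x w \<partial>lborel \<partial>lborel)"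
    by (rule lborel_pair.Fubini') measurable
  also have "\<dots> = (\<integral>\<^sup>+w. ennreal (indicator {0<..} w * (w powr (a + 1 - 1) * exp (- w) / Gamma (a + 1))) * f (ennreal w) \<partial>lborel)"
  proof (intro nn_integral_cong)
    fix w :: real
    have "(\<integral>\<^sup>+x. ?i x w \<partial>lborel) = ennreal (indicator {0<..} w * (w powr a / a)) * (ennreal (exp (- w) / Gamma a) * f (ennreal w))"
      using a by (subst nn_integral_multc) (auto simp: nn_integral_powr_Ioo)
    also have "\<dots> = ennreal (indicator {0<..} w * (w powr (a + 1 - 1) * exp (- w) / Gamma (a + 1))) * f (ennreal w)"
    proof (cases "w > 0")
      case True
      have "w powr a / a * (exp (- w) / Gamma a) = w powr (a + 1 - 1) * exp (- w) / Gamma (a + 1)"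
        unfolding G1 by simp
      then have "ennreal (w powr a / a) * ennreal (exp (- w) / Gamma a)
          = ennreal (w powr (a + 1 - 1) * exp (- w) / Gamma (a + 1))"
        using a by (subst ennreal_mult[symmetric]) auto
      with True show ?thesis by (simp add: mult.assoc[symmetric])
    qed simp
    finally show "(\<integral>\<^sup>+x. ?i x w \<partial>lborel) = \<dots>" .
  qed
  also have "\<dots> = (\<integral>\<^sup>+x. f x \<partial>gamma_mass_law (a + 1))"
    using a by (simp add: nn_integral_gamma_mass_law)
  finally show ?thesis .
qed

section \<open>Beta and gamma-gamma laws\<close>

text \<open>The change of variables \<open>u = 1 / (1 + v)\<close> between \<open>(0, \<infinity>)\<close> and \<open>(0, 1)\<close>, with Jacobian \<open>(1 + v)\<^bsup>-2\<^esup>\<close>. The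
two measures are compared on the half-lines \<open>(x, \<infinity>)\<close>, where the primitive \<open>-1 / (1 + v)\<close> gives both
values.\<close>

lemma distr_density_Ioi:
  "distr (density lborel (\<lambda>v. ennreal (indicator {0<..} v * (1 + v) powr (- 2)))) borel (\<lambda>v. 1 / (1 + v :: real))
    = density lborel (\<lambda>u. ennreal (indicator {0<..<1} u))" (is "?L = ?R")
proof (rule measure_eqI_lessThan)
  have D: "DERIV (\<lambda>v. - 1 / (1 + v)) v :> (1 + v) powr (- 2)" if "v \<ge> 0" for v :: real
    using that by (auto intro!: derivative_eq_intros simp: powr_minus powr_numeral power2_eq_square field_simps)
  have tot: "(\<integral>\<^sup>+v. ennreal ((1 + v) powr (- 2)) * indicator {0..} v \<partial>lborel) = ennreal (0 - (- 1 / (1 + 0)))"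
  proof (rule nn_integral_FTC_atLeast)
    show "((\<lambda>v::real. - 1 / (1 + v)) \<longlongrightarrow> 0) at_top" by real_asymp
  qed (use D in auto)
  fix x :: real
  have L: "emeasure ?L {x<..} =
     (\<integral>\<^sup>+v. ennreal (indicator {0<..} v * (1 + v) powr (- 2)) * indicator {x<..} (1 / (1 + v)) \<partial>lborel)"
    by (simp add: nn_integral_distr nn_integral_density flip: nn_integral_indicator)
  have R: "emeasure ?R {x<..} = emeasure lborel ({x<..} \<inter> {0<..<1})"
    by (subst emeasure_density)
       (auto simp: nn_integral_indicator[symmetric] simp del: nn_integral_indicator
         intro!: nn_integral_cong split: split_indicator)
  show "emeasure ?L {x<..} = emeasure ?R {x<..}"
  proof (cases "x \<le> 0")
    case True
    have "emeasure ?L {x<..} = (\<integral>\<^sup>+v. ennreal ((1 + v) powr (- 2)) * indicator {0..} v \<partial>lborel)"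
    proof -
      have "x < 1 / (1 + v)" if "v \<ge> 0" for v
        using that by (intro le_less_trans[OF True]) simp
      then show ?thesis
        unfolding L
        by (intro nn_integral_cong_AE AE_I[where N="{0}"]) (auto simp: indicator_def split: if_splits)
    qed
    also have "\<dots> = 1" unfolding tot by simp
    also have "{x<..} \<inter> {0<..<1} = {0<..<1}" using True by auto
    then have "1 = emeasure ?R {x<..}" unfolding R by simp
    finally show ?thesis .
  next
    case x0: False
    show ?thesis
    proof (cases "x < 1")
      case True
      have "emeasure ?L {x<..} = (\<integral>\<^sup>+v. ennreal ((1 + v) powr (- 2)) * indicator {0..1 / x - 1} v \<partial>lborel)"
        unfolding L using True x0
        by (intro nn_integral_cong_AE AE_I[where N="{0, 1 / x - 1}"])
           (auto simp: indicator_def field_simps emeasure_lborel_countable split: if_splits)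
      also have "\<dots> = ennreal (- 1 / (1 + (1 / x - 1)) - (- 1 / (1 + 0)))"
        using x0 True D by (intro nn_integral_FTC_Icc) (auto intro: has_field_derivative_at_within)
      also have "\<dots> = ennreal (1 - x)" using x0 by (intro arg_cong[where f=ennreal]) simp
      also have "{x<..} \<inter> {0<..<1} = {x<..<1}" using x0 by auto
      then have "ennreal (1 - x) = emeasure ?R {x<..}" unfolding R using True by simp
      finally show ?thesis .
    next
      case False
      have "emeasure ?L {x<..} = 0"
      proof -
        have "1 / (1 + v) \<le> 1" if "v > 0" for v :: real
          using that by simp
        then have "1 / (1 + v) \<notin> {x<..}" if "v > 0" for v :: real
          using that False by (smt (verit) greaterThan_iff)
        then have "ennreal (indicator {0<..} v * (1 + v) powr (- 2)) * indicator {x<..} (1 / (1 + v)) = 0" for v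
          by (cases "v > 0") (simp_all del: greaterThan_iff add: greaterThan_iff[of v 0])
        then show ?thesis unfolding L by (simp only: nn_integral_const mult_zero_left)
      qed
      moreover have "{x<..} \<inter> {0<..<1} = {}" using False by auto
      then have "emeasure ?R {x<..} = 0" unfolding R by simp
      ultimately show ?thesis by simp
    qed
  qed
  have "emeasure ?R {x<..} \<le> emeasure lborel {0<..<1::real}"
    unfolding R by (intro emeasure_mono) auto
  then show "emeasure ?L {x<..} < \<infinity>"
    using \<open>emeasure ?L {x<..} = emeasure ?R {x<..}\<close> by (auto intro: le_less_trans)
qed auto

lemma distr_gamma_gamma_law:
  assumes q: "0 < q" "q < \<tau>"
  shows "distr (gamma_gamma_law \<tau> q) borel (\<lambda>v. 1 / (1 + v)) = beta_law (\<tau> - q) q"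
proof (rule measure_eqI)
  fix A assume "A \<in> sets (distr (gamma_gamma_law \<tau> q) borel (\<lambda>v. 1 / (1 + v)))"
  then have [measurable]: "A \<in> sets borel" by simp
  let ?\<phi> = "\<lambda>u. Gamma \<tau> / (Gamma (\<tau> - q) * Gamma q) * u powr (\<tau> - q - 1) * (1 - u) powr (q - 1)"
  have pos: "Gamma \<tau> > 0" "Gamma q > 0" "Gamma (\<tau> - q) > 0"
    using q by (auto intro!: Gamma_real_pos)
  have "emeasure (distr (gamma_gamma_law \<tau> q) borel (\<lambda>v. 1 / (1 + v))) A
    = (\<integral>\<^sup>+v. ennreal (indicator {0<..} v * (Gamma \<tau> / (Gamma q * Gamma (\<tau> - q)) * v powr (q - 1) *
         (1 + v) powr (- \<tau>))) * indicator A (1 / (1 + v)) \<partial>lborel)"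
    by (simp add: gamma_gamma_law_def nn_integral_distr nn_integral_density flip: nn_integral_indicator)
  also have "\<dots> = (\<integral>\<^sup>+v. ennreal (indicator {0<..} v * (1 + v) powr (- 2)) *
      (ennreal (?\<phi> (1 / (1 + v))) * indicator A (1 / (1 + v))) \<partial>lborel)"
  proof (intro nn_integral_cong)
    fix v :: real
    show "ennreal (indicator {0<..} v * (Gamma \<tau> / (Gamma q * Gamma (\<tau> - q)) * v powr (q - 1) *
         (1 + v) powr (- \<tau>))) * indicator A (1 / (1 + v)) =
       ennreal (indicator {0<..} v * (1 + v) powr (- 2)) *
      (ennreal (?\<phi> (1 / (1 + v))) * indicator A (1 / (1 + v)))"
    proof (cases "v > 0")
      case True
      have "1 - 1 / (1 + v) = v / (1 + v)" using True by (simp add: field_simps)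
      then have "(1 - 1 / (1 + v)) powr (q - 1) = v powr (q - 1) * (1 + v) powr (- (q - 1))"
        using True by (simp only: powr_divide powr_minus_divide) simp
      moreover have "(1 / (1 + v)) powr (\<tau> - q - 1) = (1 + v) powr (- (\<tau> - q - 1))"
        using True by (simp only: powr_divide powr_minus_divide) simp
      moreover have "(1 + v) powr (- 2) * ((1 + v) powr (- (\<tau> - q - 1)) * (1 + v) powr (- (q - 1))) = (1 + v) powr (- \<tau>)"
        using True by (simp flip: powr_add)
      ultimately have "(1 + v) powr (- 2) * ?\<phi> (1 / (1 + v)) =
         Gamma \<tau> / (Gamma q * Gamma (\<tau> - q)) * v powr (q - 1) * (1 + v) powr (- \<tau>)"
        by (simp add: mult_ac)
      moreover have "?\<phi> (1 / (1 + v)) \<ge> 0" using pos by simp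
      ultimately show ?thesis
        using True by (simp add: mult.assoc[symmetric] ennreal_mult[symmetric] del: times_divide_eq_left)
    qed auto
  qed
  also have "\<dots> = (\<integral>\<^sup>+u. ennreal (?\<phi> u) * indicator A u \<partial>distr (density lborel
       (\<lambda>v. ennreal (indicator {0<..} v * (1 + v) powr (- 2)))) borel (\<lambda>v. 1 / (1 + v :: real)))"
    by (simp add: nn_integral_distr nn_integral_density)
  also have "\<dots> = (\<integral>\<^sup>+u. ennreal (indicator {0<..<1} u) * (ennreal (?\<phi> u) * indicator A u) \<partial>lborel)"
    unfolding distr_density_Ioi by (simp add: nn_integral_density)
  also have "\<dots> = emeasure (beta_law (\<tau> - q) q) A"
    unfolding beta_law_def
    by (subst emeasure_density) (auto intro!: nn_integral_cong simp: indicator_def)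
  finally show "emeasure (distr (gamma_gamma_law \<tau> q) borel (\<lambda>v. 1 / (1 + v))) A =
    emeasure (beta_law (\<tau> - q) q) A" .
qed (simp add: beta_law_def)

lemma sets_beta_law [simp, measurable_cong]: "sets (beta_law a b) = sets borel"
  by (simp add: beta_law_def)

lemma sets_gamma_gamma_law [simp, measurable_cong]: "sets (gamma_gamma_law a b) = sets borel"
  by (simp add: gamma_gamma_law_def)

text \<open>The map \<open>u \<mapsto> 1 / u - 1\<close> inverts \<open>v \<mapsto> 1 / (1 + v)\<close> on all of \<open>\<real>\<close>, the point \<open>v = -1\<close> included, since
\<open>1 / 0 = 0\<close>.\<close>

lemma distr_beta_law:
  assumes q: "0 < q" "q < \<tau>"
  shows "distr (beta_law (\<tau> - q) q) borel (\<lambda>u. 1 / u - 1) = gamma_gamma_law \<tau> q"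
  unfolding distr_gamma_gamma_law[OF q, symmetric]
  by (subst distr_distr) (auto simp: o_def intro!: distr_id2)

lemma prob_space_beta_law:
  assumes "a > 0" "b > 0"
  shows "prob_space (beta_law a b)"
proof (rule prob_spaceI)
  have pos: "Gamma a > 0" "Gamma b > 0" "Gamma (a + b) > 0"
    using assms by (auto intro!: Gamma_real_pos)
  have "((\<lambda>t. t powr (a - 1) * (1 - t) powr (b - 1)) has_integral Beta a b) {0<..<1}"
    using has_integral_Beta_real[OF assms] by (simp add: has_integral_Icc_iff_Ioo)
  from has_integral_mult_right[OF this, of "Gamma (a + b) / (Gamma a * Gamma b)"]
  have "((\<lambda>u. Gamma (a + b) / (Gamma a * Gamma b) * u powr (a - 1) * (1 - u) powr (b - 1)) has_integral 1) {0<..<1}"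
    using pos by (simp add: Beta_def mult.assoc)
  then have "(\<integral>\<^sup>+u. ennreal (indicator {0<..<1} u * (Gamma (a + b) / (Gamma a * Gamma b) * u powr (a - 1) *
      (1 - u) powr (b - 1))) \<partial>lborel) = ennreal 1"
    using pos by (intro nn_integral_has_integral_lebesgue) auto
  then show "emeasure (beta_law a b) (space (beta_law a b)) = 1"
    by (simp add: beta_law_def emeasure_density)
qed

lemma AE_beta_law: "AE u in beta_law a b. 0 < u \<and> u < 1"
  unfolding beta_law_def
  by (subst AE_density) (auto simp: indicator_def)

section \<open>The space of boundedly finite measures\<close>

abbreviation (input) \<M> :: "'a::metric_space measure measure" where
  "\<M> \<equiv> bf_measure_algebra"

lemma space_bf_measure_algebra:
  "space \<M> =
    {m. sets m = sets borel \<and> (\<forall>B\<in>sets borel. bounded B \<longrightarrow> emeasure m B < \<infinity>)}"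
  by (auto simp: bf_measure_algebra_def space_Sup_eq_UN)

lemma measurable_emeasure_bf [measurable]:
  "A \<in> sets borel \<Longrightarrow> (\<lambda>m. emeasure m A) \<in> borel_measurable \<M>"
  by (auto intro!: measurable_Sup1 measurable_vimage_algebra1
      simp: bf_measure_algebra_def)

lemma measurable_measure_bf [measurable]:
  "A \<in> sets borel \<Longrightarrow> (\<lambda>m. measure m A) \<in> borel_measurable \<M>"
  unfolding measure_def by (intro borel_measurable_enn2real measurable_emeasure_bf)

lemma measurable_bfI:
  assumes "\<And>\<omega>. \<omega> \<in> space M \<Longrightarrow> X \<omega> \<in> space \<M>"
    and "\<And>A. A \<in> sets borel \<Longrightarrow> (\<lambda>\<omega>. emeasure (X \<omega>) A) \<in> borel_measurable M"
  shows "X \<in> measurable M \<M>"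
  using assms(1)[unfolded space_bf_measure_algebra] assms(2)
  unfolding bf_measure_algebra_def
  by (auto intro!: measurable_Sup2 measurable_vimage_algebra2)

lemma nn_integral_measurable_bf [measurable]:
  fixes g :: "'a::metric_space \<Rightarrow> ennreal"
  assumes "g \<in> borel_measurable borel"
  shows "(\<lambda>m. \<integral>\<^sup>+y. g y \<partial>m) \<in> borel_measurable \<M>"
  using assms
proof induct
  case (cong f g)
  then show ?case by (simp cong: nn_integral_cong)
next
  case (set B)
  then have "(\<lambda>m. \<integral>\<^sup>+y. indicator B y \<partial>m) \<in> borel_measurable \<M> \<longleftrightarrow>
    (\<lambda>m. emeasure m B) \<in> borel_measurable \<M>"
    by (intro measurable_cong nn_integral_indicator) (auto simp: space_bf_measure_algebra)
  with set show ?case by simp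
next
  case (mult f c)
  then have "(\<lambda>m. \<integral>\<^sup>+y. c * f y \<partial>m) \<in> borel_measurable \<M> \<longleftrightarrow>
    (\<lambda>m. c * \<integral>\<^sup>+y. f y \<partial>m) \<in> borel_measurable \<M>"
    by (intro measurable_cong nn_integral_cmult) (auto simp: space_bf_measure_algebra cong: measurable_cong_sets)
  with mult show ?case by simp
next
  case (add f g)
  then have "(\<lambda>m. \<integral>\<^sup>+y. g y + f y \<partial>m) \<in> borel_measurable \<M> \<longleftrightarrow>
    (\<lambda>m. (\<integral>\<^sup>+y. g y \<partial>m) + (\<integral>\<^sup>+y. f y \<partial>m)) \<in> borel_measurable \<M>"
    by (intro measurable_cong nn_integral_add) (auto simp: space_bf_measure_algebra cong: measurable_cong_sets)
  with add show ?case by (simp add: add_ac)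
next
  case (seq F)
  then have "(\<lambda>m. \<integral>\<^sup>+y. (SUP i. F i) y \<partial>m) \<in> borel_measurable \<M> \<longleftrightarrow>
    (\<lambda>m. SUP i. \<integral>\<^sup>+y. F i y \<partial>m) \<in> borel_measurable \<M>"
    unfolding SUP_apply
    by (intro measurable_cong nn_integral_monotone_convergence_SUP)
       (auto simp: space_bf_measure_algebra cong: measurable_cong_sets)
  with seq show ?case by simp
qed

lemma measurable_scale_measure_bf [measurable (raw)]:
  assumes [measurable]: "U \<in> borel_measurable M" "X \<in> measurable M \<M>"
  shows "(\<lambda>\<omega>. scale_measure (ennreal (U \<omega>)) (X \<omega>)) \<in> measurable M \<M>"
proof (rule measurable_bfI)
  fix \<omega> assume "\<omega> \<in> space M"
  then have "X \<omega> \<in> space \<M>" by (rule measurable_space[OF assms(2)])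
  then show "scale_measure (ennreal (U \<omega>)) (X \<omega>) \<in> space \<M>"
    by (auto simp: space_bf_measure_algebra ennreal_mult_less_top)
qed simp

definition borel_partition :: "'a::topological_space set set \<Rightarrow> bool" where
  "borel_partition F \<longleftrightarrow> finite F \<and> F \<subseteq> sets borel \<and> disjoint F \<and> \<Union>F = UNIV"

text \<open>The cells of \<open>F\<close> inside \<open>S\<close> cover \<open>S\<close>, so that the mass of \<open>S\<close> is a sum of masses of cells.\<close>

definition union_of_cells :: "'a set set \<Rightarrow> 'a set \<Rightarrow> bool" where
  "union_of_cells F S \<longleftrightarrow> S = \<Union>{c\<in>F. c \<subseteq> S}"

abbreviation (input) mass_space :: "'a set set \<Rightarrow> ('a set \<Rightarrow> ennreal) measure" where
  "mass_space F \<equiv> PiM F (\<lambda>_. borel)"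

definition masses :: "'a set set \<Rightarrow> 'a measure \<Rightarrow> 'a set \<Rightarrow> ennreal" where
  "masses F m = (\<lambda>A\<in>F. emeasure m A)"

definition cylinders :: "'a::metric_space set set \<Rightarrow> 'a measure set set" where
  "cylinders F = {masses F -` B \<inter> space \<M> | B. B \<in> sets (mass_space F)}"

lemma measurable_masses [measurable]:
  "F \<subseteq> sets borel \<Longrightarrow> masses F \<in> measurable \<M> (mass_space F)"
  unfolding masses_def[abs_def] by (rule measurable_restrict) auto

lemma borel_partitionD:
  assumes "borel_partition F"
  shows "finite F" "F \<subseteq> sets borel" "disjoint F" "\<Union>F = UNIV" "\<And>A. A \<in> F \<Longrightarrow> A \<in> sets borel"
  using assms by (auto simp: borel_partition_def)

text \<open>The cells are the atoms of the algebra that \<open>\<S>\<close> generates: two points share a cell if they lie in the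
same members of \<open>\<S>\<close>. There are at most as many cells as subsets of \<open>\<S>\<close>.\<close>

lemma ex_refining_partition:
  assumes "finite \<S>" "\<S> \<subseteq> sets borel"
  shows "\<exists>F. borel_partition F \<and> (\<forall>S\<in>\<S>. union_of_cells F S)"
proof -
  \<comment> \<open>the atom that contains \<open>y\<close>\<close>
  define cell where "cell y = {z. \<forall>S\<in>\<S>. z \<in> S \<longleftrightarrow> y \<in> S}" for y
  have cell_alt: "cell y = (\<Inter>S\<in>insert UNIV \<S>. if y \<in> S then S else - S)" for y
    by (auto simp: cell_def split: if_splits)
  have "finite (range cell)"
  proof (rule finite_subset)
    show "range cell \<subseteq> (\<lambda>T. {z. \<forall>S\<in>\<S>. z \<in> S \<longleftrightarrow> S \<in> T}) ` Pow \<S>"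
    proof
      fix c assume "c \<in> range cell"
      then obtain y where "c = cell y" by auto
      then have "c = (\<lambda>T. {z. \<forall>S\<in>\<S>. z \<in> S \<longleftrightarrow> S \<in> T}) {S\<in>\<S>. y \<in> S}"
        by (auto simp: cell_def)
      then show "c \<in> (\<lambda>T. {z. \<forall>S\<in>\<S>. z \<in> S \<longleftrightarrow> S \<in> T}) ` Pow \<S>"
        by (rule image_eqI) auto
    qed
  qed (use assms in simp)
  moreover have "cell y \<in> sets borel" for y
    unfolding cell_alt using assms by (intro sets.finite_INT) auto
  moreover have "disjoint (range cell)"
    by (rule disjointI) (auto simp: cell_def)
  moreover have self: "y \<in> cell y" for y by (simp add: cell_def)
  then have "\<Union>(range cell) = UNIV" by blast
  moreover have "union_of_cells (range cell) S" if "S \<in> \<S>" for S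
  proof -
    have "cell y \<subseteq> S" if "y \<in> S" for y using that \<open>S \<in> \<S>\<close> by (auto simp: cell_def)
    then show ?thesis using self unfolding union_of_cells_def by blast
  qed
  ultimately show ?thesis
    by (intro exI[of _ "range cell"]) (auto simp: borel_partition_def)
qed

lemma emeasure_union_of_cells:
  assumes "borel_partition F" "union_of_cells F S" "sets m = sets borel"
  shows "emeasure m S = (\<Sum>c\<in>{c\<in>F. c \<subseteq> S}. emeasure m c)"
proof -
  have "(\<Sum>c\<in>{c\<in>F. c \<subseteq> S}. emeasure m c) = emeasure m (\<Union>c\<in>{c\<in>F. c \<subseteq> S}. c)"
    using borel_partitionD[OF assms(1)] assms(3)
    by (intro sum_emeasure) (auto simp: disjoint_family_on_def disjoint_def)
  then show ?thesis using assms(2) by (simp add: union_of_cells_def)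
qed

text \<open>The masses of the sets in \<open>\<S>\<close> are sums of masses of cells, hence a measurable function of the cell
masses.\<close>

lemma cylinders_mono:
  assumes F: "borel_partition F" and \<S>: "finite \<S>" "\<forall>S\<in>\<S>. union_of_cells F S"
  shows "cylinders \<S> \<subseteq> cylinders F"
proof
  fix C assume "C \<in> cylinders \<S>"
  then obtain B where B: "B \<in> sets (mass_space \<S>)" and C: "C = masses \<S> -` B \<inter> space \<M>"
    by (auto simp: cylinders_def)
  define \<phi> where "\<phi> = (\<lambda>x :: 'a set \<Rightarrow> ennreal. \<lambda>S\<in>\<S>. \<Sum>c\<in>{c\<in>F. c \<subseteq> S}. x c)"
  have \<phi>: "\<phi> \<in> measurable (mass_space F) (mass_space \<S>)"
    unfolding \<phi>_def by (rule measurable_restrict) (auto intro!: borel_measurable_sum measurable_component_singleton)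
  have "masses \<S> m = \<phi> (masses F m)" if "m \<in> space \<M>" for m
    using that \<S> emeasure_union_of_cells[OF F, of _ m]
    by (auto simp: masses_def \<phi>_def space_bf_measure_algebra intro!: restrict_ext)
  moreover have "masses F m \<in> space (mass_space F)" for m
    by (auto simp: masses_def space_PiM)
  ultimately have "C = masses F -` (\<phi> -` B \<inter> space (mass_space F)) \<inter> space \<M>"
    unfolding C by auto
  moreover have "\<phi> -` B \<inter> space (mass_space F) \<in> sets (mass_space F)"
    using \<phi> B by (rule measurable_sets)
  ultimately show "C \<in> cylinders F" unfolding cylinders_def by blast
qed

lemma cylinders_sets: "F \<subseteq> sets borel \<Longrightarrow> cylinders F \<subseteq> sets \<M>"
  using measurable_masses[of F] by (auto simp: cylinders_def intro: measurable_sets)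

lemma cylinders_Int:
  assumes "C \<in> cylinders F" "D \<in> cylinders F" shows "C \<inter> D \<in> cylinders F"
proof -
  obtain A B where A: "A \<in> sets (mass_space F)" "C = masses F -` A \<inter> space \<M>"
    and B: "B \<in> sets (mass_space F)" "D = masses F -` B \<inter> space \<M>"
    using assms by (auto simp: cylinders_def)
  have "C \<inter> D = masses F -` (A \<inter> B) \<inter> space \<M>" unfolding A B by auto
  moreover have "A \<inter> B \<in> sets (mass_space F)" using A B by auto
  ultimately show ?thesis unfolding cylinders_def by blast
qed

lemma space_in_cylinders: "space \<M> \<in> cylinders F"
  unfolding cylinders_def
  by (rule CollectI, rule exI[of _ "space (mass_space F)"], intro conjI sets.top)
     (auto simp: masses_def space_PiM)

definition partition_cylinders :: "'a::metric_space measure set set" where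
  "partition_cylinders = \<Union>(cylinders ` Collect borel_partition)"

text \<open>Cylinders over two partitions are cylinders over a common refinement.\<close>

lemma Int_stable_partition_cylinders: "Int_stable partition_cylinders"
proof (rule Int_stableI)
  fix C D :: "'a measure set" assume "C \<in> partition_cylinders" "D \<in> partition_cylinders"
  then obtain F1 F2 where F: "borel_partition F1" "C \<in> cylinders F1" "borel_partition F2" "D \<in> cylinders F2"
    by (auto simp: partition_cylinders_def)
  then obtain F where "borel_partition F" "\<forall>S\<in>F1 \<union> F2. union_of_cells F S"
    using ex_refining_partition[of "F1 \<union> F2"] by (auto simp: borel_partition_def)
  then show "C \<inter> D \<in> partition_cylinders"
    using F cylinders_mono[of F F1] cylinders_mono[of F F2]
    by (auto simp: partition_cylinders_def borel_partition_def intro!: cylinders_Int)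
qed

lemma sets_bf_measure_algebra:
  "sets \<M> = sigma_sets (space \<M>) partition_cylinders"
proof
  have sub: "partition_cylinders \<subseteq> sets \<M>"
    unfolding partition_cylinders_def borel_partition_def using cylinders_sets by blast
  then show "sigma_sets (space \<M>) partition_cylinders \<subseteq> sets \<M>"
    by (rule sets.sigma_sets_subset)
  let ?S = "sigma (space \<M>) (partition_cylinders :: 'a measure set set)"
  have Pow: "partition_cylinders \<subseteq> Pow (space \<M> :: 'a measure set)"
    using sub sets.sets_into_space by blast
  have id: "(\<lambda>m. m) \<in> measurable ?S \<M>"
  proof (rule measurable_bfI)
    fix A :: "'a set" assume A: "A \<in> sets borel"
    obtain F where F: "borel_partition F" "union_of_cells F A"
      using ex_refining_partition[of "{A}"] A by auto
    show "(\<lambda>m. emeasure m A) \<in> borel_measurable ?S"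
    proof (rule measurableI)
      fix B :: "ennreal set" assume B: "B \<in> sets borel"
      have "(\<lambda>x. x A) -` B \<inter> space (mass_space {A}) \<in> sets (mass_space {A})"
        using B by (intro measurable_sets[OF measurable_component_singleton]) auto
      then have "masses {A} -` ((\<lambda>x. x A) -` B \<inter> space (mass_space {A})) \<inter> space \<M>
          \<in> cylinders {A}" unfolding cylinders_def by blast
      also have "masses {A} -` ((\<lambda>x. x A) -` B \<inter> space (mass_space {A})) \<inter> space \<M>
          = (\<lambda>m. emeasure m A) -` B \<inter> space \<M>"
        by (auto simp: masses_def space_PiM)
      also have "cylinders {A} \<subseteq> cylinders F"
        using F by (intro cylinders_mono) auto
      finally have "(\<lambda>m. emeasure m A) -` B \<inter> space \<M> \<in> partition_cylinders"
        using F by (auto simp: partition_cylinders_def)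
      then show "(\<lambda>m. emeasure m A) -` B \<inter> space ?S \<in> sets ?S"
        using Pow by (auto simp: space_measure_of)
    qed auto
  qed (use Pow in \<open>simp add: space_measure_of\<close>)
  show "sets \<M> \<subseteq> sigma_sets (space \<M>) (partition_cylinders :: 'a measure set set)"
  proof
    fix A :: "'a measure set" assume A: "A \<in> sets \<M>"
    have "(\<lambda>m. m) -` A \<inter> space ?S \<in> sets ?S" using id A by (rule measurable_sets)
    moreover have "space ?S = space \<M>" using Pow by (rule space_measure_of)
    moreover have "A \<subseteq> space \<M>" using A by (rule sets.sets_into_space)
    ultimately have "A \<in> sets ?S" by (simp add: Int_absorb2)
    also have "sets ?S = sigma_sets (space \<M>) partition_cylinders"
      using Pow by (rule sets_measure_of)
    finally show "A \<in> sigma_sets (space \<M>) partition_cylinders" .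
  qed
qed

lemma partition_cylinders_Pow: "partition_cylinders \<subseteq> Pow (space \<M>)"
  by (auto simp: partition_cylinders_def cylinders_def)

lemma space_in_partition_cylinders: "space \<M> \<in> partition_cylinders"
proof -
  have "borel_partition {UNIV}" by (auto simp: borel_partition_def)
  with space_in_cylinders show ?thesis by (auto simp: partition_cylinders_def)
qed

text \<open>The partition cylinders form a \<open>\<pi>\<close>-system that generates the \<open>\<sigma>\<close>-algebra.\<close>

lemma bf_measure_eqI:
  assumes "sets P = sets \<M>" "sets Q = sets \<M>" "finite_measure P"
    and "\<And>F C. borel_partition F \<Longrightarrow> C \<in> cylinders F \<Longrightarrow> emeasure P C = emeasure Q C"
  shows "P = Q"
proof (rule measure_eqI_generator_eq[OF Int_stable_partition_cylinders partition_cylinders_Pow])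
  show "range (\<lambda>i::nat. space \<M>) \<subseteq> partition_cylinders"
    using space_in_partition_cylinders by auto
  show "emeasure P (space \<M>) \<noteq> \<infinity>"
    using finite_measure.emeasure_finite[OF assms(3)] by simp
qed (use assms in \<open>auto simp: sets_bf_measure_algebra partition_cylinders_def\<close>)

section \<open>Uniqueness of the law of a gamma process\<close>

abbreviation (input) gamma_masses :: "'a measure \<Rightarrow> 'a set set \<Rightarrow> ('a set \<Rightarrow> ennreal) measure" where
  "gamma_masses \<nu> F \<equiv> PiM F (\<lambda>A. gamma_mass_law (measure \<nu> A))"

lemma gamma_processD:
  assumes "gamma_process M \<nu> X"
  shows "prob_space M" "X \<in> measurable M \<M>"
    "\<And>A. A \<in> sets borel \<Longrightarrow> distr M borel (\<lambda>\<omega>. emeasure (X \<omega>) A) = gamma_mass_law (measure \<nu> A)"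
  using assms by (auto simp: gamma_process_def gamma_mass_law_def)

lemma product_prob_space_gamma_mass_law:
  "product_prob_space (\<lambda>A. gamma_mass_law (measure \<nu> A))"
  by (intro product_prob_spaceI prob_space_gamma_mass_law measure_nonneg)

text \<open>Independence together with the one-dimensional laws says that the vector of masses has a product law.
The one-dimensional laws are recovered from families with a single member.\<close>

lemma gamma_process_iff:
  fixes \<nu> :: "'b::metric_space measure"
  shows "gamma_process M \<nu> X \<longleftrightarrow> prob_space M \<and> X \<in> measurable M \<M> \<and>
    (\<forall>F. F \<noteq> {} \<longrightarrow> F \<subseteq> sets borel \<longrightarrow> finite F \<longrightarrow> disjoint F \<longrightarrow>
      distr M (mass_space F) (\<lambda>\<omega>. masses F (X \<omega>)) = gamma_masses \<nu> F)"
  (is "?L \<longleftrightarrow> ?R")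
proof (cases "prob_space M \<and> X \<in> measurable M \<M>")
  case True
  then interpret prob_space M by simp
  have X [measurable]: "X \<in> measurable M \<M>" using True by simp
  have rv: "(\<lambda>\<omega>. emeasure (X \<omega>) A) \<in> borel_measurable M" if "A \<in> sets borel" for A
    using that by (intro measurable_compose[OF X measurable_emeasure_bf])
  have iff: "indep_vars (\<lambda>_. borel) (\<lambda>A \<omega>. emeasure (X \<omega>) A) F \<longleftrightarrow>
      distr M (mass_space F) (\<lambda>\<omega>. masses F (X \<omega>)) = gamma_masses \<nu> F"
    if F: "F \<noteq> {}" "F \<subseteq> sets borel"
      and m: "\<And>A. A \<in> F \<Longrightarrow> distr M borel (\<lambda>\<omega>. emeasure (X \<omega>) A) = gamma_mass_law (measure \<nu> A)" for F
  proof -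
    have "PiM F (\<lambda>A. distr M borel (\<lambda>\<omega>. emeasure (X \<omega>) A)) = gamma_masses \<nu> F"
      using m by (intro PiM_cong) auto
    then show ?thesis
      unfolding masses_def using F rv by (subst indep_vars_iff_distr_eq_PiM') auto
  qed
  show ?thesis
  proof
    assume L: ?L
    show ?R
    proof (intro conjI allI impI)
      fix F :: "'b set set" assume F: "F \<noteq> {}" "F \<subseteq> sets borel" "finite F" "disjoint F"
      then have "indep_vars (\<lambda>_. borel) (\<lambda>A \<omega>. emeasure (X \<omega>) A) F"
        using L by (simp add: gamma_process_def)
      then show "distr M (mass_space F) (\<lambda>\<omega>. masses F (X \<omega>)) = gamma_masses \<nu> F"
        using F gamma_processD(3)[OF L] by (subst iff[symmetric]) blast+
    qed (use True in simp_all)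
  next
    assume R: ?R
    have m: "distr M borel (\<lambda>\<omega>. emeasure (X \<omega>) A) = gamma_mass_law (measure \<nu> A)" if A: "A \<in> sets borel" for A
    proof -
      have "distr M borel (\<lambda>\<omega>. emeasure (X \<omega>) A) =
          distr (distr M (mass_space {A}) (\<lambda>\<omega>. masses {A} (X \<omega>))) borel (\<lambda>x. x A)"
      proof -
        have "(\<lambda>\<omega>. masses {A} (X \<omega>)) \<in> measurable M (mass_space {A})"
          using A by (intro measurable_compose[OF X measurable_masses]) simp
        moreover have "(\<lambda>x. x A) \<in> borel_measurable (mass_space {A})"
          by (rule measurable_component_singleton) simp
        ultimately show ?thesis by (simp add: distr_distr o_def masses_def)
      qed
      also have "distr M (mass_space {A}) (\<lambda>\<omega>. masses {A} (X \<omega>)) = PiM {A} (\<lambda>A. gamma_mass_law (measure \<nu> A))"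
        using R A by (auto simp: disjoint_def)
      also have "distr (PiM {A} (\<lambda>A. gamma_mass_law (measure \<nu> A))) borel (\<lambda>x. x A) =
          distr (PiM {A} (\<lambda>A. gamma_mass_law (measure \<nu> A))) (gamma_mass_law (measure \<nu> A)) (\<lambda>x. x A)"
        by (intro distr_cong) auto
      also have "\<dots> = gamma_mass_law (measure \<nu> A)"
        by (intro distr_PiM_component prob_space_gamma_mass_law) auto
      finally show ?thesis .
    qed
    have "indep_vars (\<lambda>_. borel) (\<lambda>A \<omega>. emeasure (X \<omega>) A) F"
      if F: "F \<subseteq> sets borel" "finite F" "disjoint F" for F
    proof (cases "F = {}")
      case True
      then show ?thesis by (simp add: indep_vars_def2 indep_sets_def)
    next
      case False
      have m': "distr M borel (\<lambda>\<omega>. emeasure (X \<omega>) A) = gamma_mass_law (measure \<nu> A)" if "A \<in> F" for A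
        using that F m by blast
      show ?thesis using R F False by (subst iff[OF False F(1) m']) blast+
    qed
    with True m show ?L by (simp add: gamma_process_def gamma_mass_law_def)
  qed
qed (auto simp: gamma_process_def)

lemma gamma_process_masses:
  assumes "gamma_process M \<nu> X" "borel_partition F"
  shows "distr M (mass_space F) (\<lambda>\<omega>. masses F (X \<omega>)) = gamma_masses \<nu> F"
proof -
  have "F \<noteq> {}" using borel_partitionD(4)[OF assms(2)] by auto
  then show ?thesis
    using assms borel_partitionD[OF assms(2)] by (auto simp: gamma_process_iff)
qed

lemma nn_integral_masses:
  assumes X: "gamma_process M \<nu> X" and F: "borel_partition F"
    and h: "h \<in> borel_measurable (mass_space F)"
  shows "(\<integral>\<^sup>+\<omega>. h (masses F (X \<omega>)) \<partial>M) = (\<integral>\<^sup>+x. h x \<partial>gamma_masses \<nu> F)"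
  unfolding gamma_process_masses[OF X F, symmetric] using h
  by (subst nn_integral_distr)
     (auto intro!: measurable_compose[OF gamma_processD(2)[OF X] measurable_masses] borel_partitionD(5)[OF F])

lemma gamma_process_distr:
  assumes "gamma_process M \<nu> X"
  shows "gamma_process (distr M \<M> X) \<nu> (\<lambda>m. m)"
proof -
  note [measurable] = gamma_processD(2)[OF assms]
  have "prob_space (distr M \<M> X)"
    using gamma_processD[OF assms] by (intro prob_space.prob_space_distr) auto
  moreover have "(\<lambda>m. m) \<in> measurable (distr M \<M> X) \<M>"
    by (simp add: measurable_def)
  moreover have "distr (distr M \<M> X) (mass_space F) (\<lambda>m. masses F m)
      = distr M (mass_space F) (\<lambda>\<omega>. masses F (X \<omega>))" if "F \<subseteq> sets borel" for F
    using that by (subst distr_distr) (auto simp: o_def)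
  ultimately show ?thesis
    using assms by (auto simp: gamma_process_iff)
qed

text \<open>The probability of a cylinder is computed from the joint law of the cell masses, which depends on the
shape through its values on the cells.\<close>

lemma gamma_process_cylinder_eq:
  assumes P: "gamma_process P \<nu> (\<lambda>m. m)" "sets P = sets \<M>"
    and Q: "gamma_process Q \<nu>' (\<lambda>m. m)" "sets Q = sets \<M>"
    and F: "borel_partition F" and C: "C \<in> cylinders F"
    and eq: "\<And>A. A \<in> F \<Longrightarrow> measure \<nu> A = measure \<nu>' A"
  shows "emeasure P C = emeasure Q C"
proof -
  obtain B where B: "B \<in> sets (mass_space F)" "C = masses F -` B \<inter> space \<M>"
    using C by (auto simp: cylinders_def)
  have "emeasure P C = emeasure (distr P (mass_space F) (\<lambda>m. masses F m)) B"
    using B P F by (subst emeasure_distr) (auto simp: sets_eq_imp_space_eq[OF P(2)] borel_partition_def cong: measurable_cong_sets)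
  also have "\<dots> = emeasure (distr Q (mass_space F) (\<lambda>m. masses F m)) B"
    unfolding gamma_process_masses[OF P(1) F] gamma_process_masses[OF Q(1) F]
    using eq by (intro arg_cong2[where f=emeasure] PiM_cong) auto
  also have "\<dots> = emeasure Q C"
    using B Q F by (subst emeasure_distr) (auto simp: sets_eq_imp_space_eq[OF Q(2)] borel_partition_def cong: measurable_cong_sets)
  finally show ?thesis .
qed

lemma gamma_process_unique:
  assumes P: "gamma_process P \<nu> (\<lambda>m. m)" "sets P = sets \<M>"
    and Q: "gamma_process Q \<nu> (\<lambda>m. m)" "sets Q = sets \<M>"
  shows "P = Q"
proof (rule bf_measure_eqI)
  show "finite_measure P"
    using gamma_processD(1)[OF P(1)] by (simp add: prob_space.finite_measure)
qed (use assms gamma_process_cylinder_eq[OF P Q] in auto)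

text \<open>Uniqueness makes the definite description in the definition of the law denote the law of any given
gamma process of that shape.\<close>

lemma gamma_process_law_eq:
  fixes \<nu> :: "'b::metric_space measure"
  assumes "gamma_process M \<nu> X"
  shows "gamma_process_law \<nu> = distr M \<M> X"
  unfolding gamma_process_law_def
proof (rule the_equality)
  note D = gamma_process_distr[OF assms]
  show "sets (distr M \<M> X) = sets \<M> \<and>
      gamma_process (distr M \<M> X) \<nu> (\<lambda>m. m)"
    using D by simp
  fix Q :: "'b measure measure" assume "sets Q = sets \<M> \<and> gamma_process Q \<nu> (\<lambda>m. m)"
  then show "Q = distr M \<M> X"
    by (elim conjE, intro gamma_process_unique[OF _ _ D sets_distr])
qed

lemma gamma_process_gamma_process_law:
  assumes "gamma_process M \<nu> X"
  shows "gamma_process (gamma_process_law \<nu>) \<nu> (\<lambda>m. m)"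
  unfolding gamma_process_law_eq[OF assms] by (rule gamma_process_distr[OF assms])

lemma sets_gamma_process_law:
  assumes "gamma_process M \<nu> X"
  shows "sets (gamma_process_law \<nu>) = sets \<M>"
  unfolding gamma_process_law_eq[OF assms] by simp

section \<open>Tilting gamma processes\<close>

text \<open>If each \<open>M i\<close>, weighted by \<open>f i\<close>, is \<open>c i\<close> times the image of \<open>N i\<close> under \<open>t\<close>, the products are related in the
same way. Comparing the two measures on rectangles suffices. The map \<open>t\<close> is a dilation for
exponential weights and the identity for powers.\<close>

lemma nn_integral_PiM_tilt:
  fixes M N :: "'i \<Rightarrow> 'b measure" and f :: "'i \<Rightarrow> 'b \<Rightarrow> ennreal"
  assumes I: "finite I" and M: "product_prob_space M" and N: "product_prob_space N"
    and sets: "\<And>i. sets (M i) = sets B" "\<And>i. sets (N i) = sets B"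
    and f: "\<And>i. f i \<in> borel_measurable B" and t: "t \<in> measurable B B" and c: "\<And>i. i \<in> I \<Longrightarrow> c i < \<infinity>"
    and tilt: "\<And>i h. i \<in> I \<Longrightarrow> h \<in> borel_measurable B \<Longrightarrow>
      (\<integral>\<^sup>+x. f i x * h x \<partial>M i) = c i * (\<integral>\<^sup>+x. h (t x) \<partial>N i)"
    and h: "h \<in> borel_measurable (PiM I (\<lambda>_. B))"
  shows "(\<integral>\<^sup>+x. (\<Prod>i\<in>I. f i (x i)) * h x \<partial>PiM I M) =
    (\<Prod>i\<in>I. c i) * (\<integral>\<^sup>+x. h (\<lambda>i\<in>I. t (x i)) \<partial>PiM I N)"
proof -
  interpret M: product_prob_space M by fact
  interpret N: product_prob_space N by fact
  note [measurable_cong] = sets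
  note [measurable] = f t h
  have sM: "sets (PiM I M) = sets (PiM I (\<lambda>_. B))" "sets (PiM I N) = sets (PiM I (\<lambda>_. B))"
    using sets by (auto intro!: sets_PiM_cong)
  note [measurable_cong] = sM
  have f' [measurable]: "(\<lambda>x. \<Prod>i\<in>I. f i (x i)) \<in> borel_measurable (PiM I M)"
    by (intro borel_measurable_prod_ennreal measurable_compose[OF measurable_component_singleton]) auto
  have t' [measurable]: "(\<lambda>x. \<lambda>i\<in>I. t (x i)) \<in> measurable (PiM I N) (PiM I (\<lambda>_. B))"
    by measurable
  let ?L = "density (PiM I M) (\<lambda>x. \<Prod>i\<in>I. f i (x i))"
  let ?R = "scale_measure (\<Prod>i\<in>I. c i) (distr (PiM I N) (PiM I (\<lambda>_. B)) (\<lambda>x. \<lambda>i\<in>I. t (x i)))"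
  have "?R = ?L"
  proof (rule measure_eqI_PiM_finite[OF I])
    fix A assume A: "\<And>i. i \<in> I \<Longrightarrow> A i \<in> sets B"
    have eqM: "emeasure ?L (Pi\<^sub>E I A) = (\<Prod>i\<in>I. \<integral>\<^sup>+x. f i x * indicator (A i) x \<partial>M i)"
    proof -
      have "Pi\<^sub>E I A \<in> sets (PiM I M)" using A I unfolding sM by (intro sets_PiM_I_finite) auto
      then have "emeasure ?L (Pi\<^sub>E I A) = (\<integral>\<^sup>+x. (\<Prod>i\<in>I. f i (x i)) * indicator (Pi\<^sub>E I A) x \<partial>PiM I M)"
        by (intro emeasure_density) auto
      also have "\<dots> = (\<integral>\<^sup>+x. (\<Prod>i\<in>I. f i (x i) * indicator (A i) (x i)) \<partial>PiM I M)"
      proof (intro nn_integral_cong)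
        fix x assume "x \<in> space (PiM I M)"
        then have "indicator (Pi\<^sub>E I A) x = (\<Prod>i\<in>I. indicator (A i) (x i) :: ennreal)"
          using I by (auto simp: indicator_def space_PiM PiE_iff prod_zero_iff)
        then show "(\<Prod>i\<in>I. f i (x i)) * indicator (Pi\<^sub>E I A) x = (\<Prod>i\<in>I. f i (x i) * indicator (A i) (x i))"
          by (simp add: prod.distrib)
      qed
      also have "\<dots> = (\<Prod>i\<in>I. \<integral>\<^sup>+x. f i x * indicator (A i) x \<partial>M i)"
        using I A by (intro M.product_nn_integral_prod) auto
      finally show ?thesis .
    qed
    have eqN: "emeasure ?R (Pi\<^sub>E I A) = (\<Prod>i\<in>I. c i) * (\<Prod>i\<in>I. \<integral>\<^sup>+x. indicator (A i) (t x) \<partial>N i)"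
    proof -
      have P: "Pi\<^sub>E I A \<in> sets (PiM I (\<lambda>_. B))" using A I by (intro sets_PiM_I_finite) auto
      have "emeasure (distr (PiM I N) (PiM I (\<lambda>_. B)) (\<lambda>x. \<lambda>i\<in>I. t (x i))) (Pi\<^sub>E I A)
          = (\<integral>\<^sup>+x. indicator (Pi\<^sub>E I A) (\<lambda>i\<in>I. t (x i)) \<partial>PiM I N)"
        using P by (simp add: nn_integral_distr flip: nn_integral_indicator)
      also have "\<dots> = (\<integral>\<^sup>+x. (\<Prod>i\<in>I. indicator (A i) (t (x i))) \<partial>PiM I N)"
        using I by (intro nn_integral_cong) (auto simp: indicator_def PiE_iff prod_zero_iff)
      also have "\<dots> = (\<Prod>i\<in>I. \<integral>\<^sup>+x. indicator (A i) (t x) \<partial>N i)"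
        using I A by (intro N.product_nn_integral_prod) auto
      finally show ?thesis by simp
    qed
    have "emeasure ?L (Pi\<^sub>E I A) = (\<Prod>i\<in>I. c i * (\<integral>\<^sup>+x. indicator (A i) (t x) \<partial>N i))"
      unfolding eqM using A by (intro prod.cong refl tilt) auto
    then show "emeasure ?R (Pi\<^sub>E I A) = emeasure ?L (Pi\<^sub>E I A)"
      unfolding eqN by (simp add: prod.distrib)
  next
    show "range (\<lambda>i::nat. space (PiM I (\<lambda>_. B))) \<subseteq> prod_algebra I (\<lambda>_. B)"
      unfolding space_PiM using I by (auto intro!: prod_algebraI_finite)
    have "emeasure (distr (PiM I N) (PiM I (\<lambda>_. B)) (\<lambda>x. \<lambda>i\<in>I. t (x i))) (space (PiM I (\<lambda>_. B))) \<le> 1"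
    proof -
      interpret D: prob_space "distr (PiM I N) (PiM I (\<lambda>_. B)) (\<lambda>x. \<lambda>i\<in>I. t (x i))"
        by (intro prob_space.prob_space_distr) (use t' N.prob_space_axioms in auto)
      show ?thesis by (rule D.emeasure_le_1)
    qed
    moreover have "(\<Prod>i\<in>I. c i) < \<infinity>" using c by (auto simp: less_top[symmetric] ennreal_prod_eq_top)
    ultimately show "emeasure ?R (space (PiM I (\<lambda>_. B))) \<noteq> \<infinity>"
      by (auto simp: ennreal_mult_eq_top_iff top_unique)
  qed (auto simp: sM)
  then have "(\<integral>\<^sup>+x. h x \<partial>?L) = (\<integral>\<^sup>+x. h x \<partial>?R)" by simp
  then show ?thesis
    by (simp add: nn_integral_density nn_integral_scale_measure nn_integral_distr)
qed

lemma AE_gamma_mass_law: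
  assumes "a > 0" shows "AE x in gamma_mass_law a. 0 < x \<and> x < \<infinity>"
proof -
  have "AE x in gamma_law a. 0 < x"
    unfolding gamma_law_def using assms by (simp, subst AE_density) (auto simp: indicator_def)
  then show ?thesis
    unfolding gamma_mass_law_def by (subst AE_distr_iff) auto
qed

lemma AE_total_mass:
  assumes X: "gamma_process M \<nu> X" and pos: "measure \<nu> UNIV > 0"
  shows "AE \<omega> in M. 0 < emeasure (X \<omega>) UNIV \<and> emeasure (X \<omega>) UNIV < \<infinity>"
proof -
  have [measurable]: "(\<lambda>\<omega>. emeasure (X \<omega>) UNIV) \<in> borel_measurable M"
    by (rule measurable_compose[OF gamma_processD(2)[OF X] measurable_emeasure_bf]) simp
  have "AE x in distr M borel (\<lambda>\<omega>. emeasure (X \<omega>) UNIV). 0 < x \<and> x < \<infinity>"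
    using AE_gamma_mass_law[OF pos] by (subst gamma_processD(3)[OF X]) auto
  then show ?thesis by (subst (asm) AE_distr_iff) auto
qed

lemma prod_powr_measure:
  assumes "finite_measure \<nu>" "sets \<nu> = sets borel" "borel_partition F" "c > 0"
  shows "(\<Prod>A\<in>F. c powr (- measure \<nu> A)) = c powr (- measure \<nu> UNIV)"
proof -
  note F = borel_partitionD[OF assms(3)]
  have "(\<Sum>A\<in>F. measure \<nu> A) = measure \<nu> (\<Union>A\<in>F. A)"
    using F assms(1,2)
    by (intro finite_measure.finite_measure_finite_Union[symmetric]) (auto simp: disjoint_family_on_def disjoint_def)
  also have "\<dots> = measure \<nu> UNIV" using F by simp
  finally show ?thesis using assms(4) by (simp add: powr_sum[symmetric] sum_negf)
qed

lemma emeasure_UNIV_masses: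
  assumes "borel_partition F" "m \<in> space \<M>"
  shows "emeasure m UNIV = (\<Sum>A\<in>F. masses F m A)"
proof -
  have "union_of_cells F UNIV" using borel_partitionD(4)[OF assms(1)] by (auto simp: union_of_cells_def)
  from emeasure_union_of_cells[OF assms(1) this] assms(2) show ?thesis
    by (simp add: space_bf_measure_algebra masses_def)
qed

lemma masses_scale_measure: "masses F (scale_measure c m) = (\<lambda>A\<in>F. c * masses F m A)"
  by (auto simp: masses_def)

text \<open>The weight \<open>e\<^bsup>-sT\<^esup>\<close> is the product of the weights \<open>e\<^bsup>-s\<mu>(A)\<^esup>\<close> over the cells \<open>A\<close>, and each of them shrinks
its gamma variable by the same factor \<open>1 / (1 + s)\<close>, so that the measure as a whole is scaled. The
constants multiply to a power with exponent \<open>-\<Sum>\<nu>(A) = -\<nu>(UNIV)\<close>.\<close>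

lemma gamma_process_exp_tilt:
  fixes \<nu> :: "'a::metric_space measure"
  assumes Q: "gamma_process Q \<nu> (\<lambda>m. m)" "sets Q = sets \<M>"
    and \<nu>: "finite_measure \<nu>" "sets \<nu> = sets borel" and s: "s \<ge> 0"
    and H: "H \<in> borel_measurable \<M>"
  shows "(\<integral>\<^sup>+m. ennreal (exp_neg (ennreal s * emeasure m UNIV)) * H m \<partial>Q) =
    ennreal ((1 + s) powr (- measure \<nu> UNIV)) * (\<integral>\<^sup>+m. H (scale_measure (ennreal (1 / (1 + s))) m) \<partial>Q)"
proof -
  note [measurable_cong] = Q(2)
  note [measurable] = H
  have sp: "space Q = space \<M>" by (rule sets_eq_imp_space_eq[OF Q(2)])
  let ?f = "\<lambda>x. ennreal (exp_neg (ennreal s * x))"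
  let ?t = "\<lambda>x. ennreal (1 / (1 + s)) * x"
  let ?sc = "\<lambda>m. scale_measure (ennreal (1 / (1 + s))) m"
  have sc [measurable]: "?sc \<in> measurable Q \<M>"
    by (intro measurable_scale_measure_bf) auto
  let ?L = "density Q (\<lambda>m. ?f (emeasure m UNIV))"
  let ?R = "scale_measure (ennreal ((1 + s) powr (- measure \<nu> UNIV))) (distr Q \<M> ?sc)"
  have T [measurable]: "(\<lambda>m. emeasure m UNIV) \<in> borel_measurable Q"
    unfolding measurable_cong_sets[OF Q(2) refl] by (rule measurable_emeasure_bf) simp
  have "?L = ?R"
  proof (rule bf_measure_eqI)
    show "finite_measure ?L"
    proof (rule finite_measureI)
      have "emeasure ?L (space ?L) = (\<integral>\<^sup>+m. ?f (emeasure m UNIV) * indicator (space Q) m \<partial>Q)"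
        by (simp add: emeasure_density)
      also have "\<dots> \<le> (\<integral>\<^sup>+m. 1 \<partial>Q)"
        by (intro nn_integral_mono) (simp add: exp_neg_le_1)
      also have "\<dots> = 1" using prob_space.emeasure_space_1[OF gamma_processD(1)[OF Q(1)]] by simp
      finally show "emeasure ?L (space ?L) \<noteq> \<infinity>" by (auto simp: top_unique)
    qed
  next
    fix F :: "'a set set" and C assume F: "borel_partition F" and C: "C \<in> cylinders F"
    then obtain B where B [measurable]: "B \<in> sets (mass_space F)"
      and C_eq: "C = masses F -` B \<inter> space \<M>"
      by (auto simp: cylinders_def)
    note F' = borel_partitionD[OF F]
    have Cs: "C \<in> sets \<M>" using cylinders_sets[OF F'(2)] C by auto
    have meas1: "(\<lambda>x. (\<Prod>A\<in>F. ?f (x A)) * indicator B x) \<in> borel_measurable (mass_space F)"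
      by (intro borel_measurable_times_ennreal borel_measurable_prod_ennreal) auto
    have t: "(\<lambda>x. \<lambda>A\<in>F. ?t (x A)) \<in> measurable (mass_space F) (mass_space F)"
      by measurable
    have meas2: "(\<lambda>x. indicator B (\<lambda>A\<in>F. ?t (x A)) :: ennreal) \<in> borel_measurable (mass_space F)"
      by (rule measurable_compose[OF t]) simp
    have "emeasure ?L C = (\<integral>\<^sup>+m. (\<Prod>A\<in>F. ?f (masses F m A)) * indicator B (masses F m) \<partial>Q)"
    proof -
      have "emeasure ?L C = (\<integral>\<^sup>+m. ?f (emeasure m UNIV) * indicator C m \<partial>Q)"
        using Cs Q(2) by (subst emeasure_density) auto
      also have "\<dots> = (\<integral>\<^sup>+m. (\<Prod>A\<in>F. ?f (masses F m A)) * indicator B (masses F m) \<partial>Q)"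
        using emeasure_UNIV_masses[OF F]
        by (intro nn_integral_cong arg_cong2[where f="(*)"])
           (auto simp: sp C_eq indicator_def sum_distrib_left exp_neg_sum prod_ennreal)
      finally show ?thesis .
    qed
    also have "\<dots> = (\<integral>\<^sup>+x. (\<Prod>A\<in>F. ?f (x A)) * indicator B x \<partial>gamma_masses \<nu> F)"
      by (rule nn_integral_masses[OF Q(1) F meas1])
    also have "\<dots> = (\<Prod>A\<in>F. ennreal ((1 + s) powr (- measure \<nu> A))) *
        (\<integral>\<^sup>+x. indicator B (\<lambda>A\<in>F. ?t (x A)) \<partial>gamma_masses \<nu> F)"
      using F'(1) s
      by (intro nn_integral_PiM_tilt[where B=borel and f="\<lambda>_. ?f"] product_prob_space_gamma_mass_law
          gamma_mass_law_exp_tilt) auto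
    also have "(\<Prod>A\<in>F. ennreal ((1 + s) powr (- measure \<nu> A))) = ennreal ((1 + s) powr (- measure \<nu> UNIV))"
      using s by (simp add: prod_ennreal prod_powr_measure[OF \<nu> F])
    also have "(\<integral>\<^sup>+x. indicator B (\<lambda>A\<in>F. ?t (x A)) \<partial>gamma_masses \<nu> F) =
        (\<integral>\<^sup>+m. indicator B (\<lambda>A\<in>F. ?t (masses F m A)) \<partial>Q)"
      by (rule nn_integral_masses[OF Q(1) F meas2, symmetric])
    also have "\<dots> = (\<integral>\<^sup>+m. indicator C (?sc m) \<partial>Q)"
      using measurable_space[OF sc]
      by (intro nn_integral_cong) (auto simp: C_eq indicator_def masses_scale_measure sp)
    also have "\<dots> = emeasure (distr Q \<M> ?sc) C"
      using Cs by (simp add: nn_integral_distr flip: nn_integral_indicator)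
    finally show "emeasure ?L C = emeasure ?R C" by simp
  qed (auto simp: Q)
  then have "(\<integral>\<^sup>+m. H m \<partial>?L) = (\<integral>\<^sup>+m. H m \<partial>?R)" by simp
  then show ?thesis
    by (simp add: nn_integral_density nn_integral_scale_measure nn_integral_distr)
qed

text \<open>A version on cell masses of the Palm formula for the gamma process: each factor \<open>\<mu>(A)\<close> adds a unit of
shape somewhere in \<open>A\<close>. The position inside \<open>A\<close> is invisible to the cell masses, which is why any
shape \<open>\<nu>'\<close> with the right values on the cells is allowed.\<close>

lemma gamma_process_power_tilt:
  assumes P: "gamma_process P \<nu> (\<lambda>m. m)"
    and Q: "gamma_process Q \<nu>' (\<lambda>m. m)"
    and F: "borel_partition F" and eq: "\<And>A. A \<in> F \<Longrightarrow> measure \<nu>' A = measure \<nu> A + real (k A)"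
    and h: "h \<in> borel_measurable (mass_space F)"
  shows "(\<integral>\<^sup>+m. (\<Prod>A\<in>F. masses F m A ^ k A) * h (masses F m) \<partial>P) =
    ennreal (\<Prod>A\<in>F. pochhammer (measure \<nu> A) (k A)) * (\<integral>\<^sup>+m. h (masses F m) \<partial>Q)"
proof -
  note [measurable] = h
  have meas1: "(\<lambda>x. (\<Prod>A\<in>F. x A ^ k A) * h x) \<in> borel_measurable (mass_space F)"
    by (intro borel_measurable_times_ennreal borel_measurable_prod_ennreal) auto
  have poch: "pochhammer (measure \<nu> A) (k A) \<ge> 0" for A
    unfolding pochhammer_prod by (intro prod_nonneg) simp
  have "(\<integral>\<^sup>+m. (\<Prod>A\<in>F. masses F m A ^ k A) * h (masses F m) \<partial>P) =
      (\<integral>\<^sup>+x. (\<Prod>A\<in>F. x A ^ k A) * h x \<partial>gamma_masses \<nu> F)"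
    by (rule nn_integral_masses[OF P F meas1])
  also have "\<dots> = (\<Prod>A\<in>F. ennreal (pochhammer (measure \<nu> A) (k A))) *
      (\<integral>\<^sup>+x. h (\<lambda>A\<in>F. x A) \<partial>gamma_masses \<nu>' F)"
    using borel_partitionD(1)[OF F] eq
    by (intro nn_integral_PiM_tilt[where B=borel and f="\<lambda>A x. x ^ k A" and t="\<lambda>x. x"]
        product_prob_space_gamma_mass_law)
       (auto simp: gamma_mass_law_power_tilt)
  also have "(\<Prod>A\<in>F. ennreal (pochhammer (measure \<nu> A) (k A))) = ennreal (\<Prod>A\<in>F. pochhammer (measure \<nu> A) (k A))"
    using poch by (simp add: prod_ennreal)
  also have "(\<integral>\<^sup>+x. h (\<lambda>A\<in>F. x A) \<partial>gamma_masses \<nu>' F) =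
      (\<integral>\<^sup>+x. h x \<partial>gamma_masses \<nu>' F)"
    by (intro nn_integral_cong arg_cong[where f=h]) (auto simp: space_PiM PiE_iff extensional_restrict)
  also have "\<dots> = (\<integral>\<^sup>+m. h (masses F m) \<partial>Q)"
    by (rule nn_integral_masses[OF Q F h, symmetric])
  finally show ?thesis .
qed

section \<open>Beta-gamma processes as beta multiples of gamma processes\<close>

text \<open>Write \<open>T\<^bsup>-q\<^esup>\<close> as an integral of \<open>e\<^bsup>-sT\<^esup>\<close>, exchange the integrals, and apply the exponential tilt for each
\<open>s\<close>. What remains is the law of \<open>\<mu> / (1 + s)\<close> integrated against the gamma-gamma law of \<open>s\<close>, and
\<open>1 / (1 + s)\<close> has the beta law.\<close>

lemma beta_gamma_process_law_eq_distr:
  fixes \<nu> :: "'a::metric_space measure"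
  assumes X: "gamma_process (gamma_process_law \<nu>) \<nu> (\<lambda>m. m)"
    and \<nu>: "finite_measure \<nu>" "sets \<nu> = sets borel" and q: "0 < q" "q < measure \<nu> UNIV"
  shows "beta_gamma_process_law \<nu> q =
    distr (beta_law (measure \<nu> UNIV - q) q \<Otimes>\<^sub>M gamma_process_law \<nu>) \<M>
      (\<lambda>(u, m). scale_measure (ennreal u) m)"
proof -
  define Q where "Q = gamma_process_law \<nu>"
  define \<tau> where "\<tau> = measure \<nu> UNIV"
  have Q: "gamma_process Q \<nu> (\<lambda>m. m)" "sets Q = sets \<M>"
    using X sets_gamma_process_law[OF X] by (simp_all add: Q_def)
  have \<tau>: "q < \<tau>" using q by (simp add: \<tau>_def)
  note [measurable_cong] = Q(2)
  interpret Q: prob_space Q by (rule gamma_processD(1)[OF Q(1)])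
  interpret B: prob_space "beta_law (\<tau> - q) q" using q \<tau> by (intro prob_space_beta_law) auto
  interpret QL: pair_sigma_finite lborel Q ..
  have T [measurable]: "(\<lambda>m. emeasure m UNIV) \<in> borel_measurable Q"
    "(\<lambda>m. measure m UNIV) \<in> borel_measurable Q"
    unfolding measurable_cong_sets[OF Q(2) refl]
    by (rule measurable_emeasure_bf measurable_measure_bf; simp)+
  have sc [measurable]: "(\<lambda>(u, m). scale_measure (ennreal u) m) \<in> measurable (beta_law (\<tau> - q) q \<Otimes>\<^sub>M Q) \<M>"
    unfolding split_beta' by (intro measurable_scale_measure_bf) auto
  have sc1 [measurable]: "(\<lambda>m. scale_measure (ennreal u) m) \<in> measurable Q \<M>" for u
    by (intro measurable_scale_measure_bf) auto
  have pos: "Gamma q > 0" "Gamma \<tau> > 0" "Gamma (\<tau> - q) > 0"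
    using q \<tau> by (auto intro!: Gamma_real_pos)
  define K where "K = Gamma \<tau> / (Gamma q * Gamma (\<tau> - q))"
  have K: "K \<ge> 0" "Gamma \<tau> / Gamma (\<tau> - q) = K * Gamma q" using pos by (auto simp: K_def)
  have "emeasure (beta_gamma_process_law \<nu> q) C =
      emeasure (distr (beta_law (\<tau> - q) q \<Otimes>\<^sub>M Q) \<M> (\<lambda>(u, m). scale_measure (ennreal u) m)) C"
    if C [measurable]: "C \<in> sets \<M>" for C
  proof -
    let ?w = "\<lambda>s. indicator {0<..} s * s powr (q - 1) :: real"
    have "emeasure (beta_gamma_process_law \<nu> q) C =
        (\<integral>\<^sup>+m. ennreal (Gamma \<tau> / Gamma (\<tau> - q) * measure m UNIV powr (- q)) * indicator C m \<partial>Q)"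
      unfolding beta_gamma_process_law_def Q_def[symmetric] \<tau>_def[symmetric]
      by (intro emeasure_density) measurable
    also have "\<dots> = (\<integral>\<^sup>+m. (\<integral>\<^sup>+s. ennreal (K * ?w s) *
        (ennreal (exp_neg (ennreal s * emeasure m UNIV)) * indicator C m) \<partial>lborel) \<partial>Q)"
    proof (rule nn_integral_cong_AE)
      have "AE m in Q. 0 < emeasure m UNIV \<and> emeasure m UNIV < \<infinity>"
        using AE_total_mass[OF Q(1)] q \<tau> by (simp add: \<tau>_def)
      then show "AE m in Q. ennreal (Gamma \<tau> / Gamma (\<tau> - q) * measure m UNIV powr (- q)) * indicator C m =
          (\<integral>\<^sup>+s. ennreal (K * ?w s) * (ennreal (exp_neg (ennreal s * emeasure m UNIV)) * indicator C m) \<partial>lborel)"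
      proof (eventually_elim)
        case (elim m)
        define t where "t = measure m UNIV"
        have t: "emeasure m UNIV = ennreal t" "t > 0"
          using elim by (cases "emeasure m UNIV"; simp add: t_def measure_def)+
        have "(\<integral>\<^sup>+s. ennreal (K * ?w s) * (ennreal (exp_neg (ennreal s * emeasure m UNIV)) * indicator C m) \<partial>lborel)
          = (\<integral>\<^sup>+s. (ennreal K * indicator C m) * ennreal (indicator {0<..} s * (s powr (q - 1) * exp (- (s * t)))) \<partial>lborel)"
        proof (intro nn_integral_cong)
          fix s :: real
          show "ennreal (K * ?w s) * (ennreal (exp_neg (ennreal s * emeasure m UNIV)) * indicator C m)
            = (ennreal K * indicator C m) * ennreal (indicator {0<..} s * (s powr (q - 1) * exp (- (s * t))))"
          proof (cases "s > 0")
            case True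
            then have "exp_neg (ennreal s * emeasure m UNIV) = exp (- (s * t))"
              using t by (simp add: ennreal_mult[symmetric] exp_neg_ennreal)
            with True K(1) show ?thesis by (simp add: ennreal_mult mult_ac)
          qed simp
        qed
        also have "\<dots> = (ennreal K * indicator C m) * ennreal (Gamma q * t powr (- q))"
          using q t by (subst nn_integral_cmult) (auto simp: nn_integral_Gamma)
        also have "\<dots> = ennreal (Gamma \<tau> / Gamma (\<tau> - q) * t powr (- q)) * indicator C m"
          unfolding K(2) using K(1) pos by (simp add: ennreal_mult mult_ac)
        finally show ?case by (simp add: t_def)
      qed
    qed
    also have "\<dots> = (\<integral>\<^sup>+s. (\<integral>\<^sup>+m. ennreal (K * ?w s) *
        (ennreal (exp_neg (ennreal s * emeasure m UNIV)) * indicator C m) \<partial>Q) \<partial>lborel)"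
      by (rule QL.Fubini') measurable
    also have "\<dots> = (\<integral>\<^sup>+s. ennreal (indicator {0<..} s * (Gamma \<tau> / (Gamma q * Gamma (\<tau> - q)) * s powr (q - 1) *
        (1 + s) powr (- \<tau>))) * (\<integral>\<^sup>+m. indicator C (scale_measure (ennreal (1 / (1 + s))) m) \<partial>Q) \<partial>lborel)"
    proof (intro nn_integral_cong)
      fix s :: real
      show "(\<integral>\<^sup>+m. ennreal (K * ?w s) * (ennreal (exp_neg (ennreal s * emeasure m UNIV)) * indicator C m) \<partial>Q)
        = ennreal (indicator {0<..} s * (Gamma \<tau> / (Gamma q * Gamma (\<tau> - q)) * s powr (q - 1) *
        (1 + s) powr (- \<tau>))) * (\<integral>\<^sup>+m. indicator C (scale_measure (ennreal (1 / (1 + s))) m) \<partial>Q)"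
      proof (cases "s > 0")
        case True
        have "(\<integral>\<^sup>+m. ennreal (K * ?w s) * (ennreal (exp_neg (ennreal s * emeasure m UNIV)) * indicator C m) \<partial>Q)
          = ennreal (K * ?w s) * (\<integral>\<^sup>+m. ennreal (exp_neg (ennreal s * emeasure m UNIV)) * indicator C m \<partial>Q)"
          by (rule nn_integral_cmult) measurable
        also have "(\<integral>\<^sup>+m. ennreal (exp_neg (ennreal s * emeasure m UNIV)) * indicator C m \<partial>Q) =
          ennreal ((1 + s) powr (- \<tau>)) * (\<integral>\<^sup>+m. indicator C (scale_measure (ennreal (1 / (1 + s))) m) \<partial>Q)"
          unfolding \<tau>_def using True by (intro gamma_process_exp_tilt[OF Q \<nu>]) auto
        finally show ?thesis
          using True pos by (simp add: K_def mult.assoc[symmetric] ennreal_mult[symmetric])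
      qed simp
    qed
    also have "\<dots> = (\<integral>\<^sup>+v. (\<integral>\<^sup>+m. indicator C (scale_measure (ennreal (1 / (1 + v))) m) \<partial>Q) \<partial>gamma_gamma_law \<tau> q)"
      unfolding gamma_gamma_law_def by (subst nn_integral_density) auto
    also have "\<dots> = (\<integral>\<^sup>+u. (\<integral>\<^sup>+m. indicator C (scale_measure (ennreal u) m) \<partial>Q) \<partial>beta_law (\<tau> - q) q)"
      unfolding distr_gamma_gamma_law[OF q(1) \<tau>, symmetric] by (subst nn_integral_distr) auto
    also have "\<dots> = (\<integral>\<^sup>+p. indicator C (case p of (u, m) \<Rightarrow> scale_measure (ennreal u) m) \<partial>(beta_law (\<tau> - q) q \<Otimes>\<^sub>M Q))"
      by (subst Q.nn_integral_fst[symmetric]) (auto intro!: measurable_compose[OF sc])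
    also have "\<dots> = emeasure (distr (beta_law (\<tau> - q) q \<Otimes>\<^sub>M Q) \<M> (\<lambda>(u, m). scale_measure (ennreal u) m)) C"
      using C by (simp add: nn_integral_distr flip: nn_integral_indicator)
    finally show ?thesis .
  qed
  then show ?thesis
    unfolding Q_def[symmetric] \<tau>_def[symmetric]
    by (intro measure_eqI) (auto simp: beta_gamma_process_law_def Q(2) simp flip: Q_def)
qed

text \<open>Independence is given through the generated \<open>\<sigma>\<close>-algebras; it says that the law of the pair is the
product measure, on which the mixture representation is stated.\<close>

lemma pair_law_of_indep_beta_gamma:
  fixes \<nu> :: "'a::metric_space measure"
  assumes ind: "indep_beta_gamma N a b \<nu> U G" and ab: "a > 0" "b > 0"
  shows "distr N (borel \<Otimes>\<^sub>M \<M>) (\<lambda>\<omega>. (U \<omega>, G \<omega>)) = beta_law a b \<Otimes>\<^sub>M gamma_process_law \<nu>"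
proof -
  have N: "prob_space N" and U [measurable]: "U \<in> borel_measurable N" and dU: "distr N borel U = beta_law a b"
    and G: "gamma_process N \<nu> G"
    and sets_indep: "prob_space.indep_set N (sets (generated_algebra N U borel)) (sets (generated_algebra N G \<M>))"
    using ind by (auto simp: indep_beta_gamma_def)
  note Gm [measurable] = gamma_processD(2)[OF G]
  interpret N: prob_space N by fact
  note law = gamma_process_law_eq[OF G]
  interpret B: prob_space "beta_law a b" by (rule prob_space_beta_law[OF ab])
  interpret Q: prob_space "gamma_process_law \<nu>" unfolding law by (rule N.prob_space_distr[OF Gm])
  have "beta_law a b \<Otimes>\<^sub>M gamma_process_law \<nu> = distr N (borel \<Otimes>\<^sub>M \<M>) (\<lambda>\<omega>. (U \<omega>, G \<omega>))"
  proof (rule pair_measure_eqI)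
    show "sets (beta_law a b \<Otimes>\<^sub>M gamma_process_law \<nu>) =
        sets (distr N (borel \<Otimes>\<^sub>M \<M>) (\<lambda>\<omega>. (U \<omega>, G \<omega>)))"
      by (auto simp: law intro!: sets_pair_measure_cong)
  next
    fix A B assume "A \<in> sets (beta_law a b)" "B \<in> sets (gamma_process_law \<nu>)"
    then have A: "A \<in> sets borel" and B: "B \<in> sets \<M>" by (simp_all add: law)
    have "emeasure (beta_law a b) A = emeasure N (U -` A \<inter> space N)"
      unfolding dU[symmetric] using A by (simp add: emeasure_distr)
    moreover have "emeasure (gamma_process_law \<nu>) B = emeasure N (G -` B \<inter> space N)"
      unfolding law using B by (simp add: emeasure_distr)
    moreover have "N.prob ((U -` A \<inter> space N) \<inter> (G -` B \<inter> space N)) =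
        N.prob (U -` A \<inter> space N) * N.prob (G -` B \<inter> space N)"
      using A B by (intro N.indep_setD[OF sets_indep] in_vimage_algebra)
    moreover have "emeasure (distr N (borel \<Otimes>\<^sub>M \<M>) (\<lambda>\<omega>. (U \<omega>, G \<omega>))) (A \<times> B) =
        emeasure N ((U -` A \<inter> space N) \<inter> (G -` B \<inter> space N))"
      using A B by (subst emeasure_distr) (auto intro!: arg_cong[where f="emeasure N"])
    ultimately show "emeasure (beta_law a b) A * emeasure (gamma_process_law \<nu>) B =
        emeasure (distr N (borel \<Otimes>\<^sub>M \<M>) (\<lambda>\<omega>. (U \<omega>, G \<omega>))) (A \<times> B)"
      by (simp add: N.emeasure_eq_measure ennreal_mult)
  qed (intro B.sigma_finite_measure_axioms Q.sigma_finite_measure_axioms)+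
  then show ?thesis ..
qed

text \<open>The coordinates on a product space are independent. This shows that the representation is not
vacuous.\<close>

lemma indep_beta_gamma_pair:
  fixes \<nu> :: "'a::metric_space measure"
  assumes X: "gamma_process (gamma_process_law \<nu>) \<nu> (\<lambda>m. m)" and ab: "a > 0" "b > 0"
  shows "indep_beta_gamma (beta_law a b \<Otimes>\<^sub>M gamma_process_law \<nu>) a b \<nu> fst snd"
proof -
  let ?B = "beta_law a b" and ?Q = "gamma_process_law \<nu>"
  let ?P = "?B \<Otimes>\<^sub>M ?Q"
  interpret B: prob_space ?B by (rule prob_space_beta_law[OF ab])
  interpret Q: prob_space ?Q by (rule gamma_processD(1)[OF X])
  interpret P: pair_prob_space ?B ?Q ..
  note Qs = sets_gamma_process_law[OF X]
  have f: "fst \<in> borel_measurable ?P"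
    using measurable_fst[of ?B ?Q] by (simp add: measurable_cong_sets[OF refl, of ?B borel])
  have s: "snd \<in> measurable ?P \<M>"
    using measurable_snd[of ?B ?Q] by (simp add: measurable_cong_sets[OF refl Qs])
  have ds: "distr ?P \<M> snd = ?Q"
  proof (rule measure_eqI)
    fix C assume "C \<in> sets (distr ?P \<M> snd)"
    then have C: "C \<in> sets \<M>" by simp
    have "snd -` C \<inter> space ?P = space ?B \<times> C"
      using sets.sets_into_space[OF C] by (auto simp: space_pair_measure sets_eq_imp_space_eq[OF Qs])
    then show "emeasure (distr ?P \<M> snd) C = emeasure ?Q C"
      using C Q.emeasure_pair_measure_Times[OF sets.top, of C ?B]
      by (simp add: emeasure_distr[OF s] Qs B.emeasure_space_1)
  qed (simp add: Qs)
  have df: "distr ?P borel fst = ?B"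
  proof (rule measure_eqI)
    fix A assume "A \<in> sets (distr ?P borel fst)"
    then have A: "A \<in> sets borel" by simp
    have "fst -` A \<inter> space ?P = A \<times> space ?Q"
      using A by (auto simp: space_pair_measure sets_eq_imp_space_eq[OF sets_beta_law])
    then show "emeasure (distr ?P borel fst) A = emeasure ?B A"
      using A Q.emeasure_pair_measure_Times[OF _ sets.top, of A ?B]
      by (simp add: emeasure_distr[OF f] Q.emeasure_space_1)
  qed simp
  have "gamma_process ?P \<nu> snd"
  proof -
    have "distr ?P (mass_space F) (\<lambda>p. masses F (snd p)) = gamma_masses \<nu> F"
      if F: "F \<noteq> {}" "F \<subseteq> sets borel" "finite F" "disjoint F" for F
    proof -
      have "distr ?P (mass_space F) (\<lambda>p. masses F (snd p)) =
        distr (distr ?P \<M> snd) (mass_space F) (masses F)"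
        using s F(2) by (subst distr_distr) (auto simp: o_def)
      also have "\<dots> = distr ?Q (mass_space F) (\<lambda>m. masses F m)" unfolding ds ..
      also have "\<dots> = gamma_masses \<nu> F"
        using X F by (auto simp: gamma_process_iff)
      finally show ?thesis .
    qed
    then show ?thesis unfolding gamma_process_iff using s P.prob_space_axioms by blast
  qed
  moreover have "P.indep_set (sets (generated_algebra ?P fst borel))
      (sets (generated_algebra ?P snd \<M>))"
  proof -
    have S1: "sets (generated_algebra ?P fst borel) =
        {fst -` A \<inter> space ?P | A. A \<in> sets borel}"
      by (rule sets_vimage_algebra2) simp
    have S2: "sets (generated_algebra ?P snd \<M>) =
        {snd -` A \<inter> space ?P | A. A \<in> sets \<M>}"
      by (rule sets_vimage_algebra2) (use measurable_space[OF s] in auto)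
    show ?thesis
    proof (rule P.indep_setI)
      show "sets (generated_algebra ?P fst borel) \<subseteq> P.events"
        unfolding S1 using measurable_sets[OF f] by auto
      show "sets (generated_algebra ?P snd \<M>) \<subseteq> P.events"
        unfolding S2 using measurable_sets[OF s] by auto
      fix a' b' assume "a' \<in> sets (generated_algebra ?P fst borel)"
        "b' \<in> sets (generated_algebra ?P snd \<M>)"
      then obtain A C where A: "A \<in> sets borel" "a' = fst -` A \<inter> space ?P"
        and C: "C \<in> sets \<M>" "b' = snd -` C \<inter> space ?P"
        unfolding S1 S2 by auto
      have Cs: "C \<subseteq> space ?Q" using sets.sets_into_space[OF C(1)] by (simp add: sets_eq_imp_space_eq[OF Qs])
      have As: "A \<subseteq> space ?B" by (simp add: sets_eq_imp_space_eq[OF sets_beta_law])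
      have "a' \<inter> b' = A \<times> C" using A C Cs As by (auto simp: space_pair_measure)
      then have "emeasure ?P (a' \<inter> b') = emeasure ?B A * emeasure ?Q C"
        using A C by (simp add: Q.emeasure_pair_measure_Times Qs)
      also have "emeasure ?B A = emeasure ?P a'"
        unfolding A(2) by (subst df[symmetric]) (simp add: emeasure_distr[OF f A(1)])
      also have "emeasure ?Q C = emeasure ?P b'"
        unfolding C(2) by (subst ds[symmetric]) (simp add: emeasure_distr[OF s C(1)])
      finally show "P.prob (a' \<inter> b') = P.prob a' * P.prob b'"
        by (simp add: P.emeasure_eq_measure ennreal_mult[symmetric])
    qed
  qed
  ultimately show ?thesis
    using P.prob_space_axioms f df by (simp add: indep_beta_gamma_def)
qed

lemma beta_gamma_process_law_eq_scaled:
  fixes \<nu> :: "'a::metric_space measure"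
  assumes ind: "indep_beta_gamma N (measure \<nu> UNIV - q) q \<nu> U G"
    and \<nu>: "finite_measure \<nu>" "sets \<nu> = sets borel" and q: "0 < q" "q < measure \<nu> UNIV"
  shows "beta_gamma_process_law \<nu> q = distr N \<M> (\<lambda>\<omega>. scale_measure (ennreal (U \<omega>)) (G \<omega>))"
proof -
  have U [measurable]: "U \<in> borel_measurable N" and G: "gamma_process N \<nu> G"
    using ind by (auto simp: indep_beta_gamma_def)
  note Gm [measurable] = gamma_processD(2)[OF G]
  have sc: "(\<lambda>(u, m). scale_measure (ennreal u) m) \<in> measurable (borel \<Otimes>\<^sub>M \<M>) \<M>"
    unfolding split_beta' by (intro measurable_scale_measure_bf) auto
  have "beta_gamma_process_law \<nu> q =
      distr (distr N (borel \<Otimes>\<^sub>M \<M>) (\<lambda>\<omega>. (U \<omega>, G \<omega>))) \<M>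
        (\<lambda>(u, m). scale_measure (ennreal u) m)"
    using beta_gamma_process_law_eq_distr[OF gamma_process_gamma_process_law[OF G] \<nu> q]
      pair_law_of_indep_beta_gamma[OF ind] q by simp
  also have "\<dots> = distr N \<M> (\<lambda>\<omega>. scale_measure (ennreal (U \<omega>)) (G \<omega>))"
    using sc by (subst distr_distr) (auto simp: o_def)
  finally show ?thesis .
qed

lemma ex_gamma_gamma_of_beta:
  assumes U: "U \<in> borel_measurable N" and dU: "distr N borel U = beta_law (\<tau> - q) q" and q: "0 < q" "q < \<tau>"
  shows "\<exists>V\<in>borel_measurable N. distr N borel V = gamma_gamma_law \<tau> q \<and> (AE \<omega> in N. U \<omega> = 1 / (1 + V \<omega>))"
proof (intro bexI conjI)
  have "distr N borel (\<lambda>\<omega>. 1 / U \<omega> - 1) = distr (distr N borel U) borel (\<lambda>u. 1 / u - 1)"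
    using U by (subst distr_distr) (auto simp: o_def)
  then show "distr N borel (\<lambda>\<omega>. 1 / U \<omega> - 1) = gamma_gamma_law \<tau> q"
    using distr_beta_law[OF q] by (simp add: dU)
qed (use U in auto)

section \<open>Existence of gamma processes with atoms in the shape\<close>

definition add_atom :: "'a::topological_space measure \<Rightarrow> 'a \<Rightarrow> ennreal \<Rightarrow> 'a measure" where
  "add_atom m y c = measure_of UNIV (sets borel) (\<lambda>A. emeasure m A + c * indicator A y)"

lemma sets_add_atom [simp]: "sets (add_atom m y c) = sets (borel :: 'a::topological_space measure)"
proof -
  have "sigma_sets UNIV (sets (borel :: 'a measure)) = sets borel"
    using sets.sigma_sets_eq[of "borel :: 'a measure"] by simp
  then show ?thesis by (simp add: add_atom_def sets_measure_of_conv)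
qed

lemma emeasure_add_atom:
  assumes m: "sets m = sets borel" and A: "A \<in> sets borel"
  shows "emeasure (add_atom m y c) A = emeasure m A + c * indicator A y"
proof (rule emeasure_measure_of[OF add_atom_def])
  show "countably_additive (sets (add_atom m y c)) (\<lambda>A. emeasure m A + c * indicator A y)"
  proof (rule countably_additiveI)
    fix B :: "nat \<Rightarrow> 'a set"
    assume B: "range B \<subseteq> sets (add_atom m y c)" "disjoint_family B"
    have "(\<Sum>k. emeasure m (B k) + c * indicator (B k) y) = (\<Sum>k. emeasure m (B k)) + (\<Sum>k. c * indicator (B k) y)"
      by (rule suminf_add[symmetric]) auto
    also have "(\<Sum>k. emeasure m (B k)) = emeasure m (\<Union>k. B k)"
      using B m by (intro suminf_emeasure) auto
    also have "(\<Sum>k. c * indicator (B k) y) = c * indicator (\<Union>k. B k) y"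
      using B by (simp add: suminf_indicator)
    finally show "(\<Sum>k. emeasure m (B k) + c * indicator (B k) y) =
      emeasure m (\<Union>k. B k) + c * indicator (\<Union>k. B k) y" .
  qed
qed (use assms in \<open>auto simp: positive_def\<close>)

lemma gamma_process_cong:
  assumes "gamma_process M \<nu> X" "\<And>A. A \<in> sets borel \<Longrightarrow> measure \<nu> A = measure \<nu>' A"
  shows "gamma_process M \<nu>' X"
  using assms by (auto simp: gamma_process_def)

text \<open>In a disjoint family at most one set contains \<open>y\<close>. Adding an exponential mass at \<open>y\<close> leaves the masses
of the other sets alone and raises the shape of this one by \<open>1\<close>; independence is kept because the
new mass enters a single coordinate.\<close>

lemma gamma_process_add_atom:
  fixes \<nu> \<nu>' :: "'a::metric_space measure"
  assumes Q: "gamma_process Q \<nu> (\<lambda>m. m)" "sets Q = sets \<M>"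
    and \<nu>': "\<And>A. A \<in> sets borel \<Longrightarrow> measure \<nu>' A = measure \<nu> A + indicator A y"
  shows "gamma_process (Q \<Otimes>\<^sub>M gamma_law 1) \<nu>' (\<lambda>(m, x). add_atom m y (ennreal x))"
proof -
  let ?N = "Q \<Otimes>\<^sub>M gamma_law 1"
  interpret Q: prob_space Q by (rule gamma_processD(1)[OF Q(1)])
  interpret G: prob_space "gamma_law 1" by (rule prob_space_gamma_law) simp
  interpret QG: pair_prob_space Q "gamma_law 1" ..
  note [measurable_cong] = Q(2)
  have sp: "space Q = space \<M>" by (rule sets_eq_imp_space_eq[OF Q(2)])
  have borel: "sets m = sets borel" if "m \<in> space Q" for m
    using that by (simp add: sp space_bf_measure_algebra)
  have em: "(\<lambda>m. emeasure m A) \<in> borel_measurable Q" if "A \<in> sets borel" for A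
    unfolding measurable_cong_sets[OF Q(2) refl] using that by (rule measurable_emeasure_bf)
  let ?X = "\<lambda>(m, x). add_atom m y (ennreal x)"
  have emX: "emeasure (?X p) A = emeasure (fst p) A + ennreal (snd p) * indicator A y"
    if "p \<in> space ?N" "A \<in> sets borel" for p A
    using that by (auto simp: space_pair_measure emeasure_add_atom borel)
  have X: "?X \<in> measurable ?N \<M>"
  proof (rule measurable_bfI)
    fix p assume p: "p \<in> space ?N"
    then have "fst p \<in> space \<M>" by (auto simp: space_pair_measure sp)
    then show "?X p \<in> space \<M>"
      using emX[OF p] by (auto simp: space_bf_measure_algebra split_beta' ennreal_mult_less_top indicator_def)
  next
    fix A :: "'a set" assume A: "A \<in> sets borel"
    have "(\<lambda>p. emeasure (fst p) A + ennreal (snd p) * indicator A y) \<in> borel_measurable ?N"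
      by (intro borel_measurable_add borel_measurable_times_ennreal measurable_compose[OF measurable_fst em[OF A]]) auto
    then show "(\<lambda>p. emeasure (?X p) A) \<in> borel_measurable ?N"
      using emX A by (subst measurable_cong) auto
  qed
  have "distr ?N (mass_space F) (\<lambda>p. masses F (?X p)) = gamma_masses \<nu>' F"
    if F: "F \<noteq> {}" "F \<subseteq> sets borel" "finite F" "disjoint F" for F
  proof -
    interpret P': product_prob_space "\<lambda>A. gamma_mass_law (measure \<nu>' A)"
      by (rule product_prob_space_gamma_mass_law)
    interpret P: product_prob_space "\<lambda>A. gamma_mass_law (measure \<nu> A)"
      by (rule product_prob_space_gamma_mass_law)
    have mF: "masses F \<in> measurable Q (mass_space F)"
      unfolding measurable_cong_sets[OF Q(2) refl] using F(2) by (rule measurable_masses)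
    have law: "distr Q (mass_space F) (\<lambda>m. masses F m) = gamma_masses \<nu> F"
      using Q(1) F by (auto simp: gamma_process_iff)
    have mX: "(\<lambda>p. masses F (?X p)) \<in> measurable ?N (mass_space F)"
      by (rule measurable_compose[OF X measurable_masses[OF F(2)]])
    show ?thesis
    proof (rule P'.PiM_eqI[OF F(3)])
      show "sets (distr ?N (mass_space F) (\<lambda>p. masses F (?X p))) =
          sets (gamma_masses \<nu>' F)"
        by (auto intro!: sets_PiM_cong)
    next
      fix S assume "\<And>A. A \<in> F \<Longrightarrow> S A \<in> sets (gamma_mass_law (measure \<nu>' A))"
      then have S [measurable]: "A \<in> F \<Longrightarrow> S A \<in> sets borel" for A by simp
      \<comment> \<open>probability that the old mass of \<open>A\<close>, shifted by \<open>z\<close>, falls into \<open>S A\<close>\<close>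
      define \<phi> where "\<phi> A z = (\<integral>\<^sup>+w. indicator (S A) (w + z) \<partial>gamma_mass_law (measure \<nu> A))" for A z
      have \<phi>_meas [measurable]: "\<phi> A \<in> borel_measurable borel" if [measurable]: "A \<in> F" for A
        unfolding \<phi>_def by measurable
      have inner: "(\<integral>\<^sup>+m. indicator (Pi\<^sub>E F S) (masses F (?X (m, x))) \<partial>Q) =
          (\<Prod>A\<in>F. \<phi> A (ennreal x * indicator A y))" for x
      proof -
        have meas: "(\<lambda>w. \<Prod>A\<in>F. indicator (S A) (w A + ennreal x * indicator A y) :: ennreal) \<in> borel_measurable (mass_space F)"
          by (intro borel_measurable_prod_ennreal) measurable
        have "(\<integral>\<^sup>+m. indicator (Pi\<^sub>E F S) (masses F (?X (m, x))) \<partial>Q) =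
          (\<integral>\<^sup>+m. (\<Prod>A\<in>F. indicator (S A) (masses F m A + ennreal x * indicator A y)) \<partial>Q)"
        proof (intro nn_integral_cong)
          fix m assume m: "m \<in> space Q"
          have "masses F (?X (m, x)) \<in> Pi\<^sub>E F S \<longleftrightarrow> (\<forall>A\<in>F. masses F m A + ennreal x * indicator A y \<in> S A)"
            using F(2) m by (auto simp: masses_def PiE_iff emeasure_add_atom borel subset_eq)
          then show "indicator (Pi\<^sub>E F S) (masses F (?X (m, x))) =
            (\<Prod>A\<in>F. indicator (S A) (masses F m A + ennreal x * indicator A y) :: ennreal)"
            using F(3) by (auto simp: indicator_def prod_zero_iff)
        qed
        also have "\<dots> = (\<integral>\<^sup>+w. (\<Prod>A\<in>F. indicator (S A) (w A + ennreal x * indicator A y)) \<partial>gamma_masses \<nu> F)"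
          unfolding law[symmetric] using meas mF by (subst nn_integral_distr) auto
        also have "\<dots> = (\<Prod>A\<in>F. \<phi> A (ennreal x * indicator A y))"
          unfolding \<phi>_def using F(3) by (intro P.product_nn_integral_prod) measurable
        finally show ?thesis .
      qed
      have "emeasure (distr ?N (mass_space F) (\<lambda>p. masses F (?X p))) (Pi\<^sub>E F S) =
          (\<integral>\<^sup>+p. indicator (Pi\<^sub>E F S) (masses F (?X p)) \<partial>?N)"
        using S F(3) mX by (simp add: nn_integral_distr sets_PiM_I_finite flip: nn_integral_indicator)
      also have "\<dots> = (\<integral>\<^sup>+x. (\<integral>\<^sup>+m. indicator (Pi\<^sub>E F S) (masses F (?X (m, x))) \<partial>Q) \<partial>gamma_law 1)"
        using S F(3)
        by (subst QG.nn_integral_snd[symmetric])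
           (auto intro!: measurable_compose[OF mX] borel_measurable_indicator sets_PiM_I_finite)
      also have "\<dots> = (\<integral>\<^sup>+x. (\<Prod>A\<in>F. \<phi> A (ennreal x * indicator A y)) \<partial>gamma_law 1)"
        unfolding inner ..
      also have "\<dots> = (\<Prod>A\<in>F. emeasure (gamma_mass_law (measure \<nu>' A)) (S A))"
      proof -
        have \<phi>0: "\<phi> A 0 = emeasure (gamma_mass_law (measure \<nu>' A)) (S A)" if "A \<in> F" "y \<notin> A" for A
          using that F(2) \<nu>'[of A] by (auto simp: \<phi>_def)
        show ?thesis
        proof (cases "\<exists>A0\<in>F. y \<in> A0")
          case False
          then have "(\<Prod>A\<in>F. \<phi> A (ennreal x * indicator A y)) = (\<Prod>A\<in>F. emeasure (gamma_mass_law (measure \<nu>' A)) (S A))" for x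
            using \<phi>0 by (intro prod.cong) auto
          then show ?thesis using G.emeasure_space_1 by simp
        next
          case True
          then obtain A0 where A0: "A0 \<in> F" "y \<in> A0" by auto
          have other: "y \<notin> A" if "A \<in> F - {A0}" for A
            using that A0 F(4) by (auto simp: disjoint_def)
          have [measurable]: "S A0 \<in> sets borel" using S A0 by auto
          let ?r = "\<Prod>A\<in>F - {A0}. emeasure (gamma_mass_law (measure \<nu>' A)) (S A)"
          have split: "(\<Prod>A\<in>F. \<phi> A (ennreal x * indicator A y)) = \<phi> A0 (ennreal x) * ?r" for x
          proof -
            have "(\<Prod>A\<in>F - {A0}. \<phi> A (ennreal x * indicator A y)) = ?r"
              using \<phi>0 other by (intro prod.cong) auto
            then show ?thesis using A0 F(3) by (subst prod.remove[of F A0]) auto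
          qed
          interpret g1: prob_space "gamma_mass_law 1" by (rule prob_space_gamma_mass_law) simp
          interpret ga: prob_space "gamma_mass_law (measure \<nu> A0)" by (rule prob_space_gamma_mass_law) simp
          interpret gg: pair_sigma_finite "gamma_mass_law (measure \<nu> A0)" "gamma_mass_law 1" ..
          have "(\<integral>\<^sup>+x. \<phi> A0 (ennreal x) \<partial>gamma_law 1) = (\<integral>\<^sup>+z. \<phi> A0 z \<partial>gamma_mass_law 1)"
            using A0 by (simp add: gamma_mass_law_def nn_integral_distr)
          also have "\<dots> = (\<integral>\<^sup>+w. \<integral>\<^sup>+z. indicator (S A0) (w + z) \<partial>gamma_mass_law 1 \<partial>gamma_mass_law (measure \<nu> A0))"
            unfolding \<phi>_def by (rule gg.Fubini') measurable
          also have "\<dots> = (\<integral>\<^sup>+x. indicator (S A0) x \<partial>gamma_mass_law (measure \<nu> A0 + 1))"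
            by (rule gamma_mass_law_convolution_1) auto
          also have "\<dots> = emeasure (gamma_mass_law (measure \<nu>' A0)) (S A0)"
            using A0 F(2) \<nu>'[of A0] by auto
          finally have "(\<integral>\<^sup>+x. \<phi> A0 (ennreal x) \<partial>gamma_law 1) = emeasure (gamma_mass_law (measure \<nu>' A0)) (S A0)" .
          moreover have "(\<lambda>x. \<phi> A0 (ennreal x)) \<in> borel_measurable (gamma_law 1)"
            using A0 by measurable
          ultimately show ?thesis
            unfolding split using A0 F(3) by (simp add: nn_integral_multc prod.remove[of F A0])
        qed
      qed
      finally show "emeasure (distr ?N (mass_space F) (\<lambda>p. masses F (?X p))) (Pi\<^sub>E F S) =
        (\<Prod>A\<in>F. emeasure (gamma_mass_law (measure \<nu>' A)) (S A))" .
    qed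
  qed
  then show ?thesis
    unfolding gamma_process_iff using X QG.prob_space_axioms by blast
qed

lemma measure_posterior_shape:
  assumes "prob_space H" "sets H = sets borel" "\<theta> \<ge> 0" "A \<in> sets borel"
  shows "measure (posterior_shape \<theta> H n y) A = \<theta> * measure H A + (\<Sum>i=1..n. indicator A (y i))"
proof -
  interpret prob_space H by fact
  have "emeasure (posterior_shape \<theta> H n y) A = ennreal (\<theta> * measure H A + (\<Sum>i=1..n. indicator A (y i)))"
  proof -
    have "emeasure (posterior_shape \<theta> H n y) A =
        ennreal \<theta> * ennreal (measure H A) + (\<Sum>i=1..n. ennreal (indicator A (y i)))"
      unfolding emeasure_posterior_shape[OF assms(2,4)] emeasure_eq_measure ennreal_indicator ..
    also have "\<dots> = ennreal \<theta> * ennreal (measure H A) + ennreal (\<Sum>i=1..n. indicator A (y i))"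
      by (simp only: sum_ennreal indicator_pos_le)
    also have "ennreal \<theta> * ennreal (measure H A) = ennreal (\<theta> * measure H A)"
      using assms(3) by (intro ennreal_mult[symmetric]) auto
    also have "ennreal (\<theta> * measure H A) + ennreal (\<Sum>i=1..n. indicator A (y i))
        = ennreal (\<theta> * measure H A + (\<Sum>i=1..n. indicator A (y i)))"
      using assms(3) by (intro ennreal_plus[symmetric] sum_nonneg) auto
    finally show ?thesis .
  qed
  then show ?thesis
    using assms(3) by (simp only: measure_def enn2real_ennreal add_nonneg_nonneg mult_nonneg_nonneg
        sum_nonneg indicator_pos_le enn2real_nonneg)
qed

lemma finite_measure_posterior_shape:
  assumes "prob_space H" "sets H = sets borel"
  shows "finite_measure (posterior_shape \<theta> H n y)"
proof (rule finite_measureI)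
  interpret prob_space H by fact
  have "space (posterior_shape \<theta> H n y) = UNIV"
    using sets_eq_imp_space_eq[OF sets_posterior_shape[of \<theta> H n y]] by simp
  then show "emeasure (posterior_shape \<theta> H n y) (space (posterior_shape \<theta> H n y)) \<noteq> \<infinity>"
    using assms(2) by (simp add: emeasure_posterior_shape emeasure_eq_measure ennreal_mult_eq_top_iff)
qed

lemma gamma_process_posterior_shape:
  fixes H :: "'a::metric_space measure"
  assumes H: "prob_space H" "sets H = sets borel" and \<theta>: "\<theta> \<ge> 0"
    and \<mu>: "gamma_process M (scale_measure (ennreal \<theta>) H) \<mu>"
  shows "gamma_process (gamma_process_law (posterior_shape \<theta> H n y)) (posterior_shape \<theta> H n y) (\<lambda>m. m)"
proof (induction n)
  case 0
  have "gamma_process M (posterior_shape \<theta> H 0 y) \<mu>"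
    using \<theta> by (intro gamma_process_cong[OF \<mu>]) (simp add: measure_posterior_shape[OF H])
  then show ?case by (rule gamma_process_gamma_process_law)
next
  case (Suc n)
  have "gamma_process (gamma_process_law (posterior_shape \<theta> H n y) \<Otimes>\<^sub>M gamma_law 1) (posterior_shape \<theta> H (Suc n) y)
    (\<lambda>(m, x). add_atom m (y (Suc n)) (ennreal x))"
    using \<theta> by (intro gamma_process_add_atom[OF Suc sets_gamma_process_law[OF Suc]])
      (simp add: measure_posterior_shape[OF H])
  then show ?case by (rule gamma_process_gamma_process_law)
qed

section \<open>Laplace functionals\<close>

text \<open>Continuity holds also at infinity, where \<open>enn2real\<close> jumps; this is what allows monotone limits of
integrals that may diverge.\<close>

lemma exp_neg_tendsto:
  assumes "(x \<longlongrightarrow> l) F" shows "((\<lambda>n. exp_neg (x n)) \<longlongrightarrow> exp_neg l) F"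
proof (cases l)
  case (real r)
  have ev: "eventually (\<lambda>n. x n < \<infinity>) F"
    using assms real by (intro order_tendstoD(2)[OF assms]) simp
  have "((\<lambda>n. exp (- enn2real (x n))) \<longlongrightarrow> exp (- r)) F"
    using assms real by (intro tendsto_intros) auto
  moreover have "eventually (\<lambda>n. exp (- enn2real (x n)) = exp_neg (x n)) F"
    using ev by eventually_elim (auto simp: exp_neg_def)
  ultimately show ?thesis
    using real by (auto simp: exp_neg_ennreal intro: Lim_transform_eventually)
next
  case top
  show ?thesis
  proof (rule tendstoI)
    fix e :: real assume e: "e > 0"
    have "eventually (\<lambda>n. x n > ennreal (max 0 (- ln e))) F"
      using assms top by (intro order_tendstoD(1)[OF assms]) simp
    then show "eventually (\<lambda>n. dist (exp_neg (x n)) (exp_neg l) < e) F"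
    proof eventually_elim
      case (elim n)
      show ?case
      proof (cases "x n")
        case (real r)
        have "r > - ln e"
        proof (rule ccontr)
          assume "\<not> r > - ln e"
          then have "ennreal r \<le> ennreal (max 0 (- ln e))" by (intro ennreal_leI) auto
          with elim real show False by (simp add: not_less[symmetric])
        qed
        then have "exp (- r) < exp (ln e)" by simp
        with e real top show ?thesis by (simp add: exp_neg_ennreal dist_real_def) (simp add: exp_neg_def)
      qed (use e top in \<open>simp add: exp_neg_def\<close>)
    qed
  qed
qed

text \<open>For a function with finitely many values the level sets form a partition, \<open>e\<^bsup>-\<mu>(g)\<^esup>\<close> is a product over
its cells, and each cell contributes \<open>(1 + z)\<^bsup>-\<nu>(A)\<^esup> = exp (- \<nu>(A) ln (1 + z))\<close> with \<open>z\<close> the value of \<open>g\<close>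
on \<open>A\<close>.\<close>

lemma laplace_functional_simple:
  fixes g :: "'a::metric_space \<Rightarrow> real" and \<nu> :: "'a measure"
  assumes Q: "gamma_process Q \<nu> (\<lambda>m. m)" "sets Q = sets \<M>"
    and \<nu>: "finite_measure \<nu>" "sets \<nu> = sets borel"
    and g: "g \<in> borel_measurable borel" "finite (range g)" "\<And>x. 0 \<le> g x"
  shows "laplace_functional Q g = exp (- (\<integral>x. ln (1 + g x) \<partial>\<nu>))"
proof -
  interpret \<nu>: finite_measure \<nu> by fact
  have sp: "space Q = space \<M>" by (rule sets_eq_imp_space_eq[OF Q(2)])
  define F where "F = (\<lambda>z. g -` {z}) ` range g"
  \<comment> \<open>the value of \<open>g\<close> on a level set\<close>
  define v where "v A = g (SOME x. x \<in> A)" for A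
  have mF: "A \<in> sets borel" if "A \<in> F" for A
    using that measurable_sets[OF g(1), of "{z}" for z] by (auto simp: F_def)
  have F: "borel_partition F"
    using g mF by (auto simp: borel_partition_def F_def disjoint_def)
  have v: "v A = g x" if "A \<in> F" "x \<in> A" for A x
  proof -
    have "(SOME x. x \<in> A) \<in> A" using that by (auto intro: someI)
    with that show ?thesis by (auto simp: F_def v_def)
  qed
  have v0: "v A \<ge> 0" for A using g by (simp add: v_def)
  note F' = borel_partitionD[OF F]
  \<comment> \<open>used in \<open>ennreal\<close> for \<open>\<mu>(g)\<close> and in \<open>real\<close> for \<open>\<integral> ln (1 + g) d\<nu>\<close>\<close>
  have split: "(\<Sum>A\<in>F. \<phi> (v A) * indicator A x) = \<phi> (g x)" for \<phi> :: "real \<Rightarrow> 'b::semiring_1" and x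
  proof -
    obtain A0 where A0: "A0 \<in> F" "x \<in> A0" using F'(4) by blast
    have "(\<Sum>A\<in>F. \<phi> (v A) * indicator A x) = (\<Sum>A\<in>F. if A = A0 then \<phi> (g x) else 0)"
      using A0 F'(3) v by (intro sum.cong) (auto simp: disjoint_def indicator_def)
    then show ?thesis using A0 F'(1) by simp
  qed
  let ?f = "\<lambda>A x. ennreal (exp_neg (ennreal (v A) * x))"
  have "laplace_functional Q g = enn2real (\<integral>\<^sup>+m. ennreal (exp_neg (\<integral>\<^sup>+y. ennreal (g y) \<partial>m)) \<partial>Q)"
    unfolding laplace_functional_def
  proof (rule integral_eq_nn_integral)
    have "(\<lambda>m. exp_neg (\<integral>\<^sup>+y. ennreal (g y) \<partial>m)) \<in> borel_measurable \<M>"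
      using g(1) by (intro measurable_compose[OF nn_integral_measurable_bf borel_measurable_exp_neg]) simp
    then show "(\<lambda>m. exp_neg (\<integral>\<^sup>+y. ennreal (g y) \<partial>m)) \<in> borel_measurable Q"
      by (simp add: measurable_cong_sets[OF Q(2) refl])
  qed simp
  also have "(\<integral>\<^sup>+m. ennreal (exp_neg (\<integral>\<^sup>+y. ennreal (g y) \<partial>m)) \<partial>Q) = (\<integral>\<^sup>+m. (\<Prod>A\<in>F. ?f A (masses F m A)) \<partial>Q)"
  proof (intro nn_integral_cong)
    fix m assume "m \<in> space Q"
    then have m: "sets m = sets borel" by (simp add: sp space_bf_measure_algebra)
    have "(\<integral>\<^sup>+y. ennreal (g y) \<partial>m) = (\<integral>\<^sup>+y. (\<Sum>A\<in>F. ennreal (v A) * indicator A y) \<partial>m)"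
      by (simp add: split)
    also have "\<dots> = (\<Sum>A\<in>F. ennreal (v A) * emeasure m A)"
      using mF m by (subst nn_integral_sum) (auto intro!: sum.cong nn_integral_cmult_indicator)
    also have "\<dots> = (\<Sum>A\<in>F. ennreal (v A) * masses F m A)"
      by (simp add: masses_def)
    finally show "ennreal (exp_neg (\<integral>\<^sup>+y. ennreal (g y) \<partial>m)) = (\<Prod>A\<in>F. ?f A (masses F m A))"
      by (simp add: exp_neg_sum prod_ennreal)
  qed
  also have "\<dots> = (\<integral>\<^sup>+x. (\<Prod>A\<in>F. ?f A (x A)) \<partial>gamma_masses \<nu> F)"
    by (rule nn_integral_masses[OF Q(1) F]) (intro borel_measurable_prod_ennreal, measurable)
  also have "\<dots> = (\<Prod>A\<in>F. \<integral>\<^sup>+x. ?f A x \<partial>gamma_mass_law (measure \<nu> A))"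
    using product_prob_space_gamma_mass_law F'(1)
    by (intro product_sigma_finite.product_nn_integral_prod product_prob_space.axioms) auto
  also have "\<dots> = (\<Prod>A\<in>F. ennreal ((1 + v A) powr (- measure \<nu> A)))"
  proof (intro prod.cong refl)
    fix A
    interpret ga: prob_space "gamma_mass_law (measure \<nu> A)" by (rule prob_space_gamma_mass_law) simp
    show "(\<integral>\<^sup>+x. ?f A x \<partial>gamma_mass_law (measure \<nu> A)) = ennreal ((1 + v A) powr (- measure \<nu> A))"
      using gamma_mass_law_exp_tilt[OF measure_nonneg v0, of "\<lambda>_. 1" \<nu> A A] ga.emeasure_space_1 by simp
  qed
  also have "enn2real \<dots> = (\<Prod>A\<in>F. (1 + v A) powr (- measure \<nu> A))"
    by (simp add: prod_ennreal prod_nonneg)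
  also have "\<dots> = (\<Prod>A\<in>F. exp (- (ln (1 + v A) * measure \<nu> A)))"
  proof (intro prod.cong refl)
    fix A
    have "1 + v A \<noteq> 0" using v0[of A] by linarith
    then show "(1 + v A) powr (- measure \<nu> A) = exp (- (ln (1 + v A) * measure \<nu> A))"
      by (simp add: powr_def mult.commute)
  qed
  also have "\<dots> = exp (- (\<Sum>A\<in>F. ln (1 + v A) * measure \<nu> A))"
    using F'(1) by (simp add: exp_sum sum_negf[symmetric])
  also have "(\<Sum>A\<in>F. ln (1 + v A) * measure \<nu> A) = (\<integral>x. (\<Sum>A\<in>F. ln (1 + v A) * indicator A x) \<partial>\<nu>)"
    using mF \<nu> \<nu>.emeasure_finite
    by (subst Bochner_Integration.integral_sum) (auto simp: less_top[symmetric] intro!: integrable_mult_right integrable_real_indicator)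
  also have "\<dots> = (\<integral>x. ln (1 + g x) \<partial>\<nu>)"
    by (simp add: split[of "\<lambda>z. ln (1 + z)"])
  finally show ?thesis .
qed

text \<open>Approximate \<open>g\<close> from below by simple functions. The left side converges boundedly, and the integrals
on the right are dominated by \<open>ln (1 + g)\<close>.\<close>

lemma laplace_functional_gamma_process:
  fixes g :: "'a::metric_space \<Rightarrow> real" and \<nu> :: "'a measure"
  assumes Q: "gamma_process Q \<nu> (\<lambda>m. m)" "sets Q = sets \<M>"
    and \<nu>: "finite_measure \<nu>" "sets \<nu> = sets borel"
    and g: "g \<in> borel_measurable borel" "\<And>x. 0 \<le> g x"
    and int: "integrable \<nu> (\<lambda>x. ln (1 + g x))"
  shows "laplace_functional Q g = exp (- (\<integral>x. ln (1 + g x) \<partial>\<nu>))"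
proof -
  interpret Q: prob_space Q by (rule gamma_processD(1)[OF Q(1)])
  have sp: "space Q = space \<M>" by (rule sets_eq_imp_space_eq[OF Q(2)])
  obtain f where f: "incseq f" "\<And>i. simple_function borel (f i)" "\<And>x. bdd_above (range (\<lambda>i. f i x))"
    "\<And>i x. 0 \<le> f i x" "g = (SUP i. f i)"
    using borel_measurable_implies_simple_function_sequence_real[OF g] by blast
  have mono: "incseq (\<lambda>i. f i x)" for x using f(1) by (auto simp: incseq_def le_fun_def)
  have lim: "(\<lambda>i. f i x) \<longlonglongrightarrow> g x" for x
    unfolding f(5) SUP_apply by (rule LIMSEQ_incseq_SUP[OF f(3) mono])
  have le: "f i x \<le> g x" for i x by (rule incseq_le[OF mono lim])
  have f_meas: "f i \<in> borel_measurable borel" for i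
    using f(2) by (rule borel_measurable_simple_function)
  have meas: "(\<lambda>m. exp_neg (\<integral>\<^sup>+y. ennreal (h y) \<partial>m)) \<in> borel_measurable Q" if "h \<in> borel_measurable borel" for h :: "'a \<Rightarrow> real"
    unfolding measurable_cong_sets[OF Q(2) refl]
    using that by (intro measurable_compose[OF nn_integral_measurable_bf borel_measurable_exp_neg]) simp
  have "(\<lambda>i. laplace_functional Q (f i)) \<longlonglongrightarrow> laplace_functional Q g"
    unfolding laplace_functional_def
  proof (rule integral_dominated_convergence[where w="\<lambda>_. 1"])
    show "AE m in Q. (\<lambda>i. exp_neg (\<integral>\<^sup>+y. ennreal (f i y) \<partial>m)) \<longlonglongrightarrow> exp_neg (\<integral>\<^sup>+y. ennreal (g y) \<partial>m)"
    proof (intro AE_I2 exp_neg_tendsto)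
      fix m assume "m \<in> space Q"
      then have m: "sets m = sets borel" by (simp add: sp space_bf_measure_algebra)
      have "(\<lambda>i. \<integral>\<^sup>+y. ennreal (f i y) \<partial>m) \<longlonglongrightarrow> (\<integral>\<^sup>+y. ennreal (g y) \<partial>m)"
      proof (rule nn_integral_LIMSEQ)
        show "incseq (\<lambda>i y. ennreal (f i y))"
          using mono by (auto simp: incseq_def le_fun_def intro!: ennreal_leI)
        show "(\<lambda>y. ennreal (f i y)) \<in> borel_measurable m" for i
          using f_meas by (simp add: measurable_cong_sets[OF m refl])
        show "(\<lambda>i. ennreal (f i y)) \<longlonglongrightarrow> ennreal (g y)" for y
          using lim by (rule tendsto_ennrealI)
      qed
      then show "(\<lambda>i. \<integral>\<^sup>+y. ennreal (f i y) \<partial>m) \<longlonglongrightarrow> (\<integral>\<^sup>+y. ennreal (g y) \<partial>m)" .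
    qed
  qed (use meas f_meas g(1) exp_neg_le_1 in auto)
  moreover have "laplace_functional Q (f i) = exp (- (\<integral>x. ln (1 + f i x) \<partial>\<nu>))" for i
  proof (rule laplace_functional_simple[OF Q \<nu> f_meas])
    show "finite (range (f i))" using simple_functionD(1)[OF f(2)[of i]] by simp
  qed (rule f(4))
  moreover have "(\<lambda>i. exp (- (\<integral>x. ln (1 + f i x) \<partial>\<nu>))) \<longlonglongrightarrow> exp (- (\<integral>x. ln (1 + g x) \<partial>\<nu>))"
  proof (intro tendsto_exp tendsto_minus integral_dominated_convergence[where w="\<lambda>x. ln (1 + g x)"])
    have pos: "1 + f i x > 0" "1 + g x > 0" for i x
      using f(4)[of i x] g(2)[of x] by linarith+
    show "AE x in \<nu>. (\<lambda>i. ln (1 + f i x)) \<longlonglongrightarrow> ln (1 + g x)"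
      using lim pos less_imp_neq[OF pos(2)] by (auto intro!: AE_I2 tendsto_ln tendsto_add)
    show "AE x in \<nu>. norm (ln (1 + f i x)) \<le> ln (1 + g x)" for i
      using le pos f(4) by (auto intro!: AE_I2)
    show "(\<lambda>x. ln (1 + f i x)) \<in> borel_measurable \<nu>" for i
      using f_meas[of i] \<nu>(2) by (simp add: measurable_cong_sets[OF \<nu>(2) refl])
    show "(\<lambda>x. ln (1 + g x)) \<in> borel_measurable \<nu>"
      using int by auto
  qed (rule int)
  ultimately show ?thesis by (metis (no_types, lifting) LIMSEQ_unique ext)
qed

lemma integrable_ln_1_plus_scale:
  fixes g :: "'a \<Rightarrow> real"
  assumes int: "integrable M (\<lambda>x. ln (1 + g x))" and g: "g \<in> borel_measurable M" "\<And>x. 0 \<le> g x"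
    and u: "0 \<le> u" "u \<le> 1"
  shows "integrable M (\<lambda>x. ln (1 + u * g x))"
proof (rule Bochner_Integration.integrable_bound[OF int])
  show "AE x in M. norm (ln (1 + u * g x)) \<le> norm (ln (1 + g x))"
  proof (intro AE_I2)
    fix x
    have "0 \<le> u * g x" "u * g x \<le> g x"
      using u g(2)[of x] by (auto intro: mult_left_le_one_le)
    then show "norm (ln (1 + u * g x)) \<le> norm (ln (1 + g x))" by simp
  qed
qed (use g in measurable)

text \<open>Mix the Laplace functional of the gamma process: \<open>(u m)(g) = m(u g)\<close>, and \<open>ln (1 + u g)\<close> stays integrable
for \<open>u \<le> 1\<close>.\<close>

lemma laplace_functional_beta_gamma_process:
  fixes g :: "'a::metric_space \<Rightarrow> real" and \<nu> :: "'a measure"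
  assumes X: "gamma_process (gamma_process_law \<nu>) \<nu> (\<lambda>m. m)"
    and \<nu>: "finite_measure \<nu>" "sets \<nu> = sets borel" and q: "0 < q" "q < measure \<nu> UNIV"
    and g: "g \<in> borel_measurable borel" "\<And>x. 0 \<le> g x"
    and int: "integrable \<nu> (\<lambda>x. ln (1 + g x))"
  shows "laplace_functional (beta_gamma_process_law \<nu> q) g =
    (\<integral>u. exp (- (\<integral>x. ln (1 + u * g x) \<partial>\<nu>)) \<partial>beta_law (measure \<nu> UNIV - q) q)"
proof -
  define Q where "Q = gamma_process_law \<nu>"
  define B where "B = beta_law (measure \<nu> UNIV - q) q"
  have Q: "gamma_process Q \<nu> (\<lambda>m. m)" "sets Q = sets \<M>"
    using X sets_gamma_process_law[OF X] by (simp_all add: Q_def)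
  note [measurable_cong] = Q(2)
  have sp: "space Q = space \<M>" by (rule sets_eq_imp_space_eq[OF Q(2)])
  interpret Q: prob_space Q by (rule gamma_processD(1)[OF Q(1)])
  interpret B: prob_space B using q unfolding B_def by (intro prob_space_beta_law) auto
  interpret BQ: pair_prob_space B Q ..
  interpret \<nu>: finite_measure \<nu> by fact
  have [measurable_cong]: "sets B = sets borel" by (simp add: B_def)
  have sc [measurable]: "(\<lambda>(u, m). scale_measure (ennreal u) m) \<in> measurable (B \<Otimes>\<^sub>M Q) \<M>"
    unfolding split_beta' by (intro measurable_scale_measure_bf) auto
  have L [measurable]: "(\<lambda>m. exp_neg (\<integral>\<^sup>+y. ennreal (g y) \<partial>m)) \<in> borel_measurable \<M>"
    using g(1) by (intro measurable_compose[OF nn_integral_measurable_bf borel_measurable_exp_neg]) simp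
  let ?f = "\<lambda>(u, m). exp_neg (\<integral>\<^sup>+y. ennreal (g y) \<partial>scale_measure (ennreal u) m)"
  have f [measurable]: "?f \<in> borel_measurable (B \<Otimes>\<^sub>M Q)"
    using measurable_compose[OF sc L] by (simp add: split_beta')
  have "laplace_functional (beta_gamma_process_law \<nu> q) g = (\<integral>p. ?f p \<partial>(B \<Otimes>\<^sub>M Q))"
    unfolding laplace_functional_def beta_gamma_process_law_eq_distr[OF X \<nu> q] Q_def[symmetric] B_def[symmetric]
    by (subst integral_distr) (auto simp: split_beta')
  also have "\<dots> = (\<integral>u. (\<integral>m. ?f (u, m) \<partial>Q) \<partial>B)"
    by (intro BQ.integral_fst'[symmetric] BQ.integrable_const_bound[where B=1] f)
       (auto simp: exp_neg_le_1)
  also have "\<dots> = (\<integral>u. exp (- (\<integral>x. ln (1 + u * g x) \<partial>\<nu>)) \<partial>B)"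
  proof (rule integral_cong_AE)
    show "AE u in B. (\<integral>m. ?f (u, m) \<partial>Q) = exp (- (\<integral>x. ln (1 + u * g x) \<partial>\<nu>))"
      using AE_beta_law[of "measure \<nu> UNIV - q" q] unfolding B_def[symmetric]
    proof eventually_elim
      case (elim u)
      have g': "g \<in> borel_measurable \<nu>" using g(1) by (simp add: measurable_cong_sets[OF \<nu>(2) refl])
      have "(\<integral>m. ?f (u, m) \<partial>Q) = laplace_functional Q (\<lambda>x. u * g x)"
        unfolding laplace_functional_def
      proof (rule Bochner_Integration.integral_cong[OF refl])
        fix m assume "m \<in> space Q"
        then have m: "sets m = sets borel" by (simp add: sp space_bf_measure_algebra)
        have gm: "g \<in> borel_measurable m" using g(1) by (simp add: measurable_cong_sets[OF m refl])
        then have "(\<integral>\<^sup>+y. ennreal (g y) \<partial>scale_measure (ennreal u) m) = (\<integral>\<^sup>+y. ennreal (u * g y) \<partial>m)"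
          using elim g(2) by (simp add: nn_integral_scale_measure nn_integral_cmult ennreal_mult)
        then show "?f (u, m) = exp_neg (\<integral>\<^sup>+y. ennreal (u * g y) \<partial>m)" by simp
      qed
      also have "\<dots> = exp (- (\<integral>x. ln (1 + u * g x) \<partial>\<nu>))"
        using elim g
        by (intro laplace_functional_gamma_process[OF Q \<nu>] integrable_ln_1_plus_scale[OF int g']) auto
      finally show ?case .
    qed
    show "(\<lambda>u. \<integral>m. ?f (u, m) \<partial>Q) \<in> borel_measurable B" by measurable
    have "(\<lambda>(u, x). ln (1 + u * g x)) \<in> borel_measurable (B \<Otimes>\<^sub>M \<nu>)"
      using g(1) \<nu>(2) by (simp cong: measurable_cong_sets add: split_beta')
    then have "(\<lambda>u. \<integral>x. ln (1 + u * g x) \<partial>\<nu>) \<in> borel_measurable B"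
      by (rule \<nu>.borel_measurable_lebesgue_integral)
    then show "(\<lambda>u. exp (- (\<integral>x. ln (1 + u * g x) \<partial>\<nu>))) \<in> borel_measurable B"
      by measurable
  qed
  finally show ?thesis by (simp add: B_def)
qed

lemma nn_integral_posterior_shape:
  fixes H :: "'a::topological_space measure"
  assumes H: "sets H = sets borel" and f: "f \<in> borel_measurable borel"
  shows "(\<integral>\<^sup>+x. f x \<partial>posterior_shape \<theta> H n y) = ennreal \<theta> * (\<integral>\<^sup>+x. f x \<partial>H) + (\<Sum>i=1..n. f (y i))"
  using f
proof induct
  case (cong f g)
  then show ?case by (simp cong: nn_integral_cong)
next
  case (set A)
  then show ?case using H by (simp add: emeasure_posterior_shape)
next
  case (mult f c)
  then show ?case
    using H by (simp add: nn_integral_cmult measurable_cong_sets[OF sets_posterior_shape refl]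
        measurable_cong_sets[OF H refl] distrib_left sum_distrib_left mult.left_commute)
next
  case (add f g)
  then show ?case
    using H by (simp add: nn_integral_add measurable_cong_sets[OF sets_posterior_shape refl]
        measurable_cong_sets[OF H refl] distrib_left sum.distrib add_ac)
next
  case (seq F)
  have m: "F i \<in> borel_measurable H" "F i \<in> borel_measurable (posterior_shape \<theta> H n y)" for i
    using seq(1)[of i] by (simp_all add: measurable_cong_sets[OF sets_posterior_shape refl]
        measurable_cong_sets[OF H refl])
  have inc: "incseq (\<lambda>i. F i x)" for x using seq by (auto simp: incseq_def le_fun_def)
  have inc': "incseq (\<lambda>i. \<integral>\<^sup>+x. F i x \<partial>M)" for M
    using seq by (auto simp: incseq_def le_fun_def intro!: nn_integral_mono)
  have "(\<integral>\<^sup>+x. (SUP i. F i) x \<partial>posterior_shape \<theta> H n y) = (SUP i. \<integral>\<^sup>+x. F i x \<partial>posterior_shape \<theta> H n y)"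
    unfolding SUP_apply using seq m by (intro nn_integral_monotone_convergence_SUP) auto
  also have "\<dots> = (SUP i. ennreal \<theta> * (\<integral>\<^sup>+x. F i x \<partial>H) + (\<Sum>j=1..n. F i (y j)))"
    using seq by simp
  also have "\<dots> = (SUP i. ennreal \<theta> * (\<integral>\<^sup>+x. F i x \<partial>H)) + (SUP i. (\<Sum>j=1..n. F i (y j)))"
    using inc inc' by (intro ennreal_SUP_add) (auto simp: incseq_def intro!: sum_mono mult_left_mono)
  also have "(SUP i. (\<Sum>j=1..n. F i (y j))) = (\<Sum>j=1..n. (SUP i. F i (y j)))"
    using inc by (intro ennreal_SUP_sum) auto
  also have "(SUP i. ennreal \<theta> * (\<integral>\<^sup>+x. F i x \<partial>H)) = ennreal \<theta> * (SUP i. \<integral>\<^sup>+x. F i x \<partial>H)"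
    by (simp add: SUP_mult_left_ennreal)
  also have "(SUP i. \<integral>\<^sup>+x. F i x \<partial>H) = (\<integral>\<^sup>+x. (SUP i. F i) x \<partial>H)"
    unfolding SUP_apply using seq m by (intro nn_integral_monotone_convergence_SUP[symmetric]) auto
  finally show ?case by (simp only: SUP_apply)
qed

lemma integral_posterior_shape:
  fixes H :: "'a::topological_space measure" and f :: "'a \<Rightarrow> real"
  assumes H: "sets H = sets borel" and f: "f \<in> borel_measurable borel" "\<And>x. 0 \<le> f x"
    and int: "integrable (scale_measure (ennreal \<theta>) H) f"
  shows "integrable (posterior_shape \<theta> H n y) f"
    and "(\<integral>x. f x \<partial>posterior_shape \<theta> H n y) = (\<integral>x. f x \<partial>scale_measure (ennreal \<theta>) H) + (\<Sum>i=1..n. f (y i))"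
proof -
  have fp: "f \<in> borel_measurable (posterior_shape \<theta> H n y)" and fH: "f \<in> borel_measurable H"
    using f(1) by (simp_all add: measurable_cong_sets[OF sets_posterior_shape refl] measurable_cong_sets[OF H refl])
  let ?I = "\<integral>x. f x \<partial>scale_measure (ennreal \<theta>) H"
  have I: "ennreal ?I = ennreal \<theta> * (\<integral>\<^sup>+x. ennreal (f x) \<partial>H)"
    using nn_integral_eq_integral[OF int] f(2) fH by (simp add: nn_integral_scale_measure)
  have I0: "0 \<le> ?I" using f(2) by (intro integral_nonneg_AE) auto
  have "(\<integral>\<^sup>+x. ennreal (f x) \<partial>posterior_shape \<theta> H n y) = ennreal ?I + (\<Sum>i=1..n. ennreal (f (y i)))"
    unfolding I using f(1) by (intro nn_integral_posterior_shape[OF H]) simp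
  also have "\<dots> = ennreal (?I + (\<Sum>i=1..n. f (y i)))"
    using I0 f(2) by (simp add: sum_nonneg)
  finally have *: "(\<integral>\<^sup>+x. ennreal (f x) \<partial>posterior_shape \<theta> H n y) = ennreal (?I + (\<Sum>i=1..n. f (y i)))" .
  then show "integrable (posterior_shape \<theta> H n y) f"
    using f(2) fp by (intro integrableI_nonneg) auto
  show "(\<integral>x. f x \<partial>posterior_shape \<theta> H n y) = ?I + (\<Sum>i=1..n. f (y i))"
  proof -
    have "(\<integral>x. f x \<partial>posterior_shape \<theta> H n y) = enn2real (\<integral>\<^sup>+x. ennreal (f x) \<partial>posterior_shape \<theta> H n y)"
      using f(2) fp by (intro integral_eq_nn_integral) auto
    then show ?thesis
      unfolding * using I0 f(2) by (simp only: enn2real_ennreal add_nonneg_nonneg sum_nonneg)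
  qed
qed

lemma prod_distinct_values:
  fixes f :: "'a \<Rightarrow> real"
  shows "(\<Prod>z\<in>distinct_values n y. f z powi (- int (block_size n y z))) = (\<Prod>i=1..n. inverse (f (y i)))"
proof -
  have "(\<Prod>z\<in>distinct_values n y. f z powi (- int (block_size n y z))) =
    (\<Prod>z\<in>y ` {1..n}. \<Prod>i\<in>{i\<in>{1..n}. y i = z}. inverse (f (y i)))"
    unfolding distinct_values_def block_size_def
    by (intro prod.cong refl) (simp add: power_int_minus power_inverse)
  also have "\<dots> = (\<Prod>i=1..n. inverse (f (y i)))"
    by (rule prod.group) auto
  finally show ?thesis .
qed

text \<open>The atoms of the shape contribute the factors \<open>1 / (1 + g(y\<^sub>i))\<close>, which are then collected according to
the value of \<open>y\<^sub>i\<close>.\<close>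

lemma exp_neg_integral_ln_posterior_shape:
  fixes H :: "'a::topological_space measure" and g :: "'a \<Rightarrow> real"
  assumes H: "sets H = sets borel" and g: "g \<in> borel_measurable borel" "\<And>x. 0 \<le> g x"
    and int: "integrable (scale_measure (ennreal \<theta>) H) (\<lambda>x. ln (1 + g x))"
  shows "exp (- (\<integral>x. ln (1 + g x) \<partial>posterior_shape \<theta> H n y)) =
    exp (- (\<integral>x. ln (1 + g x) \<partial>scale_measure (ennreal \<theta>) H)) *
      (\<Prod>z\<in>distinct_values n y. (1 + g z) powi (- int (block_size n y z)))"
proof -
  have "(\<integral>x. ln (1 + g x) \<partial>posterior_shape \<theta> H n y) =
      (\<integral>x. ln (1 + g x) \<partial>scale_measure (ennreal \<theta>) H) + (\<Sum>i=1..n. ln (1 + g (y i)))"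
    using g by (intro integral_posterior_shape(2)[OF H _ _ int]) auto
  moreover have "exp (- (\<Sum>i=1..n. ln (1 + g (y i)))) = (\<Prod>i=1..n. inverse (1 + g (y i)))"
  proof -
    have "exp (ln (1 + g x)) = 1 + g x" for x
      using g(2)[of x] by (intro exp_ln) linarith
    then show ?thesis by (simp add: exp_sum exp_minus o_def flip: prod_inversef)
  qed
  ultimately show ?thesis
    by (simp only: prod_distinct_values minus_add_distrib exp_add)
qed

lemma laplace_functional_posterior:
  fixes H :: "'a::metric_space measure" and g :: "'a \<Rightarrow> real"
  assumes H: "prob_space H" "sets H = sets borel" and \<theta>: "\<theta> > 0" and n: "n \<ge> 1"
    and \<mu>: "gamma_process M (scale_measure (ennreal \<theta>) H) \<mu>"
    and g: "g \<in> borel_measurable borel" "\<And>x. 0 \<le> g x"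
    and int: "integrable (scale_measure (ennreal \<theta>) H) (\<lambda>x. ln (1 + g x))"
  shows "laplace_functional (beta_gamma_process_law (posterior_shape \<theta> H n y) (real n)) g =
      (\<integral>u. exp (- (\<integral>x. ln (1 + u * g x) \<partial>scale_measure (ennreal \<theta>) H)) *
         (\<Prod>z\<in>distinct_values n y. (1 + u * g z) powi (- int (block_size n y z))) \<partial>beta_law \<theta> (real n))"
    (is "?L = (\<integral>u. ?F u \<partial>_)")
    and "laplace_functional (beta_gamma_process_law (posterior_shape \<theta> H n y) (real n)) g =
      (\<integral>v. exp (- (\<integral>x. ln (1 + 1 / (1 + v) * g x) \<partial>scale_measure (ennreal \<theta>) H)) *
         (\<Prod>z\<in>distinct_values n y. (1 + 1 / (1 + v) * g z) powi (- int (block_size n y z)))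
       \<partial>gamma_gamma_law (\<theta> + real n) (real n))"
proof -
  interpret H: prob_space H by fact
  let ?\<nu> = "posterior_shape \<theta> H n y"
  have m: "measure ?\<nu> UNIV = \<theta> + real n"
    using \<theta> H.prob_space sets_eq_imp_space_eq[OF H(2)]
    by (subst measure_posterior_shape[OF H]) auto
  have fin: "finite_measure ?\<nu>" by (rule finite_measure_posterior_shape[OF H])
  interpret S: finite_measure "scale_measure (ennreal \<theta>) H"
    by (rule finite_measureI) (simp add: space_scale_measure H.emeasure_space_1)
  have F: "?F \<in> borel_measurable borel"
  proof -
    have "(\<lambda>(u, x). ln (1 + u * g x)) \<in> borel_measurable (borel \<Otimes>\<^sub>M scale_measure (ennreal \<theta>) H)"
      using g(1) H(2) by (simp cong: measurable_cong_sets add: split_beta')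
    then have "(\<lambda>u. \<integral>x. ln (1 + u * g x) \<partial>scale_measure (ennreal \<theta>) H) \<in> borel_measurable borel"
      by (rule S.borel_measurable_lebesgue_integral)
    then show ?thesis unfolding prod_distinct_values by measurable
  qed
  have "?L = (\<integral>u. exp (- (\<integral>x. ln (1 + u * g x) \<partial>?\<nu>)) \<partial>beta_law \<theta> (real n))"
  proof -
    have "integrable ?\<nu> (\<lambda>x. ln (1 + g x))"
      using g by (intro integral_posterior_shape(1)[OF H(2) _ _ int]) auto
    moreover have "0 < real n" "real n < measure ?\<nu> UNIV" "measure ?\<nu> UNIV - real n = \<theta>"
      using n \<theta> by (simp_all add: m)
    ultimately show ?thesis
      using laplace_functional_beta_gamma_process[OF gamma_process_posterior_shape[OF H less_imp_le[OF \<theta>] \<mu>] fin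
        sets_posterior_shape _ _ g] by metis
  qed
  also have "\<dots> = (\<integral>u. ?F u \<partial>beta_law \<theta> (real n))"
  proof (rule integral_cong_AE)
    have eq: "exp (- (\<integral>x. ln (1 + u * g x) \<partial>?\<nu>)) = ?F u" if "0 < u" "u < 1" for u
    proof (rule exp_neg_integral_ln_posterior_shape[OF H(2)])
      show "integrable (scale_measure (ennreal \<theta>) H) (\<lambda>x. ln (1 + u * g x))"
        using that g H(2) by (intro integrable_ln_1_plus_scale[OF int])
          (auto simp: measurable_cong_sets[of "scale_measure (ennreal \<theta>) H" borel])
    qed (use that g in auto)
    show "AE u in beta_law \<theta> (real n). exp (- (\<integral>x. ln (1 + u * g x) \<partial>?\<nu>)) = ?F u"
      using AE_beta_law[of \<theta> "real n"]
    proof eventually_elim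
      case (elim u)
      then show ?case by (intro eq) auto
    qed
    show "?F \<in> borel_measurable (beta_law \<theta> (real n))" using F by simp
    interpret \<nu>: finite_measure ?\<nu> by fact
    have "(\<lambda>(u, x). ln (1 + u * g x)) \<in> borel_measurable (beta_law \<theta> (real n) \<Otimes>\<^sub>M ?\<nu>)"
      using g(1) by (simp cong: measurable_cong_sets add: split_beta')
    then have "(\<lambda>u. \<integral>x. ln (1 + u * g x) \<partial>?\<nu>) \<in> borel_measurable (beta_law \<theta> (real n))"
      by (rule \<nu>.borel_measurable_lebesgue_integral)
    then show "(\<lambda>u. exp (- (\<integral>x. ln (1 + u * g x) \<partial>?\<nu>))) \<in> borel_measurable (beta_law \<theta> (real n))"
      by measurable
  qed
  finally show *: "?L = (\<integral>u. ?F u \<partial>beta_law \<theta> (real n))" .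
  have "beta_law \<theta> (real n) = distr (gamma_gamma_law (\<theta> + real n) (real n)) borel (\<lambda>v. 1 / (1 + v))"
    using distr_gamma_gamma_law[of "real n" "\<theta> + real n"] \<theta> n by simp
  then show "?L = (\<integral>v. ?F (1 / (1 + v)) \<partial>gamma_gamma_law (\<theta> + real n) (real n))"
    unfolding * using F by (simp add: integral_distr)
qed

section \<open>The posterior law\<close>

text \<open>The total mass is the sum of the cell masses, so the weight \<open>T\<^bsup>-q\<^esup>\<close> is a function of the cell masses as
well.\<close>

lemma emeasure_beta_gamma_process_law_cylinder:
  fixes \<nu> :: "'a::metric_space measure"
  assumes X: "gamma_process (gamma_process_law \<nu>) \<nu> (\<lambda>m. m)"
    and F: "borel_partition F" and B: "B \<in> sets (mass_space F)"
  shows "emeasure (beta_gamma_process_law \<nu> q) (masses F -` B \<inter> space \<M>) =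
      ennreal (Gamma (measure \<nu> UNIV) / Gamma (measure \<nu> UNIV - q)) *
      (\<integral>\<^sup>+m. ennreal (enn2real (\<Sum>A\<in>F. masses F m A) powr (- q)) * indicator B (masses F m) \<partial>gamma_process_law \<nu>)"
  (is "emeasure _ ?C = ennreal ?K * (\<integral>\<^sup>+m. ?h (masses F m) \<partial>_)")
proof -
  note Q = sets_gamma_process_law[OF X]
  have sp: "space (gamma_process_law \<nu>) = space \<M>" by (rule sets_eq_imp_space_eq[OF Q])
  have C: "?C \<in> sets \<M>"
    using measurable_masses[OF borel_partitionD(2)[OF F]] B by (rule measurable_sets)
  have "(\<lambda>m. measure m UNIV) \<in> borel_measurable (gamma_process_law \<nu>)"
    unfolding measurable_cong_sets[OF Q refl] by (rule measurable_measure_bf) simp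
  then have "emeasure (beta_gamma_process_law \<nu> q) ?C =
      (\<integral>\<^sup>+m. ennreal (?K * measure m UNIV powr (- q)) * indicator ?C m \<partial>gamma_process_law \<nu>)"
    unfolding beta_gamma_process_law_def using C Q by (intro emeasure_density) auto
  also have "\<dots> = (\<integral>\<^sup>+m. ennreal ?K * ?h (masses F m) \<partial>gamma_process_law \<nu>)"
  proof (intro nn_integral_cong)
    fix m assume m: "m \<in> space (gamma_process_law \<nu>)"
    then have "measure m UNIV = enn2real (\<Sum>A\<in>F. masses F m A)"
      using emeasure_UNIV_masses[OF F, of m] by (simp add: sp measure_def)
    then show "ennreal (?K * measure m UNIV powr (- q)) * indicator ?C m = ennreal ?K * ?h (masses F m)"
      using m by (subst ennreal_mult'') (simp_all add: sp indicator_def)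
  qed
  also have "\<dots> = ennreal ?K * (\<integral>\<^sup>+m. ?h (masses F m) \<partial>gamma_process_law \<nu>)"
  proof (rule nn_integral_cmult)
    have "?h \<in> borel_measurable (mass_space F)" using B by measurable
    then show "(\<lambda>m. ?h (masses F m)) \<in> borel_measurable (gamma_process_law \<nu>)"
      unfolding measurable_cong_sets[OF Q refl]
      by (rule measurable_compose[OF measurable_masses[OF borel_partitionD(2)[OF F]]])
  qed
  finally show ?thesis .
qed

lemma ex_cells:
  assumes "borel_partition F" "y \<in> PiE I A" "\<And>i. i \<in> I \<Longrightarrow> union_of_cells F (A i)"
  shows "\<exists>\<kappa>\<in>PiE I (\<lambda>i. {c\<in>F. c \<subseteq> A i}). y \<in> PiE I \<kappa>"
proof -
  have "\<forall>i\<in>I. \<exists>c. c \<in> F \<and> c \<subseteq> A i \<and> y i \<in> c"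
  proof
    fix i assume i: "i \<in> I"
    then have "y i \<in> A i" using assms(2) by auto
    then show "\<exists>c. c \<in> F \<and> c \<subseteq> A i \<and> y i \<in> c"
      using assms(3)[OF i] unfolding union_of_cells_def by blast
  qed
  then obtain \<kappa> where \<kappa>: "\<forall>i\<in>I. \<kappa> i \<in> F \<and> \<kappa> i \<subseteq> A i \<and> y i \<in> \<kappa> i" by metis
  then show ?thesis
    using assms(2) by (intro bexI[of _ "restrict \<kappa> I"]) (auto simp: PiE_iff extensional_def)
qed

lemma measure_normalize_measure:
  assumes m: "sets m = sets borel" and T: "0 < emeasure m UNIV" "emeasure m UNIV < \<infinity>"
  shows "measure (normalize_measure m) A = measure m A / measure m UNIV"
proof -
  have sp: "space m = UNIV" using sets_eq_imp_space_eq[OF m] by simp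
  define t where "t = measure m UNIV"
  have t: "emeasure m UNIV = ennreal t" "t > 0"
    using T by (cases "emeasure m UNIV"; simp add: t_def measure_def)+
  have "1 / emeasure m (space m) = ennreal (1 / t)"
    using t by (simp add: sp divide_ennreal[symmetric])
  then show ?thesis
    using t by (simp add: normalize_measure_def t_def[symmetric])
qed

locale gamma_sample =
  fixes H :: "'a::metric_space measure" and M :: "'w measure" and \<mu> :: "'w \<Rightarrow> 'a measure"
    and Y :: "nat \<Rightarrow> 'w \<Rightarrow> 'a" and \<theta> :: real and n :: nat
  assumes H: "prob_space H" "sets H = sets borel" and \<theta>: "\<theta> > 0" and n: "n \<ge> 1"
    and \<mu>: "gamma_process M (scale_measure (ennreal \<theta>) H) \<mu>"
    and Y: "cond_iid M (generated_algebra M \<mu> \<M>) {1..n} Y (\<lambda>\<omega>. normalize_measure (\<mu> \<omega>))"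
begin

abbreviation sample :: "'w \<Rightarrow> nat \<Rightarrow> 'a" where
  "sample \<omega> \<equiv> \<lambda>i\<in>{1..n}. Y i \<omega>"

abbreviation sample_space :: "(nat \<Rightarrow> 'a) measure" where
  "sample_space \<equiv> PiM {1..n} (\<lambda>_. borel)"

abbreviation shape :: "(nat \<Rightarrow> 'a) \<Rightarrow> 'a measure" where
  "shape y \<equiv> posterior_shape \<theta> H n y"

abbreviation posterior :: "(nat \<Rightarrow> 'a) \<Rightarrow> 'a measure measure" where
  "posterior y \<equiv> beta_gamma_process_law (shape y) (real n)"

sublocale M: prob_space M by (rule gamma_processD(1)[OF \<mu>])

lemma measurable_\<mu> [measurable]: "\<mu> \<in> measurable M \<M>"
  by (rule gamma_processD(2)[OF \<mu>])

lemma measurable_Y: "i \<in> {1..n} \<Longrightarrow> Y i \<in> borel_measurable M"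
  using Y by (simp add: cond_iid_def)

lemma measurable_sample [measurable]: "sample \<in> measurable M sample_space"
  by (intro measurable_restrict measurable_Y)

lemma measure_shape: "A \<in> sets borel \<Longrightarrow> measure (shape y) A = \<theta> * measure H A + (\<Sum>i=1..n. indicator A (y i))"
  using \<theta> by (intro measure_posterior_shape[OF H]) auto

lemma measure_shape_UNIV [simp]: "measure (shape y) UNIV = \<theta> + real n"
  using prob_space.prob_space[OF H(1)] sets_eq_imp_space_eq[OF H(2)] by (simp add: measure_shape)

lemma gamma_process_shape: "gamma_process (gamma_process_law (shape y)) (shape y) (\<lambda>m. m)"
  using \<theta> by (intro gamma_process_posterior_shape[OF H _ \<mu>]) auto

lemma sets_posterior: "sets (posterior y) = sets \<M>"
  using sets_gamma_process_law[OF gamma_process_shape] by (simp add: beta_gamma_process_law_def)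

lemma prob_space_posterior: "prob_space (posterior y)"
proof -
  interpret Q: prob_space "gamma_process_law (shape y)" by (rule gamma_processD(1)[OF gamma_process_shape])
  interpret B: prob_space "beta_law \<theta> (real n)" using \<theta> n by (intro prob_space_beta_law) auto
  interpret P: pair_prob_space "beta_law \<theta> (real n)" "gamma_process_law (shape y)" ..
  note [measurable_cong] = sets_gamma_process_law[OF gamma_process_shape]
  have "(\<lambda>(u, m). scale_measure (ennreal u) m) \<in>
      measurable (beta_law \<theta> (real n) \<Otimes>\<^sub>M gamma_process_law (shape y)) \<M>"
    unfolding split_beta' by (intro measurable_scale_measure_bf) auto
  then have "prob_space (distr (beta_law \<theta> (real n) \<Otimes>\<^sub>M gamma_process_law (shape y)) \<M>
      (\<lambda>(u, m). scale_measure (ennreal u) m))"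
    by (rule P.prob_space_distr)
  also have "distr (beta_law \<theta> (real n) \<Otimes>\<^sub>M gamma_process_law (shape y)) \<M>
      (\<lambda>(u, m). scale_measure (ennreal u) m) = posterior y"
    using beta_gamma_process_law_eq_distr[OF gamma_process_shape finite_measure_posterior_shape[OF H]
        sets_posterior_shape, of "real n" y] \<theta> n by simp
  finally show ?thesis .
qed

text \<open>The shapes for \<open>y\<close> and \<open>y'\<close> have the same values on all cells if corresponding points lie in the same
cells.\<close>

lemma emeasure_posterior_cong:
  assumes F: "borel_partition F" and C: "C \<in> cylinders F"
    and eq: "\<And>i A. i \<in> {1..n} \<Longrightarrow> A \<in> F \<Longrightarrow> y i \<in> A \<longleftrightarrow> y' i \<in> A"
  shows "emeasure (posterior y) C = emeasure (posterior y') C"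
proof -
  obtain B where B: "B \<in> sets (mass_space F)" "C = masses F -` B \<inter> space \<M>"
    using C by (auto simp: cylinders_def)
  let ?h = "\<lambda>x. ennreal (enn2real (\<Sum>A\<in>F. x A) powr (- real n)) * indicator B x"
  have h: "?h \<in> borel_measurable (mass_space F)" using B(1) by measurable
  have m: "measure (shape y) A = measure (shape y') A" if "A \<in> F" for A
    using that eq borel_partitionD(5)[OF F] by (simp add: measure_shape indicator_def cong: sum.cong_simp)
  have *: "emeasure (posterior y) C = ennreal (Gamma (\<theta> + real n) / Gamma \<theta>) *
      (\<integral>\<^sup>+x. ?h x \<partial>gamma_masses (shape y) F)" for y
    unfolding B(2) emeasure_beta_gamma_process_law_cylinder[OF gamma_process_shape F B(1)]
      nn_integral_masses[OF gamma_process_shape F h] by simp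
  have "gamma_masses (shape y) F = gamma_masses (shape y') F"
    using m by (intro PiM_cong) auto
  then show ?thesis unfolding * by simp
qed

lemma emeasure_posterior_const_on_cells:
  assumes F: "borel_partition F" and C: "C \<in> cylinders F"
    and \<kappa>: "\<kappa> \<in> {1..n} \<rightarrow>\<^sub>E F" and y: "y \<in> PiE {1..n} \<kappa>" "y' \<in> PiE {1..n} \<kappa>"
  shows "emeasure (posterior y) C = emeasure (posterior y') C"
proof (rule emeasure_posterior_cong[OF F C])
  fix i A assume i: "i \<in> {1..n}" and A: "A \<in> F"
  then have "\<kappa> i \<in> F" "y i \<in> \<kappa> i" "y' i \<in> \<kappa> i" using \<kappa> y by auto
  then show "y i \<in> A \<longleftrightarrow> y' i \<in> A"
    using A borel_partitionD(3)[OF F] unfolding disjoint_def by (metis Int_iff empty_iff)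
qed

lemma cells_box_sets:
  assumes "borel_partition F" "\<kappa> \<in> {1..n} \<rightarrow>\<^sub>E F"
  shows "PiE {1..n} \<kappa> \<in> sets sample_space"
proof -
  have "\<kappa> i \<in> sets borel" if "i \<in> {1..n}" for i
    by (rule borel_partitionD(5)[OF assms(1) PiE_mem[OF assms(2) that]])
  then show ?thesis by (intro sets_PiM_I_finite) auto
qed

text \<open>On a generating cylinder the posterior probability takes finitely many values, one on each product of
cells, and is therefore measurable in the sample.\<close>

lemma measurable_posterior: "posterior \<in> measurable sample_space (prob_algebra \<M>)"
proof (rule measurable_prob_algebra_generated[OF sets_bf_measure_algebra Int_stable_partition_cylinders
      partition_cylinders_Pow prob_space_posterior sets_posterior])
  fix C :: "'a measure set" assume "C \<in> partition_cylinders"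
  then obtain F where F: "borel_partition F" and C: "C \<in> cylinders F"
    by (auto simp: partition_cylinders_def)
  show "(\<lambda>y. emeasure (posterior y) C) \<in> borel_measurable sample_space"
  proof (rule measurable_piecewise_restrict[where C="PiE {1..n} ` ({1..n} \<rightarrow>\<^sub>E F)"])
    show "countable (PiE {1..n} ` ({1..n} \<rightarrow>\<^sub>E F))"
      using borel_partitionD(1)[OF F] by (intro countable_finite finite_imageI finite_PiE) auto
    show "space sample_space \<subseteq> \<Union> (PiE {1..n} ` ({1..n} \<rightarrow>\<^sub>E F))"
    proof
      fix y :: "nat \<Rightarrow> 'a" assume "y \<in> space sample_space"
      then have "y \<in> PiE {1..n} (\<lambda>_. UNIV)" by (simp add: space_PiM)
      moreover have "union_of_cells F UNIV" using borel_partitionD(4)[OF F] by (auto simp: union_of_cells_def)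
      ultimately show "y \<in> \<Union> (PiE {1..n} ` ({1..n} \<rightarrow>\<^sub>E F))"
        using ex_cells[OF F, of y "{1..n}" "\<lambda>_. UNIV"] by auto
    qed
  next
    fix D assume "D \<in> PiE {1..n} ` ({1..n} \<rightarrow>\<^sub>E F)"
    then obtain \<kappa> where \<kappa>: "\<kappa> \<in> {1..n} \<rightarrow>\<^sub>E F" and D: "D = PiE {1..n} \<kappa>" by auto
    then show "D \<inter> space sample_space \<in> sets sample_space"
      using cells_box_sets[OF F \<kappa>] by auto
    show "(\<lambda>y. emeasure (posterior y) C) \<in> borel_measurable (restrict_space sample_space D)"
    proof (cases "D = {}")
      case True
      then show ?thesis by (simp add: measurable_def space_restrict_space)
    next
      case False
      then obtain y' where "y' \<in> D" by auto
      then have "emeasure (posterior y) C = emeasure (posterior y') C"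
        if "y \<in> space (restrict_space sample_space D)" for y
        using that emeasure_posterior_const_on_cells[OF F C \<kappa>, of y y'] by (auto simp: space_restrict_space D)
      then show ?thesis by (subst measurable_cong) auto
    qed
  qed
qed

text \<open>The defining property of the sample, integrated over \<open>\<mu> \<in> C\<close>: the conditional probability is
\<open>\<Prod> (\<mu>(A\<^sub>i) / T)\<close> because almost surely \<open>0 < T < \<infinity>\<close>, where normalization is an honest division.\<close>

lemma emeasure_sample_box:
  assumes A: "\<And>i. i \<in> {1..n} \<Longrightarrow> A i \<in> sets borel" and C: "C \<in> sets \<M>"
  shows "emeasure M {\<omega>\<in>space M. sample \<omega> \<in> PiE {1..n} A \<and> \<mu> \<omega> \<in> C} =
    (\<integral>\<^sup>+\<omega>. (\<Prod>i=1..n. emeasure (\<mu> \<omega>) (A i)) *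
      (ennreal (enn2real (emeasure (\<mu> \<omega>) UNIV) powr (- real n)) * indicator C (\<mu> \<omega>)) \<partial>M)"
proof -
  let ?F = "generated_algebra M \<mu> \<M>"
  let ?E = "{\<omega>\<in>space M. \<forall>i\<in>{1..n}. Y i \<omega> \<in> A i}"
  let ?D = "\<mu> -` C \<inter> space M"
  have sF: "sets ?F = {\<mu> -` A \<inter> space M | A. A \<in> sets \<M>}"
    by (rule sets_vimage_algebra2) (use measurable_space[OF measurable_\<mu>] in auto)
  have sub: "subalgebra M ?F"
    unfolding subalgebra_def sF using measurable_sets[OF measurable_\<mu>] by auto
  interpret F: sigma_finite_subalgebra M ?F
    by (intro finite_measure_subalgebra_is_sigma_finite finite_measure_subalgebra.intro
        finite_measure_subalgebra_axioms.intro M.finite_measure_axioms sub)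
  have E: "?E \<in> sets M" using A measurable_Y by measurable
  have D: "?D \<in> sets ?F" "?D \<in> sets M" unfolding sF using C by auto
  define p where "p \<omega> = (\<Prod>i=1..n. measure (normalize_measure (\<mu> \<omega>)) (A i))" for \<omega>
  have cond: "AE \<omega> in M. real_cond_exp M ?F (indicator ?E) \<omega> = p \<omega>"
    using Y A by (simp add: cond_iid_def p_def)
  have AE_T: "AE \<omega> in M. 0 < emeasure (\<mu> \<omega>) UNIV \<and> emeasure (\<mu> \<omega>) UNIV < \<infinity>"
    using AE_total_mass[OF \<mu>] \<theta> prob_space.prob_space[OF H(1)] sets_eq_imp_space_eq[OF H(2)] by simp
  have "M.prob (?E \<inter> ?D) = (\<integral>\<omega>\<in>?D. indicator ?E \<omega> \<partial>M)"
    using E D(2) by (simp add: set_lebesgue_integral_def indicator_inter_arith[symmetric] Int_commute)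
  also have "\<dots> = (\<integral>\<omega>\<in>?D. real_cond_exp M ?F (indicator ?E) \<omega> \<partial>M)"
    using E D(1) by (intro F.real_cond_exp_intA) (auto simp: M.emeasure_eq_measure)
  finally have "ennreal (M.prob (?E \<inter> ?D)) = ennreal (\<integral>\<omega>. indicator ?D \<omega> * real_cond_exp M ?F (indicator ?E) \<omega> \<partial>M)"
    by (simp add: set_lebesgue_integral_def)
  also have "\<dots> = (\<integral>\<^sup>+\<omega>. ennreal (indicator ?D \<omega> * real_cond_exp M ?F (indicator ?E) \<omega>) \<partial>M)"
  proof (rule nn_integral_eq_integral[symmetric])
    show "integrable M (\<lambda>\<omega>. indicator ?D \<omega> * real_cond_exp M ?F (indicator ?E) \<omega>)"
      using E D(2) integrable_mult_indicator[OF D(2) F.real_cond_exp_int(1), of "indicator ?E"]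
      by (simp add: M.emeasure_eq_measure)
    show "AE \<omega> in M. 0 \<le> indicator ?D \<omega> * real_cond_exp M ?F (indicator ?E) \<omega>"
      using cond
    proof eventually_elim
      case (elim \<omega>)
      have "0 \<le> p \<omega>" unfolding p_def by (intro prod_nonneg) simp
      then show ?case unfolding elim by simp
    qed
  qed
  also have "\<dots> = (\<integral>\<^sup>+\<omega>. (\<Prod>i=1..n. emeasure (\<mu> \<omega>) (A i)) *
      (ennreal (enn2real (emeasure (\<mu> \<omega>) UNIV) powr (- real n)) * indicator C (\<mu> \<omega>)) \<partial>M)"
  proof (rule nn_integral_cong_AE)
    show "AE \<omega> in M. ennreal (indicator ?D \<omega> * real_cond_exp M ?F (indicator ?E) \<omega>) =
      (\<Prod>i=1..n. emeasure (\<mu> \<omega>) (A i)) *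
      (ennreal (enn2real (emeasure (\<mu> \<omega>) UNIV) powr (- real n)) * indicator C (\<mu> \<omega>))"
      using cond AE_T AE_space
    proof eventually_elim
      case (elim \<omega>)
      have m: "sets (\<mu> \<omega>) = sets borel"
        using measurable_space[OF measurable_\<mu> elim(3)] by (simp add: space_bf_measure_algebra)
      interpret m: finite_measure "\<mu> \<omega>"
        using elim(2) sets_eq_imp_space_eq[OF m] by (intro finite_measureI) auto
      define t where "t = measure (\<mu> \<omega>) UNIV"
      have t: "t > 0" "enn2real (emeasure (\<mu> \<omega>) UNIV) = t"
        using elim(2) by (auto simp: t_def m.emeasure_eq_measure)
      have "p \<omega> = (\<Prod>i=1..n. measure (\<mu> \<omega>) (A i) / t)"
        using elim(2) unfolding p_def t_def by (intro prod.cong refl measure_normalize_measure m) auto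
      also have "\<dots> = (\<Prod>i=1..n. measure (\<mu> \<omega>) (A i)) * t powr (- real n)"
        using t by (simp add: prod_dividef powr_minus_divide powr_realpow)
      finally have "ennreal (p \<omega>) = (\<Prod>i=1..n. emeasure (\<mu> \<omega>) (A i)) * ennreal (t powr (- real n))"
        by (simp add: ennreal_mult prod_nonneg m.emeasure_eq_measure prod_ennreal)
      then show ?case
        using elim by (simp add: t(2) indicator_def)
    qed
  qed
  also have "?E \<inter> ?D = {\<omega>\<in>space M. sample \<omega> \<in> PiE {1..n} A \<and> \<mu> \<omega> \<in> C}"
    by (auto simp: PiE_iff)
  finally show ?thesis by (simp add: M.emeasure_eq_measure)
qed

text \<open>Grouping equal cells, \<open>\<Prod> \<mu>(\<kappa>\<^sub>i)\<close> becomes \<open>\<Prod> \<mu>(A)\<^bsup>k(A)\<^esup>\<close>, where \<open>k(A)\<close> counts the \<open>i\<close> with \<open>\<kappa>\<^sub>i = A\<close>. The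
power tilt replaces \<open>\<theta> H\<close> by the posterior shape of any \<open>y\<close> in the product of the \<open>\<kappa>\<^sub>i\<close>, and the
factor \<open>T\<^bsup>-n\<^esup>\<close> that is left turns the gamma process into the posterior. The constant is
identified by taking for \<open>C\<close> the whole space.\<close>

lemma bayes_on_cells:
  assumes F: "borel_partition F" and C: "C \<in> cylinders F"
    and \<kappa>: "\<kappa> \<in> {1..n} \<rightarrow>\<^sub>E F" and y: "y \<in> PiE {1..n} \<kappa>"
  shows "emeasure M {\<omega>\<in>space M. sample \<omega> \<in> PiE {1..n} \<kappa> \<and> \<mu> \<omega> \<in> C} =
    emeasure M {\<omega>\<in>space M. sample \<omega> \<in> PiE {1..n} \<kappa>} * emeasure (posterior y) C"
proof -
  define k where "k A = card {i\<in>{1..n}. \<kappa> i = A}" for A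
  define Q0 where "Q0 = distr M \<M> \<mu>"
  define c where "c = ennreal (\<Prod>A\<in>F. pochhammer (measure (scale_measure (ennreal \<theta>) H) A) (k A))"
  have Q0: "gamma_process Q0 (scale_measure (ennreal \<theta>) H) (\<lambda>m. m)"
    unfolding Q0_def by (rule gamma_process_distr[OF \<mu>])
  note F' = borel_partitionD[OF F]
  have \<kappa>F: "\<kappa> i \<in> F" if "i \<in> {1..n}" for i using \<kappa> that by auto
  \<comment> \<open>the only cell that contains \<open>y i\<close> is \<open>\<kappa> i\<close>, so \<open>k\<close> counts the sample points in each cell\<close>
  have iff: "y i \<in> A \<longleftrightarrow> \<kappa> i = A" if "i \<in> {1..n}" "A \<in> F" for i A
  proof -
    have "y i \<in> \<kappa> i" using y that by auto
    then show ?thesis using \<kappa>F[OF that(1)] that(2) F'(3) unfolding disjoint_def by (metis Int_iff empty_iff)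
  qed
  have shape: "measure (shape y) A = measure (scale_measure (ennreal \<theta>) H) A + real (k A)" if "A \<in> F" for A
  proof -
    have "(\<Sum>i=1..n. indicator A (y i) :: real) = (\<Sum>i=1..n. if \<kappa> i = A then 1 else 0)"
      using iff that by (intro sum.cong) (auto simp: indicator_def)
    also have "\<dots> = real (k A)" by (simp add: k_def sum.If_cases Int_def)
    finally show ?thesis using \<theta> F'(5)[OF that] by (simp add: measure_shape)
  qed
  have key: "emeasure M {\<omega>\<in>space M. sample \<omega> \<in> PiE {1..n} \<kappa> \<and> \<mu> \<omega> \<in> C} =
    c * ennreal (Gamma \<theta> / Gamma (\<theta> + real n)) * emeasure (posterior y) C" if C: "C \<in> cylinders F" for C
  proof -
    obtain B where B: "B \<in> sets (mass_space F)" "C = masses F -` B \<inter> space \<M>"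
      using C by (auto simp: cylinders_def)
    have Cs: "C \<in> sets \<M>" using cylinders_sets[OF F'(2)] C by auto
    let ?h = "\<lambda>x. ennreal (enn2real (\<Sum>A\<in>F. x A) powr (- real n)) * indicator B x"
    have h: "?h \<in> borel_measurable (mass_space F)" using B(1) by measurable
    have meas: "(\<lambda>x. (\<Prod>A\<in>F. x A ^ k A) * ?h x) \<in> borel_measurable (mass_space F)"
      by (intro borel_measurable_times_ennreal[OF _ h] borel_measurable_prod_ennreal) auto
    have "emeasure M {\<omega>\<in>space M. sample \<omega> \<in> PiE {1..n} \<kappa> \<and> \<mu> \<omega> \<in> C} =
      (\<integral>\<^sup>+\<omega>. (\<Prod>i=1..n. emeasure (\<mu> \<omega>) (\<kappa> i)) *
      (ennreal (enn2real (emeasure (\<mu> \<omega>) UNIV) powr (- real n)) * indicator C (\<mu> \<omega>)) \<partial>M)"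
      using \<kappa>F F'(5) by (intro emeasure_sample_box Cs) auto
    also have "\<dots> = (\<integral>\<^sup>+\<omega>. (\<Prod>A\<in>F. masses F (\<mu> \<omega>) A ^ k A) * ?h (masses F (\<mu> \<omega>)) \<partial>M)"
    proof (intro nn_integral_cong arg_cong2[where f="(*)"])
      fix \<omega> assume "\<omega> \<in> space M"
      then have m: "\<mu> \<omega> \<in> space \<M>" by (rule measurable_space[OF measurable_\<mu>])
      show "(\<Prod>i=1..n. emeasure (\<mu> \<omega>) (\<kappa> i)) = (\<Prod>A\<in>F. masses F (\<mu> \<omega>) A ^ k A)"
      proof -
        have "(\<Prod>i=1..n. emeasure (\<mu> \<omega>) (\<kappa> i)) = (\<Prod>A\<in>F. \<Prod>i\<in>{i\<in>{1..n}. \<kappa> i = A}. emeasure (\<mu> \<omega>) (\<kappa> i))"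
          using F'(1) \<kappa>F by (intro prod.group[symmetric]) auto
        also have "\<dots> = (\<Prod>A\<in>F. \<Prod>i\<in>{i\<in>{1..n}. \<kappa> i = A}. masses F (\<mu> \<omega>) A)"
          by (intro prod.cong refl) (auto simp: masses_def)
        finally show ?thesis by (simp add: k_def)
      qed
      show "ennreal (enn2real (emeasure (\<mu> \<omega>) UNIV) powr (- real n)) =
          ennreal (enn2real (\<Sum>A\<in>F. masses F (\<mu> \<omega>) A) powr (- real n))"
        using emeasure_UNIV_masses[OF F m] by simp
      show "indicator C (\<mu> \<omega>) = (indicator B (masses F (\<mu> \<omega>)) :: ennreal)"
        using m by (simp add: B(2) indicator_def)
    qed
    also have "\<dots> = (\<integral>\<^sup>+m. (\<Prod>A\<in>F. masses F m A ^ k A) * ?h (masses F m) \<partial>Q0)"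
      unfolding Q0_def
      using measurable_compose[OF measurable_masses[OF F'(2)] meas]
      by (intro nn_integral_distr[symmetric, OF measurable_\<mu>])
         (simp only: measurable_cong_sets[OF sets_distr refl])
    also have "\<dots> = c * (\<integral>\<^sup>+m. ?h (masses F m) \<partial>gamma_process_law (shape y))"
      unfolding c_def by (rule gamma_process_power_tilt[OF Q0 gamma_process_shape F shape h])
    also have "(\<integral>\<^sup>+m. ?h (masses F m) \<partial>gamma_process_law (shape y)) =
        ennreal (Gamma \<theta> / Gamma (\<theta> + real n)) * emeasure (posterior y) C"
    proof -
      have pos: "Gamma \<theta> > 0" "Gamma (\<theta> + real n) > 0" using \<theta> by (auto intro!: Gamma_real_pos)
      have "ennreal (Gamma \<theta> / Gamma (\<theta> + real n)) * ennreal (Gamma (\<theta> + real n) / Gamma \<theta>) = 1"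
        using pos by (simp add: ennreal_mult[symmetric])
      then show ?thesis
        unfolding B(2) emeasure_beta_gamma_process_law_cylinder[OF gamma_process_shape F B(1)]
        by (simp add: mult.assoc[symmetric])
    qed
    finally show ?thesis by (simp only: mult.assoc)
  qed
  have "emeasure M {\<omega>\<in>space M. sample \<omega> \<in> PiE {1..n} \<kappa>} = c * ennreal (Gamma \<theta> / Gamma (\<theta> + real n))"
  proof -
    interpret P: prob_space "posterior y" by (rule prob_space_posterior)
    have "{\<omega>\<in>space M. sample \<omega> \<in> PiE {1..n} \<kappa>} =
        {\<omega>\<in>space M. sample \<omega> \<in> PiE {1..n} \<kappa> \<and> \<mu> \<omega> \<in> space \<M>}"
      using measurable_space[OF measurable_\<mu>] by auto
    then show ?thesis
      using key[OF space_in_cylinders] P.emeasure_space_1 sets_eq_imp_space_eq[OF sets_posterior, of y] by simp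
  qed
  then show ?thesis using key[OF C] by simp
qed

lemma emeasure_posterior_measurable:
  "B \<in> sets \<M> \<Longrightarrow> (\<lambda>y. emeasure (posterior y) B) \<in> borel_measurable sample_space"
  by (rule measurable_compose[OF measurable_prob_algebraD[OF measurable_posterior] measurable_emeasure_subprob_algebra])

text \<open>For a fixed cylinder both sides are measures in \<open>D\<close>. To compare them on a product of Borel sets, refine
the partition until each of these sets is a union of cells; the product then splits into finitely
many products of cells, where the previous lemma applies and the posterior probability is constant.\<close>

lemma bayes_on_cylinders:
  assumes C: "C \<in> partition_cylinders" and D: "D \<in> sets sample_space"
  shows "emeasure M {\<omega>\<in>space M. sample \<omega> \<in> D \<and> \<mu> \<omega> \<in> C} =
    (\<integral>\<^sup>+y. indicator D y * emeasure (posterior y) C \<partial>distr M sample_space sample)"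
proof -
  obtain F1 where F1: "borel_partition F1" and C1: "C \<in> cylinders F1"
    using C by (auto simp: partition_cylinders_def)
  have Cs: "C \<in> sets \<M>" using cylinders_sets[OF borel_partitionD(2)[OF F1]] C1 by auto
  let ?m = "distr M sample_space sample"
  let ?E = "\<mu> -` C \<inter> space M"
  have E [measurable]: "?E \<in> sets M" using Cs by (intro measurable_sets[OF measurable_\<mu>])
  let ?L = "distr (density M (indicator ?E)) sample_space sample"
  let ?R = "density ?m (\<lambda>y. emeasure (posterior y) C)"
  note meas [measurable] = emeasure_posterior_measurable[OF Cs]
  have L: "emeasure ?L D = emeasure M {\<omega>\<in>space M. sample \<omega> \<in> D \<and> \<mu> \<omega> \<in> C}"
    if D: "D \<in> sets sample_space" for D
  proof -
    have S: "sample -` D \<inter> space M \<in> sets M" using D by (rule measurable_sets[OF measurable_sample])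
    have "sample \<in> measurable (density M (indicator ?E)) sample_space"
      using measurable_sample by (simp only: measurable_cong_sets[OF sets_density refl])
    then have "emeasure ?L D = emeasure (density M (indicator ?E)) (sample -` D \<inter> space M)"
      using D by (simp only: emeasure_distr space_density)
    also have "\<dots> = (\<integral>\<^sup>+\<omega>. indicator ?E \<omega> * indicator (sample -` D \<inter> space M) \<omega> \<partial>M)"
      by (rule emeasure_density[OF borel_measurable_indicator[OF E] S])
    also have "\<dots> = (\<integral>\<^sup>+\<omega>. indicator (?E \<inter> (sample -` D \<inter> space M)) \<omega> \<partial>M)"
      by (simp add: indicator_inter_arith)
    also have "\<dots> = emeasure M (?E \<inter> (sample -` D \<inter> space M))"
      using S E by (intro nn_integral_indicator) auto
    also have "?E \<inter> (sample -` D \<inter> space M) = {\<omega>\<in>space M. sample \<omega> \<in> D \<and> \<mu> \<omega> \<in> C}" by auto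
    finally show ?thesis .
  qed
  have R: "emeasure ?R D = (\<integral>\<^sup>+y. indicator D y * emeasure (posterior y) C \<partial>?m)"
    if D: "D \<in> sets sample_space" for D
    by (subst emeasure_density)
       (simp_all only: measurable_cong_sets[OF sets_distr refl] meas sets_distr D mult.commute)
  have "?L = ?R"
  proof (rule measure_eqI_PiM_finite)
    fix A :: "nat \<Rightarrow> 'a set" assume A: "\<And>i. i \<in> {1..n} \<Longrightarrow> A i \<in> sets borel"
    have "finite (F1 \<union> A ` {1..n})" "F1 \<union> A ` {1..n} \<subseteq> sets borel"
      using borel_partitionD(1,2)[OF F1] A by blast+
    from ex_refining_partition[OF this]
    obtain F where F: "borel_partition F" "\<forall>S\<in>F1 \<union> A ` {1..n}. union_of_cells F S" by blast
    have CF: "C \<in> cylinders F"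
      using cylinders_mono[OF F(1), of F1] F(2) borel_partitionD(1)[OF F1] C1 by auto
    let ?K = "PiE {1..n} (\<lambda>i. {c\<in>F. c \<subseteq> A i})"
    have KF: "\<kappa> \<in> {1..n} \<rightarrow>\<^sub>E F" if "\<kappa> \<in> ?K" for \<kappa> using that by (auto simp: PiE_iff)
    have finK: "finite ?K" using borel_partitionD(1)[OF F(1)] by (intro finite_PiE) auto
    have box: "PiE {1..n} A = (\<Union>\<kappa>\<in>?K. PiE {1..n} \<kappa>)"
    proof
      show "PiE {1..n} A \<subseteq> (\<Union>\<kappa>\<in>?K. PiE {1..n} \<kappa>)"
      proof
        fix y assume "y \<in> PiE {1..n} A"
        then have "\<exists>\<kappa>\<in>?K. y \<in> PiE {1..n} \<kappa>" using F(2) by (intro ex_cells[OF F(1)]) auto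
        then show "y \<in> (\<Union>\<kappa>\<in>?K. PiE {1..n} \<kappa>)" by blast
      qed
      show "(\<Union>\<kappa>\<in>?K. PiE {1..n} \<kappa>) \<subseteq> PiE {1..n} A"
      proof (intro UN_least PiE_mono)
        fix \<kappa> i assume "\<kappa> \<in> ?K" "i \<in> {1..n}"
        then show "\<kappa> i \<subseteq> A i" by (auto dest: PiE_mem)
      qed
    qed
    have disj: "disjoint_family_on (PiE {1..n}) ?K"
      unfolding disjoint_family_on_def
    proof (intro ballI impI)
      fix \<kappa> \<kappa>' assume k: "\<kappa> \<in> ?K" "\<kappa>' \<in> ?K" "\<kappa> \<noteq> \<kappa>'"
      then obtain i where i: "i \<in> {1..n}" "\<kappa> i \<noteq> \<kappa>' i" by (meson PiE_ext)
      then have "\<kappa> i \<inter> \<kappa>' i = {}"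
        using KF[OF k(1)] KF[OF k(2)] borel_partitionD(3)[OF F(1)] unfolding disjoint_def by blast
      then show "PiE {1..n} \<kappa> \<inter> PiE {1..n} \<kappa>' = {}" using i(1) by (auto dest!: PiE_mem)
    qed
    have add: "emeasure P (PiE {1..n} A) = (\<Sum>\<kappa>\<in>?K. emeasure P (PiE {1..n} \<kappa>))"
      if "sets P = sets sample_space" for P
      unfolding box using that finK disj KF cells_box_sets[OF F(1)]
      by (intro sum_emeasure[symmetric]) auto
    show "emeasure ?L (PiE {1..n} A) = emeasure ?R (PiE {1..n} A)"
    proof -
      have "emeasure ?L (PiE {1..n} \<kappa>) = emeasure ?R (PiE {1..n} \<kappa>)" if \<kappa>: "\<kappa> \<in> ?K" for \<kappa>
      proof (cases "PiE {1..n} \<kappa> = {}")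
        case False
        then obtain y where y: "y \<in> PiE {1..n} \<kappa>" by auto
        note \<kappa>F = KF[OF \<kappa>]
        note bs = cells_box_sets[OF F(1) \<kappa>F]
        have "emeasure ?R (PiE {1..n} \<kappa>) = (\<integral>\<^sup>+z. emeasure (posterior y) C * indicator (PiE {1..n} \<kappa>) z \<partial>?m)"
          unfolding R[OF bs]
          using emeasure_posterior_const_on_cells[OF F(1) CF \<kappa>F _ y]
          by (intro nn_integral_cong) (auto simp: indicator_def)
        also have "\<dots> = emeasure (posterior y) C * emeasure ?m (PiE {1..n} \<kappa>)"
          using bs by (intro nn_integral_cmult_indicator) simp
        also have "emeasure ?m (PiE {1..n} \<kappa>) = emeasure M {\<omega>\<in>space M. sample \<omega> \<in> PiE {1..n} \<kappa>}"
          unfolding emeasure_distr[OF measurable_sample bs] by (rule arg_cong[where f="emeasure M"]) blast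
        finally show ?thesis
          unfolding L[OF bs] bayes_on_cells[OF F(1) CF \<kappa>F y] by (simp only: mult.commute)
      qed simp
      then show ?thesis by (subst (1 2) add) auto
    qed
  next
    show "range (\<lambda>i::nat. space sample_space) \<subseteq> prod_algebra {1..n} (\<lambda>_. borel)"
      unfolding space_PiM by (auto intro!: prod_algebraI_finite)
    show "emeasure ?L (space sample_space) \<noteq> \<infinity>"
      unfolding L[OF sets.top] by (simp add: M.emeasure_eq_measure)
  qed auto
  then show ?thesis using L[OF D] R[OF D] by simp
qed

text \<open>Now \<open>D\<close> is fixed and both sides are measures in \<open>B\<close> that agree on all partition cylinders. The right side
is the measure that the kernel makes out of the sample law restricted to \<open>D\<close>.\<close>

lemma bayes:
  assumes B: "B \<in> sets \<M>" and D: "D \<in> sets sample_space"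
  shows "emeasure M {\<omega>\<in>space M. sample \<omega> \<in> D \<and> \<mu> \<omega> \<in> B} =
    (\<integral>\<^sup>+y. indicator D y * emeasure (posterior y) B \<partial>distr M sample_space sample)"
proof -
  let ?m = "density (distr M sample_space sample) (indicator D)"
  let ?E = "sample -` D \<inter> space M"
  have E [measurable]: "?E \<in> sets M" using D by (intro measurable_sets[OF measurable_sample])
  let ?L = "distr (density M (indicator ?E)) \<M> \<mu>"
  let ?R = "bind ?m posterior"
  have K: "posterior \<in> measurable ?m (subprob_algebra \<M>)"
    using measurable_prob_algebraD[OF measurable_posterior] by (simp cong: measurable_cong_sets)
  have ne: "space ?m \<noteq> {}" by (simp add: space_PiM PiE_eq_empty_iff)
  have L: "emeasure ?L B = emeasure M {\<omega>\<in>space M. sample \<omega> \<in> D \<and> \<mu> \<omega> \<in> B}"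
    if B: "B \<in> sets \<M>" for B
  proof -
    have S: "\<mu> -` B \<inter> space M \<in> sets M" using B by (rule measurable_sets[OF measurable_\<mu>])
    have "emeasure ?L B = emeasure (density M (indicator ?E)) (\<mu> -` B \<inter> space M)"
      using B by (subst emeasure_distr) auto
    also have "\<dots> = (\<integral>\<^sup>+\<omega>. indicator ?E \<omega> * indicator (\<mu> -` B \<inter> space M) \<omega> \<partial>M)"
      by (rule emeasure_density[OF borel_measurable_indicator[OF E] S])
    also have "\<dots> = (\<integral>\<^sup>+\<omega>. indicator (?E \<inter> (\<mu> -` B \<inter> space M)) \<omega> \<partial>M)"
      by (simp add: indicator_inter_arith)
    also have "\<dots> = emeasure M (?E \<inter> (\<mu> -` B \<inter> space M))"
      using S E by (intro nn_integral_indicator) auto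
    also have "?E \<inter> (\<mu> -` B \<inter> space M) = {\<omega>\<in>space M. sample \<omega> \<in> D \<and> \<mu> \<omega> \<in> B}" by auto
    finally show ?thesis .
  qed
  have R: "emeasure ?R B = (\<integral>\<^sup>+y. indicator D y * emeasure (posterior y) B \<partial>distr M sample_space sample)"
    if B: "B \<in> sets \<M>" for B
    using emeasure_bind[OF ne K B] D emeasure_posterior_measurable[OF B]
    by (simp add: nn_integral_density)
  have "?L = ?R"
  proof (rule bf_measure_eqI)
    show "sets ?R = sets \<M>" by (rule sets_bind) (use K ne sets_posterior in auto)
    show "finite_measure ?L"
    proof (rule finite_measureI)
      show "emeasure ?L (space ?L) \<noteq> \<infinity>"
        using L[OF sets.top] by (simp add: M.emeasure_eq_measure)
    qed
  next
    fix F :: "'a set set" and C assume F: "borel_partition F" and C: "C \<in> cylinders F"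
    have "C \<in> sets \<M>" using cylinders_sets[OF borel_partitionD(2)[OF F]] C by auto
    moreover have "C \<in> partition_cylinders" using F C by (auto simp: partition_cylinders_def)
    ultimately show "emeasure ?L C = emeasure ?R C"
      using L R bayes_on_cylinders D by simp
  qed simp
  then show ?thesis using L[OF B] R[OF B] by simp
qed

lemma regular_cond_distr_posterior:
  "regular_cond_distr M \<mu> \<M> sample sample_space posterior"
  unfolding regular_cond_distr_def
proof (intro conjI ballI measurable_\<mu> measurable_sample measurable_posterior)
  fix B :: "'a measure set" assume B: "B \<in> sets \<M>"
  let ?F = "generated_algebra M sample sample_space"
  have sF: "sets ?F = {sample -` A \<inter> space M | A. A \<in> sets sample_space}"
    by (rule sets_vimage_algebra2) (use measurable_space[OF measurable_sample] in auto)
  have sub: "subalgebra M ?F"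
    unfolding subalgebra_def sF using measurable_sets[OF measurable_sample] by auto
  interpret F: sigma_finite_subalgebra M ?F
    by (intro finite_measure_subalgebra_is_sigma_finite finite_measure_subalgebra.intro
        finite_measure_subalgebra_axioms.intro M.finite_measure_axioms sub)
  let ?E = "\<mu> -` B \<inter> space M"
  have E [measurable]: "?E \<in> sets M" using B by (intro measurable_sets[OF measurable_\<mu>])
  have mp: "(\<lambda>y. measure (posterior y) B) \<in> borel_measurable sample_space"
    unfolding measure_def by (intro borel_measurable_enn2real emeasure_posterior_measurable B)
  have emp: "emeasure (posterior y) B = ennreal (measure (posterior y) B)" for y
  proof -
    interpret P: prob_space "posterior y" by (rule prob_space_posterior)
    show ?thesis by (rule P.emeasure_eq_measure)
  qed
  have le1: "measure (posterior y) B \<le> 1" for y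
    by (rule prob_space.prob_le_1[OF prob_space_posterior])
  have mps: "(\<lambda>\<omega>. measure (posterior (sample \<omega>)) B) \<in> borel_measurable M"
    by (rule measurable_compose[OF measurable_sample mp])
  show "AE \<omega> in M. real_cond_exp M ?F (indicator ?E) \<omega> = measure (posterior (sample \<omega>)) B"
  proof (rule F.real_cond_exp_charact)
    fix A assume "A \<in> sets ?F"
    then obtain D where D: "D \<in> sets sample_space" and A: "A = sample -` D \<inter> space M" unfolding sF by auto
    have As [measurable]: "A \<in> sets M" unfolding A by (rule measurable_sets[OF measurable_sample D])
    have "(\<integral>\<omega>\<in>A. indicator ?E \<omega> \<partial>M) = (\<integral>\<omega>. indicator (A \<inter> ?E) \<omega> \<partial>M)"
      unfolding set_lebesgue_integral_def by (intro Bochner_Integration.integral_cong) (auto simp: indicator_def)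
    also have "\<dots> = M.prob (A \<inter> ?E \<inter> space M)" by (rule Bochner_Integration.integral_indicator)
    also have "A \<inter> ?E \<inter> space M = A \<inter> ?E" by auto
    finally have "ennreal (\<integral>\<omega>\<in>A. indicator ?E \<omega> \<partial>M) = emeasure M (A \<inter> ?E)"
      by (simp only: M.emeasure_eq_measure)
    also have "A \<inter> ?E = {\<omega>\<in>space M. sample \<omega> \<in> D \<and> \<mu> \<omega> \<in> B}" unfolding A by auto
    also have "emeasure M \<dots> = (\<integral>\<^sup>+y. indicator D y * emeasure (posterior y) B \<partial>distr M sample_space sample)"
      by (rule bayes[OF B D])
    also have "\<dots> = (\<integral>\<^sup>+\<omega>. indicator D (sample \<omega>) * emeasure (posterior (sample \<omega>)) B \<partial>M)"
      using D emeasure_posterior_measurable[OF B] by (intro nn_integral_distr measurable_sample) auto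
    also have "\<dots> = (\<integral>\<^sup>+\<omega>. ennreal (indicator A \<omega> * measure (posterior (sample \<omega>)) B) \<partial>M)"
      unfolding emp by (intro nn_integral_cong) (auto simp: A indicator_def)
    also have "\<dots> = ennreal (\<integral>\<omega>. indicator A \<omega> * measure (posterior (sample \<omega>)) B \<partial>M)"
      using mps le1
      by (intro nn_integral_eq_integral M.integrable_const_bound[where B=1])
         (auto simp: indicator_def)
    finally show "(\<integral>\<omega>\<in>A. indicator ?E \<omega> \<partial>M) = (\<integral>\<omega>\<in>A. measure (posterior (sample \<omega>)) B \<partial>M)"
      by (subst (asm) ennreal_inj) (auto simp: set_lebesgue_integral_def intro!: integral_nonneg_AE)
  next
    show "integrable M (\<lambda>\<omega>. measure (posterior (sample \<omega>)) B)"
      using mps le1 by (intro M.integrable_const_bound[where B=1]) auto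
    show "(\<lambda>\<omega>. measure (posterior (sample \<omega>)) B) \<in> borel_measurable ?F"
      by (rule measurable_compose[OF measurable_vimage_algebra1 mp])
         (use measurable_space[OF measurable_sample] in auto)
  qed (auto simp: M.emeasure_eq_measure)
qed

end

section \<open>Posterior law, Laplace functional and beta representation\<close>

theorem proposition2p1:
  fixes H :: "'a::polish_space measure"
    and M :: "'w measure"
    and \<mu> :: "'w \<Rightarrow> 'a measure"
    and Y :: "nat \<Rightarrow> 'w \<Rightarrow> 'a"
    and \<theta> :: real and n :: nat
  assumes H: "prob_space H" "sets H = sets borel" "non_atomic H"
    and \<theta>: "\<theta> > 0" and n: "n \<ge> 1"
    and \<mu>: "gamma_process M (scale_measure (ennreal \<theta>) H) \<mu>"
    and Y: "cond_iid M (generated_algebra M \<mu> bf_measure_algebra) {1..n} Y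
              (\<lambda>\<omega>. normalize_measure (\<mu> \<omega>))"
  shows "regular_cond_distr M
           \<mu> bf_measure_algebra
           (\<lambda>\<omega>. \<lambda>i\<in>{1..n}. Y i \<omega>) (\<Pi>\<^sub>M i\<in>{1..n}. borel)
           (\<lambda>y. beta_gamma_process_law (posterior_shape \<theta> H n y) (real n))
       \<and> (\<forall>y. beta_gamma_process_law (posterior_shape \<theta> H n y) (real n) =
           density (gamma_process_law (posterior_shape \<theta> H n y))
             (\<lambda>m. ennreal (Gamma (\<theta> + real n) / Gamma \<theta> * measure m UNIV powr (- real n))))
       \<and> (\<forall>y. \<forall>g\<in>borel_measurable borel.
           (\<forall>x. 0 \<le> g x) \<longrightarrow> integrable (scale_measure (ennreal \<theta>) H) (\<lambda>x. ln (1 + g x)) \<longrightarrow>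
           laplace_functional (beta_gamma_process_law (posterior_shape \<theta> H n y) (real n)) g =
             (\<integral>v. exp (- (\<integral>x. ln (1 + 1 / (1 + v) * g x) \<partial>scale_measure (ennreal \<theta>) H)) *
                (\<Prod>z\<in>distinct_values n y. (1 + 1 / (1 + v) * g z) powi (- int (block_size n y z)))
              \<partial>gamma_gamma_law (\<theta> + real n) (real n)) \<and>
           laplace_functional (beta_gamma_process_law (posterior_shape \<theta> H n y) (real n)) g =
             (\<integral>u. exp (- (\<integral>x. ln (1 + u * g x) \<partial>scale_measure (ennreal \<theta>) H)) *
                (\<Prod>z\<in>distinct_values n y. (1 + u * g z) powi (- int (block_size n y z)))
              \<partial>beta_law \<theta> (real n)))
       \<and> (\<forall>y. indep_beta_gamma
           (beta_law \<theta> (real n) \<Otimes>\<^sub>M gamma_process_law (posterior_shape \<theta> H n y))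
           \<theta> (real n) (posterior_shape \<theta> H n y) fst snd)
       \<and> (\<forall>y (N :: 'v measure) U G.
           indep_beta_gamma N \<theta> (real n) (posterior_shape \<theta> H n y) U G \<longrightarrow>
           beta_gamma_process_law (posterior_shape \<theta> H n y) (real n) =
             distr N bf_measure_algebra (\<lambda>\<omega>. scale_measure (ennreal (U \<omega>)) (G \<omega>)) \<and>
           (\<exists>V\<in>borel_measurable N. distr N borel V = gamma_gamma_law (\<theta> + real n) (real n) \<and>
             (AE \<omega> in N. U \<omega> = 1 / (1 + V \<omega>))))
       \<and> distr (gamma_gamma_law (\<theta> + real n) (real n)) borel (\<lambda>v. 1 / (1 + v)) = beta_law \<theta> (real n)"
proof -
  interpret gamma_sample H M \<mu> Y \<theta> n
    by (rule gamma_sample.intro[OF H(1,2) \<theta> n \<mu> Y])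
  have n0: "real n > 0" using n by simp
  have sub: "measure (shape y) UNIV - real n = \<theta>" for y by simp
  show ?thesis
  proof (intro conjI allI ballI impI)
    show "posterior y =
           density (gamma_process_law (shape y))
             (\<lambda>m. ennreal (Gamma (\<theta> + real n) / Gamma \<theta> * measure m UNIV powr (- real n)))" for y
      by (simp add: beta_gamma_process_law_def)
    show "indep_beta_gamma (beta_law \<theta> (real n) \<Otimes>\<^sub>M gamma_process_law (shape y))
           \<theta> (real n) (shape y) fst snd" for y
      by (rule indep_beta_gamma_pair[OF gamma_process_shape \<theta> n0])
    show "distr (gamma_gamma_law (\<theta> + real n) (real n)) borel (\<lambda>v. 1 / (1 + v)) = beta_law \<theta> (real n)"
      using distr_gamma_gamma_law[of "real n" "\<theta> + real n"] \<theta> n0 by simp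
    fix y and N :: "'v measure" and U G
    assume ind: "indep_beta_gamma N \<theta> (real n) (shape y) U G"
    show "posterior y =
        distr N bf_measure_algebra (\<lambda>\<omega>. scale_measure (ennreal (U \<omega>)) (G \<omega>))"
    proof (rule beta_gamma_process_law_eq_scaled)
      show "indep_beta_gamma N (measure (shape y) UNIV - real n) (real n) (shape y) U G"
        unfolding sub by (rule ind)
      show "real n < measure (shape y) UNIV"
        using \<theta> by (simp only: measure_shape_UNIV)
    qed (rule finite_measure_posterior_shape[OF H(1,2)] sets_posterior_shape n0)+
    show "\<exists>V\<in>borel_measurable N. distr N borel V = gamma_gamma_law (\<theta> + real n) (real n) \<and>
        (AE \<omega> in N. U \<omega> = 1 / (1 + V \<omega>))"
    proof (rule ex_gamma_gamma_of_beta)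
      show "U \<in> borel_measurable N" "distr N borel U = beta_law (\<theta> + real n - real n) (real n)"
        using ind by (simp_all add: indep_beta_gamma_def)
    qed (use \<theta> n0 in simp_all)
  next
    show "regular_cond_distr M \<mu> bf_measure_algebra sample sample_space
        posterior"
      by (rule regular_cond_distr_posterior)
  next
    fix y and g :: "'a \<Rightarrow> real"
    assume g: "g \<in> borel_measurable borel" "\<forall>x. 0 \<le> g x"
      and int: "integrable (scale_measure (ennreal \<theta>) H) (\<lambda>x. ln (1 + g x))"
    note laplace = laplace_functional_posterior[OF H(1,2) \<theta> n \<mu> g(1) _ int, of y]
    show "laplace_functional (posterior y) g =
        (\<integral>v. exp (- (\<integral>x. ln (1 + 1 / (1 + v) * g x) \<partial>scale_measure (ennreal \<theta>) H)) *
           (\<Prod>z\<in>distinct_values n y. (1 + 1 / (1 + v) * g z) powi (- int (block_size n y z)))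
         \<partial>gamma_gamma_law (\<theta> + real n) (real n))"
      using g(2) by (intro laplace(2)) simp
    show "laplace_functional (posterior y) g =
        (\<integral>u. exp (- (\<integral>x. ln (1 + u * g x) \<partial>scale_measure (ennreal \<theta>) H)) *
           (\<Prod>z\<in>distinct_values n y. (1 + u * g z) powi (- int (block_size n y z)))
         \<partial>beta_law \<theta> (real n))"
      using g(2) by (intro laplace(1)) simp
  qed
qed

end
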